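(* Let $d\in\{1,2,3\}$, $\alpha\in(0,2)$, $\lambda\ge 0$. Let $u\in C^s(\mathbb{R}^d)$ be compactly supported with $s\ge 8$. Let $L>0$ and let $w\in C^\gamma([0,\infty))$, with $\gamma\ge 4$ an integer, satisfy $0\le w(\rho)\le 1$, $w(\rho)=0$ for $\rho\ge L$, and $w(\rho)=1+O(\rho^\gamma)$ as $\rho\to 0$. Let $(-\Delta)_\lambda^{\alpha/2}$ be the tempered fractional Laplacian and $(-\Delta_h)_\lambda^{\alpha/2}$ its weighted integral-regularized finite difference (WIRFD) discretization with window function $w$ (both defined in the context). Then there is a constant $C>0$ independent of $h$ such that, for all sufficiently small $h>0$ (of the form $h=2/N_1$, $N_1$ a positive integer), $$\left\|(-\Delta)_{\lambda}^{\frac{\alpha}{2}}U-(-\Delta_h)_{\lambda}^{\frac{\alpha}{2}}U\right\|_{l^\infty(\Omega_h)}:=\max_{x\in\Omega_h}\left|(-\Delta)_{\lambda}^{\frac{\alpha}{2}}u(x)-(-\Delta_h)_{\lambda}^{\frac{\alpha}{2}}u(x)\right|\le C h^{4-\alpha}.$$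
   Context: Tempered fractional Laplacian: $$(-\Delta)_{\lambda}^{\frac{\alpha}{2}}u(x)=C_{d,\alpha}\,\mathrm{P.V.}\int_{\mathbb{R}^d}\frac{u(x)-u(y)}{e^{\lambda|x-y|}|x-y|^{d+\alpha}}\,dy,$$ where P.V. denotes the Cauchy principal value, $|\cdot|$ is the Euclidean norm, and $C_{d,\alpha}=\dfrac{\alpha\,\Gamma(\frac{d+\alpha}{2})}{2^{1-\alpha}\pi^{d/2}\Gamma(1-\frac{\alpha}{2})}$ if $\lambda=0$ or $\alpha=1$, and $C_{d,\alpha}=\dfrac{\Gamma(\frac d2)}{2\pi^{d/2}|\Gamma(-\alpha)|}$ if $\lambda>0$ and $\alpha\neq 1$. Grid: $\Omega=(-1,1)^d$, $h=2/N_1$ with $N_1$ a positive integer, $\Omega_h=\{(-1+j_1h,\ldots,-1+j_dh): 1\le j_l\le N_1-1,\ l=1,\ldots,d\}$, and $y_j=jh$ for $j\in\mathbb{Z}^d$. $U$ is the grid function of values of $u$ on $\Omega_h$; operators applied to $U$ denote the grid functions of values at points of $\Omega_h$. WIRFD scheme: for $x\in\Omega_h$, $$(-\Delta_h)_{\lambda}^{\frac{\alpha}{2}}u(x)=C_{d,\alpha}h^d\left((S_{1,h}-S_1)\Delta_hu(x)+S_2u(x)-\sum_{j\in\mathbb{Z}^d\setminus\{0\}}\frac{u(x+y_j)}{e^{\lambda|y_j|}|y_j|^{d+\alpha}}\right),$$ where $$S_{1,h}=\frac{1}{2d}\sum_{j\in\mathbb{Z}^d\setminus\{0\}}\frac{w(|y_j|)}{e^{\lambda|y_j|}|y_j|^{d+\alpha-2}},\qquad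 S_1=\frac{1}{2dh^d}\int_{[-L,L]^d}\frac{w(|y|)}{e^{\lambda|y|}|y|^{d+\alpha-2}}\,dy,\qquad S_2=\sum_{j\in\mathbb{Z}^d\setminus\{0\}}\frac{1}{e^{\lambda|y_j|}|y_j|^{d+\alpha}},$$ and $\Delta_hu(x)=\frac{1}{h^2}\sum_{l=1}^d\left[u(x-e_lh)-2u(x)+u(x+e_lh)\right]$, with $e_l$ the standard basis vectors of $\mathbb{R}^d$. *)

theory Defs
  imports "HOL-Analysis.Analysis" "HOL-Library.Landau_Symbols"
begin

(* The class C^k on S. Derivatives are taken within S, hence one-sided at
   boundary points such as 0 in {0..}. On the sets used here, UNIV and {0..},
   the derivative D is uniquely determined by f. *)
primrec C_k_on :: "nat \<Rightarrow> 'a::real_normed_vector set \<Rightarrow> ('a \<Rightarrow> real) \<Rightarrow> bool" where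
  "C_k_on 0 S f \<longleftrightarrow> continuous_on S f"
| "C_k_on (Suc k) S f \<longleftrightarrow>
     (\<exists>D. (\<forall>x\<in>S. (f has_derivative D x) (at x within S)) \<and>
          (\<forall>v. C_k_on k S (\<lambda>x. D x v)))"

definition compactly_supported :: "('a::topological_space \<Rightarrow> real) \<Rightarrow> bool" where
  "compactly_supported f \<longleftrightarrow> compact (closure {x. f x \<noteq> 0})"

definition pv_integral :: "(real ^ 'n \<Rightarrow> real) \<Rightarrow> real ^ 'n \<Rightarrow> real" where
  "pv_integral f x = Lim (at_right 0) (\<lambda>\<epsilon>. LINT y:{y. \<epsilon> < norm (x - y)}|lborel. f y)"

definition frac_const :: "nat \<Rightarrow> real \<Rightarrow> real \<Rightarrow> real" where
  "frac_const d \<alpha> lam =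
     (if lam = 0 \<or> \<alpha> = 1
      then \<alpha> * Gamma ((real d + \<alpha>) / 2) /
             (2 powr (1 - \<alpha>) * pi powr (real d / 2) * Gamma (1 - \<alpha> / 2))
      else Gamma (real d / 2) / (2 * pi powr (real d / 2) * \<bar>Gamma (- \<alpha>)\<bar>))"

definition tempered_frac_laplacian ::
    "real \<Rightarrow> real \<Rightarrow> (real ^ 'n \<Rightarrow> real) \<Rightarrow> real ^ 'n \<Rightarrow> real" where
  "tempered_frac_laplacian \<alpha> lam u x =
     frac_const CARD('n) \<alpha> lam *
     pv_integral (\<lambda>y. (u x - u y) /
       (exp (lam * norm (x - y)) * norm (x - y) powr (real CARD('n) + \<alpha>))) x"

definition lattice_point :: "real \<Rightarrow> int ^ 'n \<Rightarrow> real ^ 'n" where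
  "lattice_point h j = (\<chi> l. of_int (j $ l) * h)"

definition discrete_laplacian :: "real \<Rightarrow> (real ^ 'n \<Rightarrow> real) \<Rightarrow> real ^ 'n \<Rightarrow> real" where
  "discrete_laplacian h u x =
     1 / h\<^sup>2 * (\<Sum>l\<in>UNIV. u (x - h *\<^sub>R axis l 1) - 2 * u x + u (x + h *\<^sub>R axis l 1))"

(* The dimension d is CARD('n); the type argument T only fixes 'n. *)
definition wirfd_S1h ::
    "'n::finite itself \<Rightarrow> (real \<Rightarrow> real) \<Rightarrow> real \<Rightarrow> real \<Rightarrow> real \<Rightarrow> real" where
  "wirfd_S1h T w \<alpha> lam h =
     1 / (2 * real CARD('n)) *
     (\<Sum>\<^sub>\<infinity>j\<in>UNIV - {0 :: int ^ 'n}. w (norm (lattice_point h j)) /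
        (exp (lam * norm (lattice_point h j)) *
         norm (lattice_point h j) powr (real CARD('n) + \<alpha> - 2)))"

definition wirfd_S1 ::
    "'n::finite itself \<Rightarrow> (real \<Rightarrow> real) \<Rightarrow> real \<Rightarrow> real \<Rightarrow> real \<Rightarrow> real \<Rightarrow> real" where
  "wirfd_S1 T w L \<alpha> lam h =
     1 / (2 * real CARD('n) * h ^ CARD('n)) *
     (LINT y:cbox (\<chi> l. - L) ((\<chi> l. L) :: real ^ 'n)|lborel. w (norm y) /
        (exp (lam * norm y) * norm y powr (real CARD('n) + \<alpha> - 2)))"

definition wirfd_S2 :: "'n::finite itself \<Rightarrow> real \<Rightarrow> real \<Rightarrow> real \<Rightarrow> real" where
  "wirfd_S2 T \<alpha> lam h =
     (\<Sum>\<^sub>\<infinity>j\<in>UNIV - {0 :: int ^ 'n}. 1 /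
        (exp (lam * norm (lattice_point h j)) *
         norm (lattice_point h j) powr (real CARD('n) + \<alpha>)))"

definition wirfd ::
    "(real \<Rightarrow> real) \<Rightarrow> real \<Rightarrow> real \<Rightarrow> real \<Rightarrow> real \<Rightarrow> (real ^ 'n \<Rightarrow> real) \<Rightarrow> real ^ 'n \<Rightarrow> real" where
  "wirfd w L \<alpha> lam h u x =
     frac_const CARD('n) \<alpha> lam * h ^ CARD('n) *
     ((wirfd_S1h TYPE('n) w \<alpha> lam h - wirfd_S1 TYPE('n) w L \<alpha> lam h) * discrete_laplacian h u x
      + wirfd_S2 TYPE('n) \<alpha> lam h * u x
      - (\<Sum>\<^sub>\<infinity>j\<in>UNIV - {0}. u (x + lattice_point h j) /
           (exp (lam * norm (lattice_point h j)) *
            norm (lattice_point h j) powr (real CARD('n) + \<alpha>))))"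

definition mesh_size :: "nat \<Rightarrow> real" where
  "mesh_size N = 2 / real N"

definition grid :: "nat \<Rightarrow> (real ^ 'n) set" where
  "grid N = {(\<chi> l. - 1 + of_int (j $ l) * mesh_size N) | j :: int ^ 'n.
               \<forall>l. 1 \<le> j $ l \<and> j $ l \<le> int N - 1}"

(* Meaningful for finite nonempty G; grid N is finite, and nonempty iff N \<ge> 2. *)
definition linf_norm :: "'a set \<Rightarrow> ('a \<Rightarrow> real) \<Rightarrow> real" where
  "linf_norm G f = Max ((\<lambda>x. \<bar>f x\<bar>) ` G)"

end

theory Submission
  imports Defs
begin

text \<open>
  Write \<open>K(y) = exp(-\<lambda>|y|) / |y|^(d+\<alpha>)\<close>, \<open>A(y) = u(x) - (u(x + y) + u(x - y)) / 2\<close>, \<open>q\<close> for half the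
  Hessian form of \<open>u\<close> at \<open>x\<close>, and \<open>W(y) = w(|y|) |y|^2 K(y)\<close>. Let \<open>E f\<close> be the integral of \<open>f\<close> minus
  \<open>h^d\<close> times its sum over the nonzero points of the lattice of mesh \<open>h\<close>. Since \<open>w K\<close> is radial, the
  regularization \<open>w |y|^2 \<Delta>u / (2d)\<close> may be replaced by \<open>w q\<close> both in the integral and in the sum,
  so the consistency error is \<open>E((A + w q) K) + (\<Delta>\<^sub>h u - \<Delta>u) / (2d) E(W)\<close> up to a constant factor.
  Here \<open>A + q\<close> vanishes to fourth order at the origin and \<open>w - 1\<close> to second order, so both arguments
  of \<open>E\<close> behave, for four derivatives, like homogeneous functions of degree \<open>m = 4 - d - \<alpha>\<close> and
  \<open>m = 2 - d - \<alpha>\<close>. For such functions \<open>E\<close> is \<open>O(h^(m+d))\<close>: away from the origin the fourth-order local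
  errors form a convergent lattice sum, and near it integral and summands are themselves of that size.
  Together with \<open>\<Delta>\<^sub>h u - \<Delta>u = O(h^2)\<close> this gives \<open>O(h^(4-\<alpha>))\<close>.
\<close>

section \<open>Symbol classes\<close>

text \<open>The bound has to be uniform in the point x and in the mesh h, so both are carried as
  parameters of a symbol class: x ranges over \<open>P\<close>, and the scale h is adjoined to it by
  rescaling. A symbol bound of order m with m + d > 0 gives no convergent integral at infinity. Each
  function therefore also comes with a decay of order s < -d, which stems from the boundedness of u
  and the support of w. The constant of that decay may depend on the parameters, because it only
  justifies convergence and does not survive into the error bound. The midpoint rule on a cell has a
  second-order error of size |y|^(m-2), and for m = 4 - d - \<alpha> these errors are not summable
  over the lattice. Hence the second-order terms are not estimated but made to cancel exactly, and
  what remains has size |y|^(m-4). Its summability requires m < 4 - d, which for this m is \<alpha>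
  > 0; integrability of order m = 2 - d - \<alpha> at the origin is \<alpha> < 2.\<close>

text \<open>The derivatives of order \<open>i \<le> k\<close> are \<open>O(|y|^(m-i))\<close> away from the origin,
  uniformly over the parameters \<open>p \<in> P\<close>; the function \<open>g l\<close> is the \<open>l\<close>-th partial derivative.
  Values at the origin are irrelevant.\<close>

primrec symbol :: "nat \<Rightarrow> 'p set \<Rightarrow> real \<Rightarrow> ('p \<Rightarrow> real ^ 'n \<Rightarrow> real) \<Rightarrow> bool" where
  "symbol 0 P m f \<longleftrightarrow> (\<exists>M. \<forall>p\<in>P. \<forall>y. y \<noteq> 0 \<longrightarrow> \<bar>f p y\<bar> \<le> M * norm y powr m)"
| "symbol (Suc k) P m f \<longleftrightarrow> (\<exists>M. \<forall>p\<in>P. \<forall>y. y \<noteq> 0 \<longrightarrow> \<bar>f p y\<bar> \<le> M * norm y powr m) \<and>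
     (\<exists>g. (\<forall>p\<in>P. \<forall>y. y \<noteq> 0 \<longrightarrow> (f p has_derivative (\<lambda>v. \<Sum>l\<in>UNIV. v $ l * g l p y)) (at y)) \<and>
          (\<forall>l. symbol k P (m - 1) (g l)))"

lemma symbol_boundE:
  assumes "symbol k P m f"
  obtains M where "M \<ge> 0" "\<And>p y. p \<in> P \<Longrightarrow> y \<noteq> 0 \<Longrightarrow> \<bar>f p y\<bar> \<le> M * norm y powr m"
proof -
  have "\<exists>M. \<forall>p\<in>P. \<forall>y. y \<noteq> 0 \<longrightarrow> \<bar>f p y\<bar> \<le> M * norm y powr m"
    using assms by (cases k) auto
  then obtain M where M: "\<forall>p\<in>P. \<forall>y. y \<noteq> 0 \<longrightarrow> \<bar>f p y\<bar> \<le> M * norm y powr m"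
    by blast
  have "\<bar>f p y\<bar> \<le> max M 0 * norm y powr m" if "p \<in> P" "y \<noteq> 0" for p y
    using M that by (smt (verit) mult_right_mono powr_ge_zero)
  then show ?thesis using that[of "max M 0"] by auto
qed

lemma symbol_0I:
  assumes "\<And>p y. p \<in> P \<Longrightarrow> y \<noteq> 0 \<Longrightarrow> \<bar>f p y\<bar> \<le> M * norm y powr m"
  shows "symbol 0 P m f"
  using assms by auto

lemma symbol_SucI:
  assumes "symbol 0 P m f"
    and "\<And>p y. p \<in> P \<Longrightarrow> y \<noteq> 0 \<Longrightarrow>
           (f p has_derivative (\<lambda>v. \<Sum>l\<in>UNIV. v $ l * g l p y)) (at y)"
    and "\<And>l. symbol k P (m - 1) (g l)"
  shows "symbol (Suc k) P m f"
  using assms by auto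

lemma symbol_SucE:
  assumes "symbol (Suc k) P m f"
  obtains g where "\<And>p y. p \<in> P \<Longrightarrow> y \<noteq> 0 \<Longrightarrow>
           (f p has_derivative (\<lambda>v. \<Sum>l\<in>UNIV. v $ l * g l p y)) (at y)"
    and "\<And>l. symbol k P (m - 1) (g l)"
  using assms that unfolding symbol.simps by blast

lemma symbol_imp_0: "symbol k P m f \<Longrightarrow> symbol 0 P m f"
  by (cases k) auto

lemma symbol_Suc_imp: "symbol (Suc k) P m f \<Longrightarrow> symbol k P m f"
proof (induction k arbitrary: m f)
  case 0
  then show ?case by auto
next
  case (Suc k)
  then obtain g where g: "\<And>p y. p \<in> P \<Longrightarrow> y \<noteq> 0 \<Longrightarrow>
           (f p has_derivative (\<lambda>v. \<Sum>l\<in>UNIV. v $ l * g l p y)) (at y)"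
    "\<And>l. symbol (Suc k) P (m - 1) (g l)"
    by (elim symbol_SucE) blast
  show ?case
    using symbol_imp_0[OF Suc.prems] g(1) Suc.IH[OF g(2)] by (rule symbol_SucI[where g = g])
qed

lemma symbol_cong:
  assumes "symbol k P m f" "\<And>p y. p \<in> P \<Longrightarrow> y \<noteq> 0 \<Longrightarrow> f p y = f' p y"
  shows "symbol k P m f'"
proof (cases k)
  case 0
  then show ?thesis using assms by auto
next
  case (Suc k')
  obtain g where g: "\<And>p y. p \<in> P \<Longrightarrow> y \<noteq> 0 \<Longrightarrow>
           (f p has_derivative (\<lambda>v. \<Sum>l\<in>UNIV. v $ l * g l p y)) (at y)"
    "\<And>l. symbol k' P (m - 1) (g l)"
    using symbol_SucE[OF assms(1)[unfolded Suc]] by blast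
  have "(f' p has_derivative (\<lambda>v. \<Sum>l\<in>UNIV. v $ l * g l p y)) (at y)" if "p \<in> P" "y \<noteq> 0" for p y
    by (rule has_derivative_transform_within_open[OF g(1)[OF that], of "- {0}"])
       (use that assms(2) in auto)
  moreover have "symbol 0 P m f'"
    using symbol_imp_0[OF assms(1)] assms(2) by auto
  ultimately show ?thesis unfolding Suc using g(2) by (intro symbol_SucI[where g = g])
qed

lemma symbol_add:
  assumes "symbol k P m f" "symbol k P m g"
  shows "symbol k P m (\<lambda>p y. f p y + g p y)"
  using assms
proof (induction k arbitrary: m f g)
  case 0
  from 0 obtain M N where M: "\<And>p y. p \<in> P \<Longrightarrow> y \<noteq> 0 \<Longrightarrow> \<bar>f p y\<bar> \<le> M * norm y powr m"
    and N: "\<And>p y. p \<in> P \<Longrightarrow> y \<noteq> 0 \<Longrightarrow> \<bar>g p y\<bar> \<le> N * norm y powr m"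
    unfolding symbol.simps by blast
  show ?case
    by (rule symbol_0I[where M = "M + N"])
       (use M N in \<open>smt (verit) distrib_right\<close>)
next
  case (Suc k)
  obtain f1 where f1: "\<And>p y. p \<in> P \<Longrightarrow> y \<noteq> 0 \<Longrightarrow>
           (f p has_derivative (\<lambda>v. \<Sum>l\<in>UNIV. v $ l * f1 l p y)) (at y)"
    "\<And>l. symbol k P (m - 1) (f1 l)"
    using symbol_SucE[OF Suc.prems(1)] by blast
  obtain g1 where g1: "\<And>p y. p \<in> P \<Longrightarrow> y \<noteq> 0 \<Longrightarrow>
           (g p has_derivative (\<lambda>v. \<Sum>l\<in>UNIV. v $ l * g1 l p y)) (at y)"
    "\<And>l. symbol k P (m - 1) (g1 l)"
    using symbol_SucE[OF Suc.prems(2)] by blast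
  show ?case
  proof (rule symbol_SucI)
    show "symbol 0 P m (\<lambda>p y. f p y + g p y)"
      using Suc.IH[OF symbol_Suc_imp symbol_Suc_imp, OF Suc.prems] by (rule symbol_imp_0)
    show "((\<lambda>y. f p y + g p y) has_derivative (\<lambda>v. \<Sum>l\<in>UNIV. v $ l * (f1 l p y + g1 l p y))) (at y)"
      if "p \<in> P" "y \<noteq> 0" for p y
      using has_derivative_add[OF f1(1)[OF that] g1(1)[OF that]]
      by (simp add: distrib_left sum.distrib)
    show "symbol k P (m - 1) (\<lambda>p y. f1 l p y + g1 l p y)" for l
      by (rule Suc.IH[OF f1(2) g1(2)])
  qed
qed

lemma symbol_mult:
  assumes "symbol k P m f" "symbol k P n g"
  shows "symbol k P (m + n) (\<lambda>p y. f p y * g p y)"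
  using assms
proof (induction k arbitrary: m n f g)
  case 0
  obtain M where M: "M \<ge> 0" "\<And>p y. p \<in> P \<Longrightarrow> y \<noteq> 0 \<Longrightarrow> \<bar>f p y\<bar> \<le> M * norm y powr m"
    using symbol_boundE[OF 0(1)] by blast
  obtain N where N: "N \<ge> 0" "\<And>p y. p \<in> P \<Longrightarrow> y \<noteq> 0 \<Longrightarrow> \<bar>g p y\<bar> \<le> N * norm y powr n"
    using symbol_boundE[OF 0(2)] by blast
  show ?case
  proof (rule symbol_0I[where M = "M * N"])
    fix p y assume py: "p \<in> P" "(y::real^'b) \<noteq> 0"
    have "\<bar>f p y * g p y\<bar> \<le> (M * norm y powr m) * (N * norm y powr n)"
      unfolding abs_mult by (rule mult_mono) (use M N py in auto)
    then show "\<bar>f p y * g p y\<bar> \<le> M * N * norm y powr (m + n)"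
      by (simp add: powr_add mult_ac)
  qed
next
  case (Suc k)
  obtain f1 where f1: "\<And>p y. p \<in> P \<Longrightarrow> y \<noteq> 0 \<Longrightarrow>
           (f p has_derivative (\<lambda>v. \<Sum>l\<in>UNIV. v $ l * f1 l p y)) (at y)"
    "\<And>l. symbol k P (m - 1) (f1 l)"
    using symbol_SucE[OF Suc.prems(1)] by blast
  obtain g1 where g1: "\<And>p y. p \<in> P \<Longrightarrow> y \<noteq> 0 \<Longrightarrow>
           (g p has_derivative (\<lambda>v. \<Sum>l\<in>UNIV. v $ l * g1 l p y)) (at y)"
    "\<And>l. symbol k P (n - 1) (g1 l)"
    using symbol_SucE[OF Suc.prems(2)] by blast
  have fk: "symbol k P m f" and gk: "symbol k P n g"
    using symbol_Suc_imp Suc.prems by blast+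
  show ?case
  proof (rule symbol_SucI)
    show "symbol 0 P (m + n) (\<lambda>p y. f p y * g p y)"
      using Suc.IH[OF fk gk] by (rule symbol_imp_0)
    show "((\<lambda>y. f p y * g p y) has_derivative
            (\<lambda>v. \<Sum>l\<in>UNIV. v $ l * (f p y * g1 l p y + f1 l p y * g p y))) (at y)"
      if "p \<in> P" "y \<noteq> 0" for p y
      using has_derivative_mult[OF f1(1)[OF that] g1(1)[OF that]]
      by (simp add: distrib_left sum.distrib sum_distrib_left sum_distrib_right mult_ac)
    show "symbol k P (m + n - 1) (\<lambda>p y. f p y * g1 l p y + f1 l p y * g p y)" for l
    proof -
      have "symbol k P (m + n - 1) (\<lambda>p y. f p y * g1 l p y)"
        using Suc.IH[OF fk g1(2)] by (simp add: algebra_simps)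
      moreover have "symbol k P (m + n - 1) (\<lambda>p y. f1 l p y * g p y)"
        using Suc.IH[OF f1(2) gk] by (simp add: algebra_simps)
      ultimately show ?thesis by (rule symbol_add)
    qed
  qed
qed

lemma symbol_zero: "symbol k P m (\<lambda>p y. 0 :: real)"
proof (induction k arbitrary: m)
  case 0
  show ?case by (rule symbol_0I[where M = 0]) auto
next
  case (Suc k)
  show ?case
    by (rule symbol_SucI[where g = "\<lambda>l p y. 0"], rule symbol_0I[where M = 0]) (auto intro!: Suc.IH)
qed

lemma symbol_const:
  assumes "\<And>p. p \<in> P \<Longrightarrow> \<bar>c p\<bar> \<le> M"
  shows "symbol k P 0 (\<lambda>p y. c p)"
proof (cases k)
  case 0
  show ?thesis unfolding 0 by (rule symbol_0I[where M = M]) (use assms in auto)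
next
  case (Suc k')
  show ?thesis unfolding Suc
    by (rule symbol_SucI[where g = "\<lambda>l p y. 0"], rule symbol_0I[where M = M]) (auto intro!: symbol_zero assms)
qed

lemma symbol_coord: "symbol k P 1 (\<lambda>p (y::real^'n). y $ i)"
proof (cases k)
  case 0
  show ?thesis unfolding 0 by (rule symbol_0I[where M = 1]) (auto simp: component_le_norm_cart)
next
  case (Suc k')
  have eq: "(\<Sum>l\<in>UNIV. v $ l * (if l = i then 1 else 0)) = v $ i" for v :: "real^'n"
    by (simp add: if_distrib cong: if_cong)
  show ?thesis unfolding Suc
  proof (rule symbol_SucI[where g = "\<lambda>l p y. if l = i then 1 else 0"])
    show "symbol 0 P 1 (\<lambda>p y. y $ i)"
      by (rule symbol_0I[where M = 1]) (auto simp: component_le_norm_cart)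
    show "((\<lambda>y. y $ i) has_derivative (\<lambda>v. \<Sum>l\<in>UNIV. v $ l * (if l = i then 1 else 0))) (at y)"
      for y :: "real^'n"
      unfolding eq by (rule bounded_linear_imp_has_derivative) (rule bounded_linear_vec_nth)
    show "symbol k' P (1 - 1) (\<lambda>p y. if l = i then 1 else 0)" for l
      using symbol_const[of P "\<lambda>_. if l = i then 1 else 0" 1] by auto
  qed
qed

lemma symbol_sum:
  assumes "finite I" "\<And>i. i \<in> I \<Longrightarrow> symbol k P m (f i)"
  shows "symbol k P m (\<lambda>p y. \<Sum>i\<in>I. f i p y)"
  using assms by (induction I rule: finite_induct) (auto intro: symbol_zero symbol_add)

text \<open>Each differentiation in \<open>y\<close> brings out one factor of the scale, which turns
  \<open>h powr (- m)\<close> into \<open>h powr (- (m - 1))\<close>, the normalisation that belongs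
  to the next order. The constants are thus the same at every scale, and the scale can be adjoined
  to the parameter set.\<close>

lemma symbol_scale:
  assumes "symbol k P m f"
  shows "symbol k (P \<times> {0<..}) m (\<lambda>p y. snd p powr (- m) * f (fst p) (snd p *\<^sub>R y))"
  using assms
proof (induction k arbitrary: m f)
  case 0
  obtain M where M: "M \<ge> 0" "\<And>p y. p \<in> P \<Longrightarrow> y \<noteq> 0 \<Longrightarrow> \<bar>f p y\<bar> \<le> M * norm y powr m"
    using symbol_boundE[OF 0] by blast
  show ?case
  proof (rule symbol_0I[where M = M])
    fix p :: "'a \<times> real" and y :: "real^'b" assume p: "p \<in> P \<times> {0<..}" and y: "y \<noteq> 0"
    then have h: "snd p > 0" "fst p \<in> P" by auto
    have "\<bar>f (fst p) (snd p *\<^sub>R y)\<bar> \<le> M * norm (snd p *\<^sub>R y) powr m"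
      using M(2)[of "fst p" "snd p *\<^sub>R y"] h y by auto
    also have "\<dots> = M * (snd p powr m * norm y powr m)"
      using h by (simp add: powr_mult)
    finally have "snd p powr (- m) * \<bar>f (fst p) (snd p *\<^sub>R y)\<bar>
       \<le> snd p powr (- m) * (M * (snd p powr m * norm y powr m))"
      by (rule mult_left_mono) auto
    also have "\<dots> = M * norm y powr m"
      using h by (simp add: powr_minus field_simps)
    finally show "\<bar>snd p powr (- m) * f (fst p) (snd p *\<^sub>R y)\<bar> \<le> M * norm y powr m"
      by (simp add: abs_mult)
  qed
next
  case (Suc k)
  obtain g where g: "\<And>p y. p \<in> P \<Longrightarrow> y \<noteq> 0 \<Longrightarrow>
           (f p has_derivative (\<lambda>v. \<Sum>l\<in>UNIV. v $ l * g l p y)) (at y)"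
    "\<And>l. symbol k P (m - 1) (g l)"
    using symbol_SucE[OF Suc.prems] by blast
  show ?case
  proof (rule symbol_SucI)
    show "symbol 0 (P \<times> {0<..}) m (\<lambda>p y. snd p powr (- m) * f (fst p) (snd p *\<^sub>R y))"
      by (rule symbol_imp_0[OF Suc.IH[OF symbol_Suc_imp[OF Suc.prems]]])
    show "symbol k (P \<times> {0<..}) (m - 1) (\<lambda>p y. snd p powr (- (m - 1)) * g l (fst p) (snd p *\<^sub>R y))" for l
      by (rule Suc.IH[OF g(2)])
    fix p :: "'a \<times> real" and y :: "real^'b" assume p: "p \<in> P \<times> {0<..}" and y: "y \<noteq> 0"
    then have h: "snd p > 0" "fst p \<in> P" by auto
    have "((\<lambda>y. f (fst p) (snd p *\<^sub>R y)) has_derivative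
            (\<lambda>v. \<Sum>l\<in>UNIV. (snd p *\<^sub>R v) $ l * g l (fst p) (snd p *\<^sub>R y))) (at y)"
      by (rule has_derivative_compose[of "\<lambda>y. snd p *\<^sub>R y", OF _ g(1)])
         (use h y in \<open>auto intro!: derivative_eq_intros\<close>)
    from has_derivative_mult_right[OF this, of "snd p powr (- m)"]
    show "((\<lambda>y. snd p powr (- m) * f (fst p) (snd p *\<^sub>R y)) has_derivative
            (\<lambda>v. \<Sum>l\<in>UNIV. v $ l * (snd p powr (- (m - 1)) * g l (fst p) (snd p *\<^sub>R y)))) (at y)"
      using h by (simp add: sum_distrib_left mult_ac powr_diff powr_minus field_simps)
  qed
qed

section \<open>Radial symbols: powers, the exponential, and the passage to functions of the
  norm\<close>

primrec radial_symbol :: "nat \<Rightarrow> real \<Rightarrow> (real \<Rightarrow> real) \<Rightarrow> bool" where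
  "radial_symbol 0 m f \<longleftrightarrow> (\<exists>M. \<forall>r>0. \<bar>f r\<bar> \<le> M * r powr m)"
| "radial_symbol (Suc k) m f \<longleftrightarrow> (\<exists>M. \<forall>r>0. \<bar>f r\<bar> \<le> M * r powr m) \<and>
     (\<exists>g. (\<forall>r>0. (f has_real_derivative g r) (at r)) \<and> radial_symbol k (m - 1) g)"

lemma radial_symbol_SucI:
  assumes "\<And>r. r > 0 \<Longrightarrow> \<bar>f r\<bar> \<le> M * r powr m"
    and "\<And>r. r > 0 \<Longrightarrow> (f has_real_derivative g r) (at r)"
    and "radial_symbol k (m - 1) g"
  shows "radial_symbol (Suc k) m f"
  using assms by auto

lemma radial_symbol_0I:
  assumes "\<And>r. r > 0 \<Longrightarrow> \<bar>f r\<bar> \<le> M * r powr m"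
  shows "radial_symbol 0 m f"
  using assms by auto

lemma radial_symbol_powr: "radial_symbol k m (\<lambda>r. c * r powr m)"
proof (induction k arbitrary: c m)
  case 0
  show ?case by (rule radial_symbol_0I[where M = "\<bar>c\<bar>"]) (auto simp: abs_mult)
next
  case (Suc k)
  show ?case
  proof (rule radial_symbol_SucI[where M = "\<bar>c\<bar>" and g = "\<lambda>r. (c * m) * r powr (m - 1)"])
    show "radial_symbol k (m - 1) (\<lambda>r. (c * m) * r powr (m - 1))" by (rule Suc.IH)
    show "((\<lambda>r. c * r powr m) has_real_derivative (c * m) * r powr (m - 1)) (at r)" if "r > 0" for r
      using that by (auto intro!: derivative_eq_intros simp: powr_diff field_simps)
  qed (auto simp: abs_mult)
qed

text \<open>For \<open>r \<le> 1\<close> the power is at least 1 because its exponent is not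
  positive. For larger \<open>r\<close> a single term of the exponential series, of degree
  \<open>n \<ge> - m\<close>, already dominates.\<close>

lemma exp_minus_le_powr:
  fixes lam m :: real
  assumes "lam > 0" "m \<le> 0"
  obtains M where "\<And>r. r > 0 \<Longrightarrow> exp (- (lam * r)) \<le> M * r powr m"
proof -
  obtain n :: nat where n: "- m \<le> real n" using real_arch_simple by blast
  define M where "M = max 1 (fact n / lam ^ n)"
  have "exp (- (lam * r)) \<le> M * r powr m" if r: "r > 0" for r
  proof (cases "r \<le> 1")
    case True
    have "r powr m \<ge> r powr 0"
      by (rule powr_mono') (use True r assms in auto)
    then have "1 * 1 \<le> M * r powr m"
      by (intro mult_mono) (use r in \<open>auto simp: M_def\<close>)
    moreover have "exp (- (lam * r)) \<le> 1" using assms r by simp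
    ultimately show ?thesis by linarith
  next
    case False
    have pos: "0 < fact n * exp (lam * r)" by simp
    have "(lam * r) ^ n / fact n \<le> exp (lam * r)"
    proof -
      have "sum (\<lambda>n. (lam * r) ^ n /\<^sub>R fact n) {n} \<le> (\<Sum>n. (lam * r) ^ n /\<^sub>R fact n)"
        by (rule sum_le_suminf[OF summable_exp_generic]) (use assms r in auto)
      then show ?thesis by (simp add: exp_def field_simps)
    qed
    then have "exp (- (lam * r)) \<le> fact n / (lam * r) ^ n"
      using assms r by (simp add: exp_minus field_simps)
    also have "\<dots> = fact n / lam ^ n * r powr (- real n)"
      using r by (simp add: powr_minus powr_realpow power_mult_distrib field_simps)
    also have "\<dots> \<le> M * r powr m"
      by (intro mult_mono powr_mono) (use False n assms in \<open>auto simp: M_def\<close>)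
    finally show ?thesis .
  qed
  then show ?thesis using that by blast
qed

lemma radial_symbol_exp_pos:
  assumes "lam > 0" "m \<le> 0"
  shows "radial_symbol k m (\<lambda>r. c * exp (- (lam * r)))"
  using assms(2)
proof (induction k arbitrary: c m)
  case 0
  obtain M where M: "\<And>r. r > 0 \<Longrightarrow> exp (- (lam * r)) \<le> M * r powr m"
    using exp_minus_le_powr[OF assms(1) 0] by blast
  show ?case
    by (rule radial_symbol_0I[where M = "\<bar>c\<bar> * M"]) (use M in \<open>auto simp: abs_mult mult.assoc intro!: mult_left_mono\<close>)
next
  case (Suc k)
  obtain M where M: "\<And>r. r > 0 \<Longrightarrow> exp (- (lam * r)) \<le> M * r powr m"
    using exp_minus_le_powr[OF assms(1) Suc.prems] by blast
  show ?case
  proof (rule radial_symbol_SucI[where M = "\<bar>c\<bar> * M"])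
    show "\<bar>c * exp (- (lam * r))\<bar> \<le> \<bar>c\<bar> * M * r powr m" if "r > 0" for r
      using M[OF that] by (auto simp: abs_mult mult.assoc intro!: mult_left_mono)
    show "((\<lambda>r. c * exp (- (lam * r))) has_real_derivative (- c * lam) * exp (- (lam * r))) (at r)" for r
      by (auto intro!: derivative_eq_intros)
    show "radial_symbol k (m - 1) (\<lambda>r. (- c * lam) * exp (- (lam * r)))"
      by (rule Suc.IH) (use Suc.prems in auto)
  qed
qed

lemma radial_symbol_cong:
  assumes "radial_symbol k m f" "\<And>r. r > 0 \<Longrightarrow> f r = f' r"
  shows "radial_symbol k m f'"
proof (cases k)
  case 0
  then show ?thesis using assms by auto
next
  case (Suc k')
  obtain g M where g: "\<And>r. r > 0 \<Longrightarrow> (f has_real_derivative g r) (at r)" "radial_symbol k' (m - 1) g"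
     "\<And>r. r > 0 \<Longrightarrow> \<bar>f r\<bar> \<le> M * r powr m"
    using assms(1) Suc by auto
  have "(f' has_real_derivative g r) (at r)" if "r > 0" for r
    by (rule has_field_derivative_transform_within_open[OF g(1)[OF that], of "{0<..}"])
       (use that assms(2) in auto)
  then show ?thesis unfolding Suc using g assms(2) by (intro radial_symbol_SucI[where M=M and g=g]) auto
qed

text \<open>Without tempering there is no exponential decay to use; the function is then the
  constant \<open>r powr 0\<close>, whose derivatives vanish.\<close>

lemma radial_symbol_exp:
  assumes "lam \<ge> 0"
  shows "radial_symbol k 0 (\<lambda>r. exp (- (lam * r)))"
proof (cases "lam = 0")
  case True
  show ?thesis
    by (rule radial_symbol_cong[OF radial_symbol_powr[where c = 1]]) (auto simp: True)
next
  case False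
  then show ?thesis using radial_symbol_exp_pos[of lam 0 k 1] assms by simp
qed

text \<open>The \<open>l\<close>-th partial derivative is \<open>g' (norm y)\<close> times
  \<open>y $ l\<close> times the inverse norm. The inverse norm is itself radial of order -1, so the
  induction hypothesis serves for two of the three factors and the orders add up to
  \<open>m - 1\<close>.\<close>

lemma symbol_radial:
  assumes "radial_symbol k m g"
  shows "symbol k P m (\<lambda>p y. g (norm y))"
  using assms
proof (induction k arbitrary: m g)
  case 0
  then obtain M where "\<forall>r>0. \<bar>g r\<bar> \<le> M * r powr m" by auto
  then show ?case by (intro symbol_0I[where M = M]) auto
next
  case (Suc k)
  obtain g' M where g: "\<And>r. r > 0 \<Longrightarrow> (g has_real_derivative g' r) (at r)" "radial_symbol k (m - 1) g'"
     "\<And>r. r > 0 \<Longrightarrow> \<bar>g r\<bar> \<le> M * r powr m"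
    using Suc.prems by auto
  show ?case
  proof (rule symbol_SucI[where g = "\<lambda>l p y. g' (norm y) * (y $ l * (1 * norm y powr (- 1)))"])
    show "symbol 0 P m (\<lambda>p y. g (norm y))"
      by (rule symbol_0I[where M = M]) (use g in auto)
    show "symbol k P (m - 1) (\<lambda>p (y::real^'b). g' (norm y) * (y $ l * (1 * norm y powr (- 1))))" for l
    proof -
      have "symbol k P (- 1) (\<lambda>p (y::real^'b). 1 * norm y powr (- 1))"
        by (rule Suc.IH[OF radial_symbol_powr[of k "-1" 1]])
      from symbol_mult[OF Suc.IH[OF g(2)] symbol_mult[OF symbol_coord[of k P l] this]]
      show ?thesis by simp
    qed
    fix p :: 'a and y :: "real^'b" assume y: "y \<noteq> 0"
    have "((\<lambda>y. g (norm y)) has_derivative (\<lambda>v. (v \<bullet> sgn y) * g' (norm y))) (at y)"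
      by (rule has_derivative_compose[OF has_derivative_norm[OF y],
            of g "\<lambda>v. v * g' (norm y)", simplified])
         (use g(1)[of "norm y"] y in \<open>auto simp: has_field_derivative_def mult_commute_abs\<close>)
    also have "(\<lambda>v. (v \<bullet> sgn y) * g' (norm y)) =
       (\<lambda>v. \<Sum>l\<in>UNIV. v $ l * (g' (norm y) * (y $ l * (1 * norm y powr (- 1)))))"
      using y by (auto simp: fun_eq_iff sgn_div_norm inner_vec_def sum_distrib_left sum_distrib_right
          powr_minus field_simps)
    finally show "((\<lambda>y. g (norm y)) has_derivative
       (\<lambda>v. \<Sum>l\<in>UNIV. v $ l * (g' (norm y) * (y $ l * (1 * norm y powr (- 1)))))) (at y)" .
  qed
qed

text \<open>All derivatives of order below \<open>k\<close> vanish at the origin and those of order \<open>k\<close> are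
  bounded, which by the mean value theorem yields a symbol of order \<open>k\<close>.\<close>

primrec vanish :: "nat \<Rightarrow> 'p set \<Rightarrow> ('p \<Rightarrow> real ^ 'n \<Rightarrow> real) \<Rightarrow> bool" where
  "vanish 0 P f \<longleftrightarrow> (\<exists>M. \<forall>p\<in>P. \<forall>y. \<bar>f p y\<bar> \<le> M)"
| "vanish (Suc k) P f \<longleftrightarrow> (\<forall>p\<in>P. f p 0 = 0) \<and>
     (\<exists>g. (\<forall>p\<in>P. \<forall>y. (f p has_derivative (\<lambda>v. \<Sum>l\<in>UNIV. v $ l * g l p y)) (at y)) \<and>
          (\<forall>l. vanish k P (g l)))"

lemma vanish_SucI:
  assumes "\<And>p. p \<in> P \<Longrightarrow> f p 0 = 0"
    and "\<And>p y. p \<in> P \<Longrightarrow> (f p has_derivative (\<lambda>v. \<Sum>l\<in>UNIV. v $ l * g l p y)) (at y)"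
    and "\<And>l. vanish k P (g l)"
  shows "vanish (Suc k) P f"
  using assms by auto

lemma abs_inner_le_sum:
  fixes v :: "real ^ 'n"
  assumes "\<And>l. \<bar>c l\<bar> \<le> B l"
  shows "\<bar>\<Sum>l\<in>UNIV. v $ l * c l\<bar> \<le> norm v * (\<Sum>l\<in>UNIV. B l)"
proof -
  have "\<bar>\<Sum>l\<in>UNIV. v $ l * c l\<bar> \<le> (\<Sum>l\<in>UNIV. \<bar>v $ l * c l\<bar>)" by (rule sum_abs)
  also have "\<dots> \<le> (\<Sum>l\<in>UNIV. norm v * B l)"
    unfolding abs_mult by (intro sum_mono mult_mono) (use assms component_le_norm_cart in auto)
  finally show ?thesis by (simp add: sum_distrib_left)
qed

lemma has_derivative_line:
  fixes f :: "real ^ 'n \<Rightarrow> real"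
  assumes "(f has_derivative (\<lambda>v. \<Sum>l\<in>UNIV. v $ l * g l (a + t *\<^sub>R v0))) (at (a + t *\<^sub>R v0))"
  shows "((\<lambda>t. f (a + t *\<^sub>R v0)) has_real_derivative (\<Sum>l\<in>UNIV. v0 $ l * g l (a + t *\<^sub>R v0))) (at t)"
proof -
  have "((\<lambda>t. a + t *\<^sub>R v0) has_derivative (\<lambda>s. s *\<^sub>R v0)) (at t)"
    by (auto intro!: derivative_eq_intros)
  from has_derivative_compose[OF this assms]
  show ?thesis
    unfolding has_field_derivative_def
    by (rule has_derivative_eq_rhs) (auto simp: fun_eq_iff sum_distrib_left mult_ac)
qed

lemma vanish_bound:
  assumes "vanish k P f"
  shows "\<exists>M\<ge>0. \<forall>p\<in>P. \<forall>y. \<bar>f p y\<bar> \<le> M * norm y ^ k"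
  using assms
proof (induction k arbitrary: f)
  case 0
  then obtain M where "\<forall>p\<in>P. \<forall>y. \<bar>f p y\<bar> \<le> M" by auto
  then show ?case by (intro exI[of _ "\<bar>M\<bar>"]) (simp, meson abs_ge_self order_trans)
next
  case (Suc k)
  obtain g where g: "\<And>p y. p \<in> P \<Longrightarrow> (f p has_derivative (\<lambda>v. \<Sum>l\<in>UNIV. v $ l * g l p y)) (at y)"
    "\<And>l. vanish k P (g l)" "\<And>p. p \<in> P \<Longrightarrow> f p 0 = 0" using Suc.prems by auto
  have "\<forall>l. \<exists>M\<ge>0. \<forall>p\<in>P. \<forall>y. \<bar>g l p y\<bar> \<le> M * norm y ^ k" using Suc.IH[OF g(2)] by blast
  then obtain M where M: "\<And>l. M l \<ge> 0" "\<And>l p y. p \<in> P \<Longrightarrow> \<bar>g l p y\<bar> \<le> M l * norm y ^ k"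
    by metis
  have "\<bar>f p y\<bar> \<le> sum M UNIV * norm y ^ Suc k" if p: "p \<in> P" for p y
  proof -
    have "((\<lambda>t. f p (0 + t *\<^sub>R y)) has_real_derivative (\<Sum>l\<in>UNIV. y $ l * g l p (0 + t *\<^sub>R y))) (at t)" for t
      by (rule has_derivative_line[where g = "\<lambda>l. g l p"]) (rule g(1)[OF p])
    then obtain t where t: "0 < t" "t < 1"
      "f p (0 + 1 *\<^sub>R y) - f p (0 + 0 *\<^sub>R y) = (1 - 0) * (\<Sum>l\<in>UNIV. y $ l * g l p (0 + t *\<^sub>R y))"
      using MVT2[of 0 1 "\<lambda>t. f p (0 + t *\<^sub>R y)" "\<lambda>t. \<Sum>l\<in>UNIV. y $ l * g l p (0 + t *\<^sub>R y)"] by auto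
    have "\<bar>\<Sum>l\<in>UNIV. y $ l * g l p (t *\<^sub>R y)\<bar> \<le> norm y * (\<Sum>l\<in>UNIV. M l * norm y ^ k)"
    proof (rule abs_inner_le_sum)
      fix l
      have "\<bar>g l p (t *\<^sub>R y)\<bar> \<le> M l * norm (t *\<^sub>R y) ^ k" using M p by blast
      also have "\<dots> \<le> M l * norm y ^ k"
        by (intro mult_left_mono power_mono) (use t M in \<open>auto intro: mult_left_le_one_le\<close>)
      finally show "\<bar>g l p (t *\<^sub>R y)\<bar> \<le> M l * norm y ^ k" .
    qed
    then show ?thesis using t g(3)[OF p] by (simp add: sum_distrib_right[symmetric] mult_ac)
  qed
  moreover have "sum M UNIV \<ge> 0" using M by (simp add: sum_nonneg)
  ultimately show ?case by blast
qed

lemma vanish_imp_symbol: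
  assumes "vanish k P f"
  shows "symbol k P (real k) f"
  using assms
proof (induction k arbitrary: f)
  case 0
  then obtain M where "\<forall>p\<in>P. \<forall>y. \<bar>f p y\<bar> \<le> M" by auto
  then show ?case by (intro symbol_0I[where M = M]) auto
next
  case (Suc k)
  obtain g where g: "\<And>p y. p \<in> P \<Longrightarrow> (f p has_derivative (\<lambda>v. \<Sum>l\<in>UNIV. v $ l * g l p y)) (at y)"
    "\<And>l. vanish k P (g l)" using Suc.prems by auto
  obtain M where M: "\<forall>p\<in>P. \<forall>y. \<bar>f p y\<bar> \<le> M * norm y ^ Suc k"
    using vanish_bound[OF Suc.prems] by blast
  show ?case
  proof (rule symbol_SucI[where g = g])
    show "symbol 0 P (real (Suc k)) f"
      by (rule symbol_0I[where M = M]) (use M in \<open>auto simp: powr_realpow simp del: power_Suc of_nat_Suc\<close>)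
    show "symbol k P (real (Suc k) - 1) (g l)" for l
      using Suc.IH[OF g(2)] by simp
  qed (use g in auto)
qed

section \<open>Integrability and symmetries of Lebesgue measure\<close>

text \<open>A substitute for polar coordinates: the function is dominated by the sum of the
  constants \<open>a k\<close> on the balls of radius \<open>r k\<close>, since at each point one
  suitable term is enough. The hypothesis is the convergence of the integrals of these
  terms.\<close>

lemma integrable_dyadic:
  fixes f :: "'a::euclidean_space \<Rightarrow> real" and a r :: "nat \<Rightarrow> real"
  assumes [measurable]: "f \<in> borel_measurable borel"
    and a: "\<And>k. a k \<ge> 0" and r: "\<And>k. r k \<ge> 0"
    and summable: "summable (\<lambda>k. a k * r k ^ DIM('a))"
    and le: "\<And>y. y \<noteq> 0 \<Longrightarrow> f y \<noteq> 0 \<Longrightarrow> \<exists>k. norm y \<le> r k \<and> \<bar>f y\<bar> \<le> a k"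
  shows "integrable lborel f"
proof (rule integrableI_bounded)
  show "f \<in> borel_measurable lborel" by simp
  define V where "V = unit_ball_vol (real DIM('a))"
  have V: "V \<ge> 0" unfolding V_def by simp
  have "(\<integral>\<^sup>+y. norm (f y) \<partial>lborel) \<le> (\<integral>\<^sup>+(y::'a). (\<Sum>k. ennreal (a k) * indicator (cball 0 (r k)) y) \<partial>lborel)"
  proof (rule nn_integral_mono_AE)
    have "AE y::'a in lborel. y \<noteq> 0"
      by (rule AE_lborel_singleton)
    then show "AE y in lborel. ennreal (norm (f y)) \<le> (\<Sum>k. ennreal (a k) * indicator (cball 0 (r k)) y)"
    proof eventually_elim
      case (elim y)
      show ?case
      proof (cases "f y = 0")
        case False
        then obtain k where k: "norm y \<le> r k" "\<bar>f y\<bar> \<le> a k" using le[OF elim] by blast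
        have "ennreal (norm (f y)) \<le> ennreal (a k) * indicator (cball 0 (r k)) y"
          using k by (simp add: ennreal_leI)
        also have "\<dots> = (\<Sum>k\<in>{k}. ennreal (a k) * indicator (cball 0 (r k)) y)" by (simp only: sum.insert[of "{}"] finite.emptyI empty_iff sum.empty not_False_eq_True add_0_right)
        also have "\<dots> \<le> (\<Sum>k. ennreal (a k) * indicator (cball 0 (r k)) y)"
          by (rule sum_le_suminf) auto
        finally show ?thesis .
      qed simp
    qed
  qed
  also have "\<dots> = (\<Sum>k. \<integral>\<^sup>+(y::'a). ennreal (a k) * indicator (cball 0 (r k)) y \<partial>lborel)"
    by (rule nn_integral_suminf) (auto intro!: borel_measurable_times_ennreal borel_measurable_indicator)
  also have "\<dots> = (\<Sum>k. ennreal (V * (a k * r k ^ DIM('a))))"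
    by (rule suminf_cong) (use a r V in
      \<open>simp add: nn_integral_cmult_indicator emeasure_cball V_def ennreal_mult'[symmetric] mult_ac\<close>)
  also have "\<dots> < \<infinity>"
    using summable_mult[OF summable, of V] a r V
    by (subst suminf_ennreal2) (auto simp: less_top)
  finally show "(\<integral>\<^sup>+y. norm (f y) \<partial>lborel) < \<infinity>" .
qed

lemma dyadic_scale:
  fixes t :: real
  assumes "t \<ge> 0"
  obtains k :: nat where "real k \<le> t" "t < real k + 1"
proof
  show "real (nat \<lfloor>t\<rfloor>) \<le> t" "t < real (nat \<lfloor>t\<rfloor>) + 1" using assms by linarith+
qed

text \<open>Rounding the exponent \<open>t\<close> down to an integer costs at most the factor
  \<open>2 powr \<bar>q\<bar>\<close>, whatever the sign of \<open>q\<close>.\<close>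

lemma powr_dyadic_le:
  fixes t q :: real
  assumes "real k \<le> t" "t < real k + 1"
  shows "2 powr (t * q) \<le> 2 powr \<bar>q\<bar> * 2 powr (real k * q)"
proof -
  have "(t - real k) * q \<le> \<bar>(t - real k) * q\<bar>" by simp
  also have "\<dots> \<le> 1 * \<bar>q\<bar>" unfolding abs_mult by (rule mult_right_mono) (use assms in auto)
  finally have "t * q \<le> \<bar>q\<bar> + real k * q" by (simp add: algebra_simps)
  then show ?thesis by (simp flip: powr_add)
qed

lemma summable_2_powr:
  assumes "q < 0"
  shows "summable (\<lambda>k. c * 2 powr (real k * q))"
proof -
  have "(\<lambda>k. c * 2 powr (real k * q)) = (\<lambda>k. c * (2 powr q) ^ k)"
    by (auto simp: powr_powr[symmetric] powr_realpow mult.commute)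
  moreover have "2 powr q < 1" using assms by (simp add: powr_less_one)
  ultimately show ?thesis by (simp add: summable_mult summable_geometric)
qed

text \<open>The order \<open>m\<close> controls the unit ball and the order \<open>s\<close> its
  complement. On dyadic balls the value times the volume forms a geometric series, convergent inside
  because \<open>m\<close> exceeds minus the dimension and outside because \<open>s\<close> lies
  below it.\<close>

lemma integrable_powr_bounds:
  fixes f :: "'a::euclidean_space \<Rightarrow> real"
  assumes [measurable]: "f \<in> borel_measurable borel"
    and m: "- real DIM('a) < m" and s: "s < - real DIM('a)"
    and f1: "\<And>y. y \<noteq> 0 \<Longrightarrow> \<bar>f y\<bar> \<le> M * norm y powr m"
    and f2: "\<And>y. y \<noteq> 0 \<Longrightarrow> \<bar>f y\<bar> \<le> M * norm y powr s"
  shows "integrable lborel f"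
proof -
  let ?d = "real DIM('a)"
  have M: "M \<ge> 0"
  proof -
    obtain b :: 'a where "b \<in> Basis" using nonempty_Basis by blast
    then have "\<bar>f b\<bar> \<le> M" using f1[of b] nonzero_Basis[of b] by auto
    then show ?thesis by linarith
  qed
  define g1 where "g1 = (\<lambda>y. if norm y \<le> 1 then f y else 0)"
  define g2 where "g2 = (\<lambda>y. if norm y \<le> 1 then 0 else f y)"
  have [measurable]: "g1 \<in> borel_measurable borel" "g2 \<in> borel_measurable borel"
    unfolding g1_def g2_def by measurable
  have "integrable lborel g1"
  proof (rule integrable_dyadic[where a = "\<lambda>k. M * (2 powr \<bar>-m\<bar> * 2 powr (real k * (-m)))"
        and r = "\<lambda>k. 2 powr (- real k)"])
    have "summable (\<lambda>k. (M * 2 powr \<bar>-m\<bar>) * 2 powr (real k * (- m - ?d)))"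
      by (rule summable_2_powr) (use m in auto)
    also have "(\<lambda>k. (M * 2 powr \<bar>-m\<bar>) * 2 powr (real k * (- m - ?d))) =
       (\<lambda>k. M * (2 powr \<bar>-m\<bar> * 2 powr (real k * (-m))) * (2 powr (- real k)) ^ DIM('a))"
      by (auto simp: fun_eq_iff powr_realpow[symmetric] powr_powr powr_add[symmetric] algebra_simps)
    finally show "summable (\<lambda>k. M * (2 powr \<bar>-m\<bar> * 2 powr (real k * (-m))) * (2 powr (- real k)) ^ DIM('a))" .
    fix y :: 'a assume y: "y \<noteq> 0" and nz: "g1 y \<noteq> 0"
    show "\<exists>k. norm y \<le> 2 powr (- real k) \<and> \<bar>g1 y\<bar> \<le> M * (2 powr \<bar>-m\<bar> * 2 powr (real k * (-m)))"
    proof (cases "norm y \<le> 1")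
      case True
      \<comment> \<open>Rounding \<open>t\<close> down enlarges the radius to 2^(-k), so
        \<open>y\<close> stays inside the ball.\<close>
      define t where "t = - log 2 (norm y)"
      have ny: "norm y = 2 powr (- t)" using y by (simp add: t_def)
      have "t \<ge> 0" using True y by (simp add: t_def)
      then obtain k where k: "real k \<le> t" "t < real k + 1" using dyadic_scale by blast
      have "norm y powr m = 2 powr (t * (-m))" by (simp add: ny powr_powr)
      also have "\<dots> \<le> 2 powr \<bar>-m\<bar> * 2 powr (real k * (-m))" by (rule powr_dyadic_le[OF k])
      finally have "M * norm y powr m \<le> M * (2 powr \<bar>-m\<bar> * 2 powr (real k * (-m)))"
        by (rule mult_left_mono[OF _ M])
      with f1[OF y] True have "\<bar>g1 y\<bar> \<le> M * (2 powr \<bar>-m\<bar> * 2 powr (real k * (-m)))"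
        by (simp add: g1_def)
      moreover have "norm y \<le> 2 powr (- real k)" using k ny by simp
      ultimately show ?thesis by blast
    qed (use nz in \<open>auto simp: g1_def\<close>)

  qed (use M in auto)
  moreover have "integrable lborel g2"
  proof (rule integrable_dyadic[where a = "\<lambda>k. M * (2 powr \<bar>s\<bar> * 2 powr (real k * s))"
        and r = "\<lambda>k. 2 powr (real k + 1)"])
    have "summable (\<lambda>k. (M * 2 powr \<bar>s\<bar> * 2 powr ?d) * 2 powr (real k * (s + ?d)))"
      by (rule summable_2_powr) (use s in auto)
    also have "(\<lambda>k. (M * 2 powr \<bar>s\<bar> * 2 powr ?d) * 2 powr (real k * (s + ?d))) =
       (\<lambda>k. M * (2 powr \<bar>s\<bar> * 2 powr (real k * s)) * (2 powr (real k + 1)) ^ DIM('a))"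
      by (auto simp: fun_eq_iff powr_realpow[symmetric] powr_powr powr_add[symmetric] algebra_simps)
    finally show "summable (\<lambda>k. M * (2 powr \<bar>s\<bar> * 2 powr (real k * s)) * (2 powr (real k + 1)) ^ DIM('a))" .
    fix y :: 'a assume y: "y \<noteq> 0" and nz: "g2 y \<noteq> 0"
    show "\<exists>k. norm y \<le> 2 powr (real k + 1) \<and> \<bar>g2 y\<bar> \<le> M * (2 powr \<bar>s\<bar> * 2 powr (real k * s))"
    proof (cases "norm y \<le> 1")
      case False
      \<comment> \<open>Here rounding down may leave \<open>y\<close> outside the ball of radius
        2^k, which is why the radius is 2^(k+1).\<close>
      define t where "t = log 2 (norm y)"
      have ny: "norm y = 2 powr t" using y by (simp add: t_def)
      have "t \<ge> 0" using False y by (simp add: t_def)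
      then obtain k where k: "real k \<le> t" "t < real k + 1" using dyadic_scale by blast
      have "norm y powr s = 2 powr (t * s)" by (simp add: ny powr_powr)
      also have "\<dots> \<le> 2 powr \<bar>s\<bar> * 2 powr (real k * s)" by (rule powr_dyadic_le[OF k])
      finally have "M * norm y powr s \<le> M * (2 powr \<bar>s\<bar> * 2 powr (real k * s))"
        by (rule mult_left_mono[OF _ M])
      with f2[OF y] False have "\<bar>g2 y\<bar> \<le> M * (2 powr \<bar>s\<bar> * 2 powr (real k * s))"
        by (simp add: g2_def)
      moreover have "norm y \<le> 2 powr (real k + 1)" using k ny by simp
      ultimately show ?thesis by blast
    qed (use nz in \<open>auto simp: g2_def\<close>)

  qed (use M in auto)
  ultimately have "integrable lborel (\<lambda>y. g1 y + g2 y)" by (rule Bochner_Integration.integrable_add)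
  also have "(\<lambda>y. g1 y + g2 y) = f" by (auto simp: g1_def g2_def)
  finally show ?thesis .
qed

section \<open>Coordinate symmetries of Lebesgue measure\<close>

lemma prod_Basis_cart: "(\<Prod>b\<in>(Basis :: (real^'n) set). f b) = (\<Prod>l\<in>UNIV. f (axis l 1))"
proof -
  have "(Basis :: (real^'n) set) = (\<lambda>l. axis l 1) ` UNIV" by (auto simp: Basis_vec_def)
  moreover have "inj (\<lambda>l::'n. axis l 1 :: real^'n)" by (auto simp: inj_def axis_eq_axis)
  ultimately show ?thesis by (metis (no_types, lifting) prod.reindex_cong)
qed

lemma emeasure_box_cart:
  fixes l u :: "real^'n"
  assumes "\<And>k. l $ k \<le> u $ k"
  shows "emeasure lborel (box l u) = (\<Prod>k\<in>UNIV. u $ k - l $ k)"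
proof -
  have "emeasure lborel (box l u) = (\<Prod>b\<in>Basis. (u - l) \<bullet> b)"
    by (rule emeasure_lborel_box) (use assms in \<open>auto simp: inner_axis Basis_vec_def\<close>)
  then show ?thesis by (simp add: prod_Basis_cart inner_axis)
qed

text \<open>Lebesgue measure is determined by its values on boxes, so a map that pulls boxes back to
  boxes of the same volume preserves it.\<close>

lemma lborel_distr_eqI:
  fixes T :: "real^'n \<Rightarrow> real^'n"
  assumes [measurable]: "T \<in> borel \<rightarrow>\<^sub>M borel"
    and "\<And>l u :: real^'n. (\<And>k. l $ k \<le> u $ k) \<Longrightarrow> \<exists>l' u'. (\<forall>k. l' $ k \<le> u' $ k) \<and>
         T -` box l u = box l' u' \<and> (\<Prod>k\<in>UNIV. u' $ k - l' $ k) = (\<Prod>k\<in>UNIV. u $ k - l $ k)"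
  shows "distr lborel borel T = lborel"
proof (rule lborel_eqI[symmetric])
  fix l u :: "real^'n" assume le: "\<And>b. b \<in> Basis \<Longrightarrow> l \<bullet> b \<le> u \<bullet> b"
  have le': "l $ k \<le> u $ k" for k
    using le[of "axis k 1"] by (auto simp: inner_axis Basis_vec_def)
  obtain l' u' where lu: "\<forall>k. l' $ k \<le> u' $ k" "T -` box l u = box l' u'"
    "(\<Prod>k\<in>UNIV. u' $ k - l' $ k) = (\<Prod>k\<in>UNIV. u $ k - l $ k)" using assms(2)[OF le'] by blast
  have "emeasure (distr lborel borel T) (box l u) = emeasure lborel (box l' u')"
    by (subst emeasure_distr) (auto simp: lu)
  also have "\<dots> = (\<Prod>k\<in>UNIV. u $ k - l $ k)" using lu by (subst emeasure_box_cart) auto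
  also have "\<dots> = (\<Prod>b\<in>Basis. (u - l) \<bullet> b)" by (simp add: prod_Basis_cart inner_axis)
  finally show "emeasure (distr lborel borel T) (box l u) = (\<Prod>b\<in>Basis. (u - l) \<bullet> b)" .
qed simp

text \<open>Polymorphic in the entries, so that the same reflection acts on lattice indices and on
  real vectors. Reflections and coordinate exchanges preserve the norm, Lebesgue measure and the
  cubic lattice alike, and they suffice to make second moments isotropic.\<close>

definition flip :: "'n \<Rightarrow> ('a::uminus) ^ 'n \<Rightarrow> 'a ^ 'n" where
  "flip i v = (\<chi> l. if l = i then - v $ l else v $ l)"

definition swap :: "'n \<Rightarrow> 'n \<Rightarrow> 'a ^ 'n \<Rightarrow> 'a ^ 'n" where
  "swap i k v = (\<chi> l. v $ (Transposition.transpose i k l))"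

lemma measurable_vec_lambda:
  assumes "\<And>l. (\<lambda>v. f v l) \<in> borel_measurable M"
  shows "(\<lambda>v. (\<chi> l. f v l) :: real^'n) \<in> borel_measurable M"
  by (rule borel_measurable_euclidean_space[THEN iffD2])
     (auto simp: Basis_vec_def inner_axis assms)

lemma measurable_flip [measurable]: "flip i \<in> borel_measurable (borel :: (real^'n) measure)"
  unfolding flip_def by (rule measurable_vec_lambda) simp

lemma measurable_swap [measurable]: "swap i k \<in> borel_measurable (borel :: (real^'n) measure)"
  unfolding swap_def by (rule measurable_vec_lambda) simp

lemma distr_flip: "distr lborel borel (flip i) = (lborel :: (real^'n) measure)"
proof (rule lborel_distr_eqI)
  fix l u :: "real^'n" assume le: "\<And>k. l $ k \<le> u $ k"
  let ?l = "\<chi> k. if k = i then - u $ k else l $ k" and ?u = "\<chi> k. if k = i then - l $ k else u $ k"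
  have "flip i -` box l u = box ?l ?u"
    by (auto simp: mem_box_cart flip_def split: if_splits) (smt (verit))+
  moreover have "(\<Prod>k\<in>UNIV. ?u $ k - ?l $ k) = (\<Prod>k\<in>UNIV. u $ k - l $ k)"
    by (rule prod.cong) auto
  ultimately show "\<exists>l' u'. (\<forall>k. l' $ k \<le> u' $ k) \<and> flip i -` box l u = box l' u' \<and>
      (\<Prod>k\<in>UNIV. u' $ k - l' $ k) = (\<Prod>k\<in>UNIV. u $ k - l $ k)"
    using le by (intro exI[of _ ?l] exI[of _ ?u]) auto
qed simp

lemma distr_swap: "distr lborel borel (swap i k) = (lborel :: (real^'n) measure)"
proof (rule lborel_distr_eqI)
  fix l u :: "real^'n" assume le: "\<And>k. l $ k \<le> u $ k"
  let ?t = "Transposition.transpose i k"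
  have "swap i k -` box l u = box (swap i k l) (swap i k u)"
  proof (rule set_eqI)
    fix v
    have "(\<forall>j. l $ j < v $ ?t j \<and> v $ ?t j < u $ j) \<longleftrightarrow>
          (\<forall>j. l $ ?t j < v $ j \<and> v $ j < u $ ?t j)"
      by (metis transpose_involutory)
    then show "v \<in> swap i k -` box l u \<longleftrightarrow> v \<in> box (swap i k l) (swap i k u)"
      by (simp add: mem_box_cart swap_def)
  qed
  moreover have "(\<Prod>j\<in>UNIV. swap i k u $ j - swap i k l $ j) = (\<Prod>j\<in>UNIV. u $ j - l $ j)"
    unfolding swap_def vec_lambda_beta
    by (rule prod.reindex_bij_betw[of ?t UNIV UNIV "\<lambda>j. u $ j - l $ j"]) simp
  ultimately show "\<exists>l' u'. (\<forall>k. l' $ k \<le> u' $ k) \<and> swap i k -` box l u = box l' u' \<and>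
      (\<Prod>k\<in>UNIV. u' $ k - l' $ k) = (\<Prod>k\<in>UNIV. u $ k - l $ k)"
    using le by (intro exI[of _ "swap i k l"] exI[of _ "swap i k u"]) (auto simp: swap_def)
qed simp

lemma integral_comp_distr_lborel:
  fixes f :: "'a::euclidean_space \<Rightarrow> real"
  assumes "distr lborel borel T = lborel" and [measurable]: "T \<in> borel \<rightarrow>\<^sub>M borel"
    and [measurable]: "f \<in> borel_measurable borel"
  shows "(LINT y|lborel. f (T y)) = (LINT y|lborel. f y)"
proof -
  have "(LINT y|distr lborel borel T. f y) = (LINT y|lborel. f (T y))"
    by (rule integral_distr) auto
  then show ?thesis by (simp add: assms(1))
qed

lemma integral_odd_zero:
  fixes f :: "'a::euclidean_space \<Rightarrow> real"
  assumes "distr lborel borel T = lborel" and "T \<in> borel \<rightarrow>\<^sub>M borel"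
    and "f \<in> borel_measurable borel" and "\<And>y. f (T y) = - f y"
  shows "(LINT y|lborel. f y) = 0"
  using integral_comp_distr_lborel[OF assms(1-3)] assms(4) by simp

section \<open>Lattice cells and lattice sums\<close>

abbreviation zpoint :: "int ^ 'n \<Rightarrow> real ^ 'n" where "zpoint \<equiv> lattice_point 1"

text \<open>Half-open, so that its integer translates partition the space exactly. The price is that
  reflections preserve it only up to a null set; symmetry arguments pass to the closed cube.\<close>

definition unit_cube :: "(real ^ 'n) set" where
  "unit_cube = {v. \<forall>l. - 1 / 2 \<le> v $ l \<and> v $ l < 1 / 2}"

lemma lattice_point_scale: "lattice_point h j = h *\<^sub>R zpoint j"
  by (simp add: lattice_point_def vec_eq_iff)

lemma zpoint_add: "zpoint (j + k) = zpoint j + zpoint k"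
  by (simp add: lattice_point_def vec_eq_iff)

lemma zpoint_diff: "zpoint (j - k) = zpoint j - zpoint k"
  by (simp add: lattice_point_def vec_eq_iff)

lemma zpoint_axis: "zpoint (axis l 1) = axis l 1"
  by (simp add: lattice_point_def vec_eq_iff axis_def)

lemma zpoint_0 [simp]: "zpoint 0 = 0"
  by (simp add: lattice_point_def vec_eq_iff)

lemma zpoint_eq_0_iff [simp]: "zpoint j = 0 \<longleftrightarrow> j = 0"
  by (simp add: lattice_point_def vec_eq_iff)

lemma norm_zpoint_ge_1:
  assumes "j \<noteq> 0"
  shows "1 \<le> norm (zpoint j)"
proof -
  obtain l where "j $ l \<noteq> 0" using assms by (auto simp: vec_eq_iff)
  then have "1 \<le> \<bar>zpoint j $ l\<bar>" by (simp add: lattice_point_def)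
  also have "\<dots> \<le> norm (zpoint j)" by (rule component_le_norm_cart)
  finally show ?thesis .
qed

lemma unit_cube_measurable [measurable]: "(unit_cube :: (real^'n) set) \<in> sets borel"
  unfolding unit_cube_def by measurable

lemma box_subset_unit_cube: "box (\<chi> l. - 1/2) (\<chi> l. 1/2) \<subseteq> (unit_cube :: (real^'n) set)"
  by (auto simp: unit_cube_def mem_box_cart intro: less_imp_le)

lemma unit_cube_subset_cbox: "(unit_cube :: (real^'n) set) \<subseteq> cbox (\<chi> l. - 1/2) (\<chi> l. 1/2)"
proof
  fix v :: "real^'n" assume "v \<in> unit_cube"
  then have "- 1 / 2 \<le> v $ l" "v $ l \<le> 1 / 2" for l
    unfolding unit_cube_def by (auto intro: less_imp_le)
  then show "v \<in> cbox (\<chi> l. - 1/2) (\<chi> l. 1/2)" unfolding mem_box_cart by simp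
qed

lemma emeasure_unit_cube: "emeasure lborel (unit_cube :: (real^'n) set) = 1"
proof -
  let ?a = "\<chi> l. - 1/2 :: real^'n" and ?b = "\<chi> l. 1/2 :: real^'n"
  have 1: "emeasure lborel (box ?a ?b) = 1" by (subst emeasure_box_cart) auto
  have "emeasure lborel (cbox ?a ?b) = emeasure lborel (box ?a ?b)"
    unfolding emeasure_lborel_cbox_eq emeasure_lborel_box_eq ..
  then have 2: "emeasure lborel (cbox ?a ?b) = 1" using 1 by simp
  have "emeasure lborel (box ?a ?b) \<le> emeasure lborel (unit_cube :: (real^'n) set)"
    by (rule emeasure_mono[OF box_subset_unit_cube]) simp
  moreover have "emeasure lborel (unit_cube :: (real^'n) set) \<le> emeasure lborel (cbox ?a ?b)"
    by (rule emeasure_mono[OF unit_cube_subset_cbox]) simp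
  ultimately show ?thesis using 1 2 by (metis order_antisym)
qed

text \<open>One set contains the other and both have measure 1, so their difference is null.\<close>

lemma AE_unit_cube_cbox: "AE v in lborel. v \<in> (unit_cube :: (real^'n) set) \<longleftrightarrow> v \<in> cbox (\<chi> l. - 1/2) (\<chi> l. 1/2)"
proof -
  let ?C = "cbox (\<chi> l. - 1/2) (\<chi> l. 1/2) :: (real^'n) set"
  have 2: "emeasure lborel ?C = 1"
    unfolding emeasure_lborel_cbox_eq emeasure_lborel_box_eq[symmetric]
    by (subst emeasure_box_cart) auto
  have "emeasure lborel (?C - unit_cube) = emeasure lborel ?C - emeasure lborel (unit_cube :: (real^'n) set)"
    by (rule emeasure_Diff[OF _ _ _ unit_cube_subset_cbox]) (auto simp: emeasure_unit_cube)
  also have "\<dots> = 0" using 2 by (simp add: emeasure_unit_cube)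
  finally have "?C - unit_cube \<in> null_sets lborel" by (intro null_setsI) auto
  from AE_not_in[OF this] show ?thesis
    by eventually_elim (use unit_cube_subset_cbox in blast)
qed

lemma norm_unit_cube_le: "v \<in> (unit_cube :: (real^'n) set) \<Longrightarrow> norm v \<le> real CARD('n) / 2"
proof -
  assume v: "v \<in> (unit_cube :: (real^'n) set)"
  have "norm v \<le> (\<Sum>l\<in>UNIV. \<bar>v $ l\<bar>)" by (rule norm_le_l1_cart)
  also have "\<dots> \<le> (\<Sum>l\<in>(UNIV::'n set). 1/2)"
    by (rule sum_mono) (use v in \<open>auto simp: unit_cube_def abs_le_iff minus_le_iff\<close>, smt (verit))
  finally show ?thesis by simp
qed

lemma integrable_unit_cube_bounded:
  fixes f :: "real^'n \<Rightarrow> real"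
  assumes [measurable]: "f \<in> borel_measurable borel" and "\<And>v. v \<in> unit_cube \<Longrightarrow> \<bar>f v\<bar> \<le> B"
  shows "integrable lborel (\<lambda>v. indicator unit_cube v * f v)"
proof (rule Bochner_Integration.integrable_bound)
  show "integrable lborel (\<lambda>v::real^'n. B * indicator unit_cube v)"
    by (intro integrable_mult_right integrable_real_indicator) (auto simp: emeasure_unit_cube)
  show "AE v in lborel. norm (indicator unit_cube v * f v) \<le> norm (B * indicator unit_cube v)"
    using order_trans[OF assms(2) abs_ge_self] by (intro AE_I2) (simp add: indicator_def)
qed measurable

lemma integral_unit_cube_1: "(LINT v|lborel. indicator (unit_cube :: (real^'n) set) v) = (1 :: real)"
  by (simp add: measure_def emeasure_unit_cube)

definition cell :: "int ^ 'n \<Rightarrow> (real ^ 'n) set" where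
  "cell j = {y. y - zpoint j \<in> unit_cube}"

lemma cell_measurable [measurable]: "cell j \<in> sets borel"
  unfolding cell_def unit_cube_def by measurable

text \<open>Rounding each coordinate to the nearest integer names the only cell that contains
  \<open>y\<close>, which yields disjointness and covering at once.\<close>

lemma mem_cell_iff: "y \<in> cell j \<longleftrightarrow> j = (\<chi> l. \<lfloor>y $ l + 1 / 2\<rfloor>)"
proof -
  have "(- 1 / 2 \<le> y $ l - of_int (j $ l) \<and> y $ l - of_int (j $ l) < 1 / 2) \<longleftrightarrow>
        j $ l = \<lfloor>y $ l + 1 / 2\<rfloor>" for l
    by (auto simp: eq_commute[of "j $ l"] floor_eq_iff)
  then show ?thesis by (simp add: cell_def unit_cube_def lattice_point_def vec_eq_iff)
qed

lemma cell_disjoint: "i \<noteq> j \<Longrightarrow> cell i \<inter> cell j = {}"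
  by (auto simp: mem_cell_iff)

lemma integral_translate:
  fixes f :: "'a::euclidean_space \<Rightarrow> real"
  assumes "f \<in> borel_measurable borel"
  shows "(LINT y|lborel. f (c + y)) = (LINT y|lborel. f y)"
  by (rule integral_comp_distr_lborel[OF lborel_distr_plus _ assms]) simp

lemma integral_cell:
  fixes f :: "real^'n \<Rightarrow> real"
  assumes [measurable]: "f \<in> borel_measurable borel"
  shows "(LINT y|lborel. indicator (cell j) y * f y) = (LINT v|lborel. indicator unit_cube v * f (zpoint j + v))"
proof -
  have "(LINT y|lborel. indicator (cell j) (zpoint j + y) * f (zpoint j + y)) = (LINT y|lborel. indicator (cell j) y * f y)"
    by (rule integral_translate[where f = "\<lambda>y. (indicator (cell j) y * f y :: real)" and c = "zpoint j"]) measurable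
  moreover have "indicator (cell j) (zpoint j + y) = (indicator unit_cube y :: real)" for y
    by (simp add: cell_def indicator_def)
  ultimately show ?thesis by simp
qed

text \<open>Countable additivity along an enumeration of the lattice. The partial sums of the
  absolute integrals are bounded by the integral of \<open>norm (f y)\<close>, so the series
  converges absolutely and the enumeration does not matter.\<close>

lemma has_sum_integral_cells:
  fixes f :: "real^'n \<Rightarrow> real"
  assumes f: "integrable lborel f"
  shows "((\<lambda>j. LINT v|lborel. indicator unit_cube v * f (zpoint j + v)) has_sum (LINT y|lborel. f y)) UNIV"
proof -
  have [measurable]: "f \<in> borel_measurable borel" using borel_measurable_integrable[OF f] by simp
  define e where "e = from_nat_into (UNIV :: (int^'n) set)"
  have "countable (UNIV :: (int^'n) set)"
  proof -
    have "inj (\<lambda>j::int^'n. \<lambda>l. j $ l)" by (auto simp: inj_def vec_eq_iff fun_eq_iff)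
    moreover have "countable (UNIV :: ('n \<Rightarrow> int) set)" by simp
    ultimately show ?thesis by (meson countable_subset countable_image_inj_on subset_UNIV inj_on_subset)
  qed
  moreover have "infinite (UNIV :: (int^'n) set)"
  proof -
    have "inj (\<lambda>k::int. (\<chi> l. k) :: int^'n)" by (auto simp: inj_def vec_eq_iff)
    then show ?thesis using infinite_UNIV_int finite_imageD
      by (metis finite_subset subset_UNIV)
  qed
  ultimately have e: "bij_betw e UNIV (UNIV :: (int^'n) set)"
    unfolding e_def by (rule bij_betw_from_nat_into)
  have ij: "cell (e i) \<inter> cell (e j) = {}" if "i \<noteq> j" for i j
    by (rule cell_disjoint) (use that e in \<open>auto simp: bij_betw_def inj_def\<close>)
  have un: "(\<Union>i. cell (e i)) = UNIV"
  proof (intro set_eqI iffI UNIV_I)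
    fix y :: "real^'n"
    obtain i where "e i = (\<chi> l. \<lfloor>y $ l + 1 / 2\<rfloor>)" using e by (metis UNIV_I bij_betw_iff_bijections)
    then show "y \<in> (\<Union>i. cell (e i))" by (auto simp: mem_cell_iff)
  qed
  have int: "integrable lborel (\<lambda>y. indicator (cell j) y * f y)" for j
    by (rule Bochner_Integration.integrable_bound[OF f]) (auto simp: indicator_def)
  define F where "F j = (LINT y|lborel. indicator (cell j) y * f y)" for j
  have sums: "(\<lambda>i. F (e i)) sums (LINT y|lborel. (\<Sum>i. indicator (cell (e i)) y * f y))"
    and summ: "summable (\<lambda>i. norm (F (e i)))"
  proof -
    have 1: "AE y in lborel. summable (\<lambda>i. norm (indicator (cell (e i)) y * f y))"
    proof (intro AE_I2)
      fix y
      have "(\<lambda>i. indicator (cell (e i)) y * \<bar>f y\<bar>) sums (indicator (\<Union>i. cell (e i)) y * \<bar>f y\<bar>)"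
        by (intro sums_mult2 indicator_sums) (use ij in auto)
      then show "summable (\<lambda>i. norm (indicator (cell (e i)) y * f y))"
        by (simp add: abs_mult sums_iff)
    qed
    have 2: "summable (\<lambda>i. LINT y|lborel. norm (indicator (cell (e i)) y * f y))"
    proof (rule summableI_nonneg_bounded)
      fix n
      show "0 \<le> (LINT y|lborel. norm (indicator (cell (e n)) y * f y))" by simp
      have "(\<Sum>i<n. LINT y|lborel. norm (indicator (cell (e i)) y * f y))
            = (LINT y|lborel. (\<Sum>i<n. norm (indicator (cell (e i)) y * f y)))"
        by (rule Bochner_Integration.integral_sum[symmetric]) (rule integrable_norm[OF int])
      also have "\<dots> \<le> (LINT y|lborel. norm (f y))"
      proof (rule integral_mono)
        fix y
        have "(\<Sum>i<n. indicator (cell (e i)) y) = (indicator (\<Union>i<n. cell (e i)) y :: real)"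
          by (rule indicator_UN_disjoint[symmetric]) (use ij in \<open>auto simp: disjoint_family_on_def\<close>)
        then have "(\<Sum>i<n. norm (indicator (cell (e i)) y * f y)) = indicator (\<Union>i<n. cell (e i)) y * \<bar>f y\<bar>"
          by (simp add: abs_mult sum_distrib_right[symmetric])
        also have "\<dots> \<le> 1 * \<bar>f y\<bar>" by (intro mult_right_mono) (auto simp: indicator_def)
        finally show "(\<Sum>i<n. norm (indicator (cell (e i)) y * f y)) \<le> norm (f y)" by simp
      qed (intro Bochner_Integration.integrable_sum integrable_norm int f)+
      finally show "(\<Sum>i<n. LINT y|lborel. norm (indicator (cell (e i)) y * f y)) \<le> (LINT y|lborel. norm (f y))" .
    qed
    show "(\<lambda>i. F (e i)) sums (LINT y|lborel. (\<Sum>i. indicator (cell (e i)) y * f y))"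
      unfolding F_def by (rule sums_integral[OF int 1 2])
    show "summable (\<lambda>i. norm (F (e i)))"
      by (rule summable_comparison_test'[OF 2, of 0]) (auto simp: F_def simp del: norm_mult intro: integral_norm_bound)
  qed
  have "(\<Sum>i. indicator (cell (e i)) y * f y) = f y" for y
  proof -
    have "(\<lambda>i. indicator (cell (e i)) y * f y) sums (indicator (\<Union>i. cell (e i)) y * f y)"
      by (intro sums_mult2 indicator_sums) (use ij in auto)
    then show ?thesis by (simp add: un sums_iff)
  qed
  then have "((\<lambda>i. F (e i)) has_sum (LINT y|lborel. f y)) UNIV"
    using norm_summable_imp_has_sum[OF summ] sums by simp
  then have "(F has_sum (LINT y|lborel. f y)) UNIV"
    using has_sum_reindex_bij_betw[OF e, of F] by simp
  then show ?thesis unfolding F_def by (simp add: integral_cell)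
qed

text \<open>Comparison with the integral of the same power away from the origin: over the cell of
  \<open>j\<close> the norm is at most a fixed multiple of the norm of \<open>zpoint j\<close>, so
  each summand is bounded by a multiple of a cell integral.\<close>

lemma summable_on_zpoint_powr:
  assumes s: "s < - real CARD('n)"
  shows "(\<lambda>j. norm (zpoint j :: real^'n) powr s) summable_on UNIV"
proof -
  \<comment> \<open>Cells of nonzero lattice points keep the distance 1/2 from the origin, so
    cutting off there removes the singularity without touching them.\<close>
  define f where "f = (\<lambda>y::real^'n. if norm y < 1/2 then 0 else norm y powr s)"
  have [measurable]: "f \<in> borel_measurable borel" unfolding f_def by measurable
  have f0: "f y \<ge> 0" for y by (simp add: f_def)
  have "integrable lborel f"
  proof (rule integrable_powr_bounds[where m = 0 and s = s and M = "2 powr (-s)"])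
    fix y :: "real^'n" assume y: "y \<noteq> 0"
    have "norm y powr s \<le> (1/2) powr s" if "norm y \<ge> 1/2"
      by (rule powr_mono2') (use that s in auto)
    moreover have "(1/2) powr s = 2 powr (-s)" by (simp add: powr_divide powr_minus_divide)
    ultimately show "\<bar>f y\<bar> \<le> 2 powr (-s) * norm y powr 0" using y unfolding f_def by (cases "norm y < 1/2") simp_all
    have "1 \<le> 2 powr (- s)" using s by (intro ge_one_powr_ge_zero) simp_all
    then have "1 * norm y powr s \<le> 2 powr (-s) * norm y powr s"
      by (rule mult_right_mono) simp
    then show "\<bar>f y\<bar> \<le> 2 powr (-s) * norm y powr s" by (auto simp: f_def)
  qed (use s in auto)
  note fi = this
  \<comment> \<open>On the cell of \<open>j\<close> the norm is at most |j| + d, and d is at most d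
    |j| because nonzero lattice points have norm at least 1.\<close>
  define c where "c = (1 + real CARD('n)) powr s"
  have c: "c > 0" by (simp add: c_def)
  have "(\<lambda>j. LINT v|lborel. indicator unit_cube v * f (zpoint j + v)) summable_on UNIV"
    using has_sum_integral_cells[OF fi] by (auto simp: summable_on_def)
  then have sm: "(\<lambda>j. (LINT v|lborel. indicator unit_cube v * f (zpoint j + v)) / c) summable_on UNIV"
    unfolding divide_inverse by (rule summable_on_cmult_left)
  show ?thesis
  proof (rule summable_on_comparison_test[OF sm])
    fix j :: "int^'n"
    show "norm (zpoint j :: real^'n) powr s \<le> (LINT v|lborel. indicator unit_cube v * f (zpoint j + v)) / c"
    proof (cases "j = 0")
      \<comment> \<open>\<open>0 powr s\<close> is \<open>0\<close> even for negative
        \<open>s\<close>, so the origin contributes nothing on the left.\<close>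
      case True
      then show ?thesis using f0 c by (auto intro!: divide_nonneg_pos integral_nonneg)
    next
      case False
      have "c * norm (zpoint j) powr s = (LINT v|lborel. indicator (unit_cube::(real^'n) set) v * (c * norm (zpoint j) powr s))"
        using integral_unit_cube_1[where 'n = 'n] by simp
      also have "\<dots> \<le> (LINT v|lborel. indicator unit_cube v * f (zpoint j + v))"
      proof (rule integral_mono)
        show "integrable lborel (\<lambda>v. indicator (unit_cube::(real^'n) set) v * (c * norm (zpoint j) powr s))"
          by (rule integrable_unit_cube_bounded) auto
        show "integrable lborel (\<lambda>v. indicator unit_cube v * f (zpoint j + v))"
        proof (rule integrable_unit_cube_bounded[where B = "2 powr (-s)"])
          fix v
          have "norm y powr s \<le> (1/2) powr s" if "norm y \<ge> 1/2" for y :: "real^'n"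
            by (rule powr_mono2') (use that s in auto)
          moreover have "(1/2) powr s = 2 powr (-s)" by (simp add: powr_divide powr_minus_divide)
          ultimately show "\<bar>f (zpoint j + v)\<bar> \<le> 2 powr (- s)" by (auto simp: f_def)
        qed measurable
        fix v :: "real^'n"
        show "indicator unit_cube v * (c * norm (zpoint j) powr s) \<le> indicator unit_cube v * f (zpoint j + v)"
        proof (cases "v \<in> unit_cube")
          case v: True
          obtain l where l: "j $ l \<noteq> 0" using False by (auto simp: vec_eq_iff)
          have "1 \<le> \<bar>zpoint j $ l\<bar>" using l by (simp add: lattice_point_def)
          moreover have "\<bar>v $ l\<bar> \<le> 1/2" using v unfolding unit_cube_def by (smt (verit) mem_Collect_eq field_sum_of_halves minus_divide_left)
          ultimately have "1/2 \<le> \<bar>(zpoint j + v) $ l\<bar>" unfolding vector_add_component by linarith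
          also have "\<dots> \<le> norm (zpoint j + v)" by (rule component_le_norm_cart)
          finally have ge: "1/2 \<le> norm (zpoint j + v)" .
          have "norm (zpoint j + v) \<le> norm (zpoint j) + norm v" by (rule norm_triangle_ineq)
          also have "\<dots> \<le> norm (zpoint j) + real CARD('n) * 1" using norm_unit_cube_le[OF v] by simp
          also have "\<dots> \<le> norm (zpoint j) + real CARD('n) * norm (zpoint j :: real^'n)"
            using norm_zpoint_ge_1[OF False] by (intro add_left_mono mult_left_mono) auto
          finally have "norm (zpoint j + v) \<le> (1 + real CARD('n)) * norm (zpoint j :: real^'n)"
            by (simp add: algebra_simps)
          then have "((1 + real CARD('n)) * norm (zpoint j :: real^'n)) powr s \<le> norm (zpoint j + v) powr s"
            by (intro powr_mono2') (use ge s in auto)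
          then show ?thesis using ge v by (simp add: f_def c_def powr_mult)
        qed simp
      qed
      finally show ?thesis using c by (simp add: field_simps)
    qed
  qed simp
qed

section \<open>Fourth-order local quadrature error\<close>

lemma powr_comparable:
  fixes r s q :: real
  assumes "0 < r" "r / 2 \<le> s" "s \<le> 2 * r"
  shows "s powr q \<le> 2 powr \<bar>q\<bar> * r powr q"
proof (cases "q \<ge> 0")
  case True
  have "s powr q \<le> (2 * r) powr q" by (rule powr_mono2) (use True assms in auto)
  then show ?thesis using True assms by (simp add: powr_mult)
next
  case False
  have "s powr q \<le> (r / 2) powr q" by (rule powr_mono2') (use False assms in auto)
  also have "\<dots> = 2 powr (- q) * r powr q" using assms by (simp add: powr_divide powr_minus_divide)
  finally show ?thesis using False by simp
qed

text \<open>Chooses the partial derivatives of a whole family at once. With nested pairs of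
  coordinates as index it can be iterated to reach higher partial derivatives.\<close>

lemma symbol_SucE_family:
  assumes "\<And>i. symbol (Suc k) P m (f i)"
  obtains g where "\<And>i p y. p \<in> P \<Longrightarrow> y \<noteq> 0 \<Longrightarrow>
           (f i p has_derivative (\<lambda>v. \<Sum>l\<in>UNIV. v $ l * g i l p y)) (at y)"
    and "\<And>i l. symbol k P (m - 1) (g i l)"
proof -
  have "\<forall>i. \<exists>g. (\<forall>p y. p \<in> P \<longrightarrow> y \<noteq> 0 \<longrightarrow>
           (f i p has_derivative (\<lambda>v. \<Sum>l\<in>UNIV. v $ l * g l p y)) (at y)) \<and>
          (\<forall>l. symbol k P (m - 1) (g l))"
    by (intro allI, rule symbol_SucE[OF assms]) blast
  from choice[OF this] show ?thesis using that by blast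
qed

lemma abs_sum_div_24_le:
  fixes x y K :: real
  assumes "0 \<le> K" "\<bar>x\<bar> \<le> K" "\<bar>y\<bar> \<le> K"
  shows "\<bar>(x + y) / 24\<bar> \<le> K"
  using assms by (simp add: abs_le_iff field_simps)

text \<open>Taylor expansion along the segment from \<open>a - v\<close> to \<open>a + v\<close>:
  the odd orders cancel in the symmetric sum. The norm stays between half and twice that of
  \<open>a\<close> on this segment, so the fourth derivatives there are comparable to the power at
  \<open>a\<close>. The coefficients \<open>H\<close> are the second partial derivatives.\<close>

lemma symmetric_difference_Taylor:
  fixes f :: "'p \<Rightarrow> real ^ 'n \<Rightarrow> real"
  assumes "symbol 4 P m f"
  obtains M H where "M \<ge> 0"
    "\<And>p a v. p \<in> P \<Longrightarrow> a \<noteq> 0 \<Longrightarrow> norm v \<le> norm a / 2 \<Longrightarrow>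
       \<bar>f p (a + v) + f p (a - v) - 2 * f p a - (\<Sum>l\<in>UNIV. \<Sum>k\<in>UNIV. v $ l * v $ k * H l k p a)\<bar>
         \<le> M * norm v ^ 4 * norm a powr (m - 4)"
proof -
  have "symbol (Suc (Suc (Suc (Suc 0)))) P m f" using assms by (simp add: eval_nat_numeral)
  then obtain g1 where g1: "\<And>p y. p \<in> P \<Longrightarrow> y \<noteq> 0 \<Longrightarrow>
           (f p has_derivative (\<lambda>v. \<Sum>l\<in>UNIV. v $ l * g1 l p y)) (at y)"
    and s1: "\<And>l. symbol (Suc (Suc (Suc 0))) P (m - 1) (g1 l)" by (rule symbol_SucE) blast
  obtain g2 where g2: "\<And>l p y. p \<in> P \<Longrightarrow> y \<noteq> 0 \<Longrightarrow>
           (g1 l p has_derivative (\<lambda>v. \<Sum>k\<in>UNIV. v $ k * g2 l k p y)) (at y)"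
    and s2: "\<And>l k. symbol (Suc (Suc 0)) P (m - 1 - 1) (g2 l k)"
    by (rule symbol_SucE_family[of "Suc (Suc 0)" P "m - 1" g1, OF s1]) blast
  \<comment> \<open>The coordinates already used are packed into one index, so that the choice for
    families applies again.\<close>
  obtain g3 where g3: "\<And>l p y. p \<in> P \<Longrightarrow> y \<noteq> 0 \<Longrightarrow>
           ((\<lambda>(l, k). g2 l k) l p has_derivative (\<lambda>v. \<Sum>k\<in>UNIV. v $ k * g3 l k p y)) (at y)"
    and s3: "\<And>l k. symbol (Suc 0) P (m - 1 - 1 - 1) (g3 l k)"
    by (rule symbol_SucE_family[of "Suc 0" P "m - 1 - 1" "\<lambda>(l, k). g2 l k"]) ((simp only: case_prod_beta s2)[1], blast)
  obtain g4 where g4: "\<And>l p y. p \<in> P \<Longrightarrow> y \<noteq> 0 \<Longrightarrow>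
           ((\<lambda>(l, k). g3 l k) l p has_derivative (\<lambda>v. \<Sum>k\<in>UNIV. v $ k * g4 l k p y)) (at y)"
    and s4: "\<And>l k. symbol 0 P (m - 1 - 1 - 1 - 1) (g4 l k)"
    by (rule symbol_SucE_family[of 0 P "m - 1 - 1 - 1" "\<lambda>(l, k). g3 l k"]) ((simp only: case_prod_beta s3)[1], blast)
  have "\<exists>M\<ge>0. \<forall>p y. p \<in> P \<longrightarrow> y \<noteq> 0 \<longrightarrow> \<bar>g4 ((l, k), i) j p y\<bar> \<le> M * norm y powr (m - 4)" for l k i j
  proof -
    have "symbol 0 P (m - 4) (g4 ((l, k), i) j)" using s4[of "((l, k), i)" j] by (simp add: diff_diff_eq del: symbol.simps)
    then show ?thesis by (rule symbol_boundE) blast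
  qed
  then have "\<forall>x. \<exists>M\<ge>0. \<forall>p y. p \<in> P \<longrightarrow> y \<noteq> 0 \<longrightarrow> \<bar>g4 (fst x) (snd x) p y\<bar> \<le> M * norm y powr (m - 4)"
    by (intro allI) (metis prod.collapse)
  from choice[OF this] obtain M' where M': "\<And>x. M' x \<ge> 0"
      "\<And>x p y. p \<in> P \<Longrightarrow> y \<noteq> 0 \<Longrightarrow> \<bar>g4 (fst x) (snd x) p y\<bar> \<le> M' x * norm y powr (m - 4)"
    by blast
  define M where "M l k i j = M' (((l, k), i), j)" for l k i j
  have M0: "M l k i j \<ge> 0" for l k i j by (simp add: M_def M')
  have M: "\<bar>g4 ((l, k), i) j p y\<bar> \<le> M l k i j * norm y powr (m - 4)" if "p \<in> P" "y \<noteq> 0" for l k i j p y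
    using M'(2)[OF that, of "(((l, k), i), j)"] by (simp add: M_def)
  define N where "N = (\<Sum>l\<in>UNIV. \<Sum>k\<in>UNIV. \<Sum>i\<in>UNIV. \<Sum>j\<in>UNIV. M l k i j)"
  have N: "N \<ge> 0" unfolding N_def by (intro sum_nonneg M0)
  define c where "c = 2 powr \<bar>m - 4\<bar>"
  show ?thesis
  proof (rule that[where M = "N * c" and H = g2])
    show "N * c \<ge> 0" using N by (simp add: c_def)
    fix p and a v :: "real^'n" assume p: "p \<in> P" and a: "a \<noteq> 0" and v: "norm v \<le> norm a / 2"
    have bounds: "norm a / 2 \<le> norm (a + t *\<^sub>R v)" "norm (a + t *\<^sub>R v) \<le> 2 * norm a" if "\<bar>t\<bar> \<le> 1" for t
    proof -
      have "norm (t *\<^sub>R v) \<le> 1 * norm v" unfolding norm_scaleR by (rule mult_right_mono) (use that in auto)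
      then have tv: "norm (t *\<^sub>R v) \<le> norm a / 2" using v by simp
      show "norm a / 2 \<le> norm (a + t *\<^sub>R v)" using norm_diff_ineq[of a "t *\<^sub>R v"] tv by linarith
      show "norm (a + t *\<^sub>R v) \<le> 2 * norm a" using norm_triangle_ineq[of a "t *\<^sub>R v"] tv norm_ge_zero[of a] by linarith
    qed
    have nz: "a + t *\<^sub>R v \<noteq> 0" if "\<bar>t\<bar> \<le> 1" for t
    proof
      assume "a + t *\<^sub>R v = 0"
      then have "norm a / 2 \<le> 0" using bounds(1)[OF that] by simp
      then show False using a by simp
    qed
    define \<phi> :: "nat \<Rightarrow> real \<Rightarrow> real" where
      "\<phi> n t = (if n = 0 then f p (a + t *\<^sub>R v)
        else if n = 1 then (\<Sum>l\<in>UNIV. v $ l * g1 l p (a + t *\<^sub>R v))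
        else if n = 2 then (\<Sum>l\<in>UNIV. v $ l * (\<Sum>k\<in>UNIV. v $ k * g2 l k p (a + t *\<^sub>R v)))
        else if n = 3 then (\<Sum>l\<in>UNIV. v $ l * (\<Sum>k\<in>UNIV. v $ k * (\<Sum>i\<in>UNIV. v $ i * g3 (l, k) i p (a + t *\<^sub>R v))))
        else (\<Sum>l\<in>UNIV. v $ l * (\<Sum>k\<in>UNIV. v $ k * (\<Sum>i\<in>UNIV. v $ i *
                (\<Sum>j\<in>UNIV. v $ j * g4 ((l, k), i) j p (a + t *\<^sub>R v))))))" for n t
    have d: "(\<phi> n has_real_derivative \<phi> (Suc n) t) (at t)" if n: "n < 4" and t: "\<bar>t\<bar> \<le> 1" for n t
    proof -
      have d0: "((\<lambda>t. f p (a + t *\<^sub>R v)) has_real_derivative (\<Sum>l\<in>UNIV. v $ l * g1 l p (a + t *\<^sub>R v))) (at t)"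
        by (rule has_derivative_line[where g = "\<lambda>l. g1 l p"], rule g1[OF p nz[OF t]])
      have d1: "((\<lambda>t. g1 l p (a + t *\<^sub>R v)) has_real_derivative (\<Sum>k\<in>UNIV. v $ k * g2 l k p (a + t *\<^sub>R v))) (at t)" for l
        by (rule has_derivative_line[where g = "\<lambda>k. g2 l k p"], rule g2[OF p nz[OF t]])
      have d2: "((\<lambda>t. g2 l k p (a + t *\<^sub>R v)) has_real_derivative (\<Sum>i\<in>UNIV. v $ i * g3 (l, k) i p (a + t *\<^sub>R v))) (at t)" for l k
        by (rule has_derivative_line[where g = "\<lambda>i. g3 (l, k) i p"], rule g3[OF p nz[OF t], of "(l, k)", unfolded prod.case])
      have d3: "((\<lambda>t. g3 (l, k) i p (a + t *\<^sub>R v)) has_real_derivative (\<Sum>j\<in>UNIV. v $ j * g4 ((l, k), i) j p (a + t *\<^sub>R v))) (at t)" for l k i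
        by (rule has_derivative_line[where g = "\<lambda>j. g4 ((l, k), i) j p"], rule g4[OF p nz[OF t], of "((l, k), i)", unfolded prod.case])
      have "n = 0 \<or> n = 1 \<or> n = 2 \<or> n = 3" using n by auto
      then show ?thesis
        unfolding \<phi>_def
        by (elim disjE) (simp_all add: d0 d1 d2 d3 DERIV_sum DERIV_cmult)
    qed
    \<comment> \<open>A single expansion on [-1, 1] serves both end points: \<open>x = 1\<close> and
      \<open>x = -1\<close> share all Taylor coefficients and differ only in the intermediate point
      of the remainder.\<close>
    have tay: "\<exists>t. \<bar>t\<bar> \<le> \<bar>x\<bar> \<and> f p (a + x *\<^sub>R v) =
        (\<Sum>n<4. \<phi> n 0 / fact n * x ^ n) + \<phi> 4 t / fact 4 * x ^ 4" if "\<bar>x\<bar> \<le> 1" for x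
      by (rule Maclaurin_bi_le[where diff = \<phi>]) (use d that in \<open>auto simp: \<phi>_def fun_eq_iff\<close>)
    obtain t1 where t1: "\<bar>t1\<bar> \<le> 1" "f p (a + v) = (\<Sum>n<4. \<phi> n 0 / fact n * 1 ^ n) + \<phi> 4 t1 / fact 4 * 1 ^ 4"
      using tay[of 1] by auto
    obtain t2 where t2: "\<bar>t2\<bar> \<le> 1" "f p (a - v) = (\<Sum>n<4. \<phi> n 0 / fact n * (-1) ^ n) + \<phi> 4 t2 / fact 4 * (-1) ^ 4"
      using tay[of "-1"] by auto
    \<comment> \<open>The terms of order 1 and 3 cancel, the two halves of order 2 add up, and 24 is
      the factorial of 4.\<close>
    have X: "f p (a + v) + f p (a - v) = 2 * \<phi> 0 0 + \<phi> 2 0 + (\<phi> 4 t1 + \<phi> 4 t2) / 24"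
      unfolding t1(2) t2(2) by (simp add: eval_nat_numeral fact_numeral field_simps)
    have X0: "\<phi> 0 0 = f p a" by (simp add: \<phi>_def)
    have X2: "\<phi> 2 0 = (\<Sum>l\<in>UNIV. \<Sum>k\<in>UNIV. v $ l * v $ k * g2 l k p a)"
      by (simp add: \<phi>_def sum_distrib_left mult_ac)
    have X4: "\<bar>\<phi> 4 t\<bar> \<le> norm v ^ 4 * (N * c * norm a powr (m - 4))" if t: "\<bar>t\<bar> \<le> 1" for t
    proof -
      have pw: "norm (a + t *\<^sub>R v) powr (m - 4) \<le> c * norm a powr (m - 4)"
        unfolding c_def by (rule powr_comparable) (use bounds[OF t] a in auto)
      have b: "\<bar>g4 ((l, k), i) j p (a + t *\<^sub>R v)\<bar> \<le> M l k i j * (c * norm a powr (m - 4))" for l k i j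
        using M[OF p nz[OF t]] mult_left_mono[OF pw M0] by (rule order_trans)
      have "\<phi> 4 t = (\<Sum>l\<in>UNIV. v $ l * (\<Sum>k\<in>UNIV. v $ k * (\<Sum>i\<in>UNIV. v $ i *
                (\<Sum>j\<in>UNIV. v $ j * g4 ((l, k), i) j p (a + t *\<^sub>R v)))))" by (simp add: \<phi>_def)
      also have "\<bar>\<dots>\<bar> \<le> norm v * (\<Sum>l\<in>UNIV. norm v * (\<Sum>k\<in>UNIV. norm v * (\<Sum>i\<in>UNIV. norm v *
          (\<Sum>j\<in>UNIV. M l k i j * (c * norm a powr (m - 4))))))"
        by (intro abs_inner_le_sum b)
      also have "\<dots> = norm v ^ 4 * (N * c * norm a powr (m - 4))"
        unfolding N_def by (simp add: eval_nat_numeral sum_distrib_left sum_distrib_right mult_ac)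
      finally show ?thesis .
    qed
    have eq: "f p (a + v) + f p (a - v) - 2 * f p a - (\<Sum>l\<in>UNIV. \<Sum>k\<in>UNIV. v $ l * v $ k * g2 l k p a) =
        (\<phi> 4 t1 + \<phi> 4 t2) / 24"
      using X X0 X2 by simp
    have "norm v ^ 4 * (N * c * norm a powr (m - 4)) \<ge> 0" using N by (simp add: c_def)
    then have "\<bar>(\<phi> 4 t1 + \<phi> 4 t2) / 24\<bar> \<le> norm v ^ 4 * (N * c * norm a powr (m - 4))"
      using X4[OF t1(1)] X4[OF t2(1)]
      by (rule abs_sum_div_24_le)
    then show "\<bar>f p (a + v) + f p (a - v) - 2 * f p a - (\<Sum>l\<in>UNIV. \<Sum>k\<in>UNIV. v $ l * v $ k * g2 l k p a)\<bar>
         \<le> N * c * norm v ^ 4 * norm a powr (m - 4)"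
      unfolding eq by (simp add: mult_ac)
  qed
qed

section \<open>Second moments of the unit cube and the error on one cell\<close>

lemma distr_uminus: "distr lborel borel uminus = (lborel :: 'a::euclidean_space measure)"
proof -
  have "(lborel :: 'a measure) = density (distr lborel borel (\<lambda>x. 0 + (-1) *\<^sub>R x)) (\<lambda>_. \<bar>-1::real\<bar> ^ DIM('a))"
    by (rule lborel_affine) simp
  then show ?thesis by (simp add: density_1)
qed

lemma integral_unit_cube_cbox:
  fixes g :: "real^'n \<Rightarrow> real"
  assumes [measurable]: "g \<in> borel_measurable borel"
  shows "(LINT v|lborel. indicator unit_cube v * g v) = (LINT v|lborel. indicator (cbox (\<chi> l. - 1/2) (\<chi> l. 1/2)) v * g v)"
proof (rule Bochner_Integration.integral_cong_AE)
  show "AE v in lborel. indicator unit_cube v * g v = indicator (cbox (\<chi> l. - 1/2) (\<chi> l. 1/2)) v * g v"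
    using AE_unit_cube_cbox by eventually_elim (auto simp: indicator_def)
qed measurable

lemma mem_half_cube:
  fixes v :: "real ^ 'n"
  shows "v \<in> cbox (\<chi> l. - 1/2) (\<chi> l. 1/2) \<longleftrightarrow> (\<forall>l. \<bar>v $ l\<bar> \<le> 1/2)"
  unfolding mem_box_cart abs_le_iff by (auto simp: minus_le_iff)

lemma integral_unit_cube_minus:
  fixes g :: "real^'n \<Rightarrow> real"
  assumes [measurable]: "g \<in> borel_measurable borel"
  shows "(LINT v|lborel. indicator unit_cube v * g (- v)) = (LINT v|lborel. indicator unit_cube v * g v)"
proof -
  let ?C = "cbox (\<chi> l. - 1/2) (\<chi> l. 1/2) :: (real^'n) set"
  have "- v \<in> ?C \<longleftrightarrow> v \<in> ?C" for v
    unfolding mem_half_cube by simp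
  then have ind: "(indicator ?C (- v) :: real) = indicator ?C v" for v
    unfolding indicator_def by (simp only:)
  have "(LINT v|lborel. indicator ?C (- v) * g (- v)) = (LINT v|lborel. indicator ?C v * g v)"
    by (rule integral_comp_distr_lborel[OF distr_uminus, where f = "\<lambda>v. indicator ?C v * g v"]) measurable
  then have "(LINT v|lborel. indicator ?C v * g (- v)) = (LINT v|lborel. indicator ?C v * g v)"
    unfolding ind .
  then show ?thesis by (subst (1 2) integral_unit_cube_cbox) measurable
qed

lemma integral_unit_cube_offdiag:
  assumes "l \<noteq> k"
  shows "(LINT v|lborel. indicator unit_cube v * (v $ l * v $ k)) = (0 :: real)"
proof -
  let ?C = "cbox (\<chi> l. - 1/2) (\<chi> l. 1/2) :: (real^'n) set"
  have eq: "flip l v \<in> ?C \<longleftrightarrow> v \<in> ?C" for v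
  proof -
    have "\<bar>flip l v $ i\<bar> = \<bar>v $ i\<bar>" for i by (simp add: flip_def)
    then show ?thesis unfolding mem_half_cube by simp
  qed
  have "(LINT v|lborel. indicator ?C v * (v $ l * v $ k)) = 0"
    by (rule integral_odd_zero[OF distr_flip[of l]])
       (use assms eq in \<open>auto simp: flip_def indicator_def\<close>)
  then show ?thesis by (simp add: integral_unit_cube_cbox)
qed

text \<open>Half of it is the weight with which a pure second derivative enters the average over a
  cell; its numerical value is 1/12.\<close>

definition unit_cube_moment :: "'n::finite \<Rightarrow> real" where
  "unit_cube_moment l = (LINT v|lborel. indicator (unit_cube :: (real^'n) set) v * (v $ l * v $ l))"

lemma unit_cube_moment_nonneg: "unit_cube_moment l \<ge> 0"
  unfolding unit_cube_moment_def by (intro Bochner_Integration.integral_nonneg) simp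

text \<open>Averaging the symmetric Taylor expansion over the cube kills the mixed second
  derivatives by reflection. The pure ones are then traded for second differences along the axes, at
  a cost of fourth order again, because differences, unlike derivatives, cancel when summed over the
  lattice. The condition on \<open>a\<close> keeps the cube and the unit vectors within half the
  norm of \<open>a\<close>.\<close>

lemma local_error:
  fixes f :: "'p \<Rightarrow> real ^ 'n \<Rightarrow> real"
  assumes f: "symbol 4 P m f" and meas: "\<And>p. p \<in> P \<Longrightarrow> f p \<in> borel_measurable borel"
  obtains M where "M \<ge> 0"
    "\<And>p a. p \<in> P \<Longrightarrow> 2 * real CARD('n) \<le> norm a \<Longrightarrow>
      \<bar>(LINT v|lborel. indicator unit_cube v * f p (a + v)) - f p a
         - (\<Sum>l\<in>UNIV. unit_cube_moment l / 2 * (f p (a + axis l 1) + f p (a - axis l 1) - 2 * f p a))\<bar>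
        \<le> M * norm a powr (m - 4)"
proof -
  let ?d = "real CARD('n)"
  have d1: "?d \<ge> 1" by (simp add: Suc_leI)
  obtain M H where M: "M \<ge> 0" and T: "\<And>p a v. p \<in> P \<Longrightarrow> a \<noteq> 0 \<Longrightarrow> norm v \<le> norm a / 2 \<Longrightarrow>
       \<bar>f p (a + v) + f p (a - v) - 2 * f p a - (\<Sum>l\<in>UNIV. \<Sum>k\<in>UNIV. v $ l * v $ k * H l k p a)\<bar>
         \<le> M * norm v ^ 4 * norm a powr (m - 4)"
    by (rule symmetric_difference_Taylor[OF f]) blast
  obtain M0 where M0: "M0 \<ge> 0" "\<And>p y. p \<in> P \<Longrightarrow> y \<noteq> 0 \<Longrightarrow> \<bar>f p y\<bar> \<le> M0 * norm y powr m"
    using symbol_boundE[OF f] by blast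
  \<comment> \<open>The first summand bounds the Taylor remainder over the cube, the second the
    replacement of second derivatives by second differences.\<close>
  define N where "N = M * ?d ^ 4 + (\<Sum>l\<in>(UNIV::'n set). unit_cube_moment l / 2) * M"
  show ?thesis
  proof (rule that[of N])
    show "N \<ge> 0" unfolding N_def using M
      by (intro add_nonneg_nonneg mult_nonneg_nonneg sum_nonneg) (auto simp: unit_cube_moment_nonneg)
    fix p a assume p: "p \<in> P" and a: "2 * ?d \<le> norm (a :: real^'n)"
    have [measurable]: "f p \<in> borel_measurable borel" by (rule meas[OF p])
    have a0: "a \<noteq> 0" using a d1 by auto
    have Qle: "norm v \<le> norm a / 2" if "v \<in> unit_cube" for v :: "real^'n" using norm_unit_cube_le[OF that] a d1 by linarith
    define R where "R v = f p (a + v) + f p (a - v) - 2 * f p a - (\<Sum>l\<in>UNIV. \<Sum>k\<in>UNIV. v $ l * v $ k * H l k p a)" for v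
    have [measurable]: "R \<in> borel_measurable borel" unfolding R_def by measurable
    define B where "B = M0 * (2 powr \<bar>m\<bar> * norm a powr m)"
    have fb: "\<bar>f p (a + v)\<bar> \<le> B" if v: "norm v \<le> norm a / 2" for v
    proof -
      have lo: "norm a / 2 \<le> norm (a + v)" using norm_diff_ineq[of a v] v by linarith
      have hi: "norm (a + v) \<le> 2 * norm a" using norm_triangle_ineq[of a v] v norm_ge_zero[of a] by linarith
      have "a + v \<noteq> 0" using lo a0 by (metis half_gt_zero norm_zero not_less zero_less_norm_iff)
      then have "\<bar>f p (a + v)\<bar> \<le> M0 * norm (a + v) powr m" using M0 p by blast
      also have "\<dots> \<le> B" unfolding B_def
        by (intro mult_left_mono powr_comparable) (use lo hi a0 M0 in auto)
      finally show ?thesis .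
    qed
    have i1: "integrable lborel (\<lambda>v. indicator unit_cube v * f p (a + v))"
      by (rule integrable_unit_cube_bounded) (use fb Qle in auto)
    have i2: "integrable lborel (\<lambda>v. indicator unit_cube v * f p (a - v))"
      by (rule integrable_unit_cube_bounded[where B = B]) (use fb[of "- _"] Qle in auto)
    have i3: "integrable lborel (\<lambda>v. indicator unit_cube v * (v $ l * v $ k))" for l k :: 'n
    proof (rule integrable_unit_cube_bounded[where B = "?d * ?d"])
      fix v :: "real^'n" assume "v \<in> unit_cube"
      then have "norm v \<le> ?d" using norm_unit_cube_le[of v] d1 by linarith
      then have "\<bar>v $ i\<bar> \<le> ?d" for i using component_le_norm_cart[of v i] by linarith
      then show "\<bar>v $ l * v $ k\<bar> \<le> ?d * ?d" unfolding abs_mult by (intro mult_mono) auto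
    qed measurable
    have i4: "integrable lborel (\<lambda>v. indicator (unit_cube::(real^'n) set) v * c)" for c :: real
      by (rule integrable_unit_cube_bounded) auto
    have Rb: "\<bar>R v\<bar> \<le> M * ?d ^ 4 * norm a powr (m - 4)" if "v \<in> unit_cube" for v
    proof -
      have "\<bar>R v\<bar> \<le> M * norm v ^ 4 * norm a powr (m - 4)" unfolding R_def by (rule T[OF p a0 Qle[OF that]])
      also have "\<dots> \<le> M * ?d ^ 4 * norm a powr (m - 4)"
        using norm_unit_cube_le[OF that] d1 by (intro mult_right_mono mult_left_mono power_mono M) auto
      finally show ?thesis .
    qed
    have i5: "integrable lborel (\<lambda>v. indicator unit_cube v * R v)"
      by (rule integrable_unit_cube_bounded) (use Rb in auto)
    let ?I = "LINT v|lborel. indicator unit_cube v * f p (a + v)"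
    have I2: "(LINT v|lborel. indicator unit_cube v * f p (a - v)) = ?I"
      using integral_unit_cube_minus[of "\<lambda>v. f p (a + v)"] by simp
    have "(LINT v|lborel. indicator unit_cube v * R v) =
       (LINT v|lborel. indicator unit_cube v * f p (a + v) + indicator unit_cube v * f p (a - v) - indicator (unit_cube::(real^'n) set) v * (2 * f p a)
         - (\<Sum>l\<in>UNIV. \<Sum>k\<in>UNIV. indicator unit_cube v * (v $ l * v $ k) * H l k p a))"
      by (rule Bochner_Integration.integral_cong) (auto simp: R_def algebra_simps sum_distrib_left)
    also have "\<dots> = ?I + ?I - 2 * f p a - (\<Sum>l\<in>UNIV. \<Sum>k\<in>UNIV. (LINT v|lborel. indicator unit_cube v * (v $ l * v $ k)) * H l k p a)"
    proof -
      have i6: "integrable lborel (\<lambda>v. indicator unit_cube v * (v $ l * v $ k) * H l k p a)" for l k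
        by (rule integrable_mult_left[OF i3])
      have i7: "integrable lborel (\<lambda>v. \<Sum>k\<in>UNIV. indicator unit_cube v * (v $ l * v $ k) * H l k p a)" for l
        by (rule Bochner_Integration.integrable_sum[OF i6])
      have i8: "integrable lborel (\<lambda>v. \<Sum>l\<in>UNIV. \<Sum>k\<in>UNIV. indicator unit_cube v * (v $ l * v $ k) * H l k p a)"
        by (rule Bochner_Integration.integrable_sum[OF i7])
      have "(LINT v|lborel. indicator (unit_cube::(real^'n) set) v * (2 * f p a)) = 2 * f p a"
        using integral_unit_cube_1[where 'n = 'n] by simp
      moreover have "(LINT v|lborel. (\<Sum>l\<in>UNIV. \<Sum>k\<in>UNIV. indicator unit_cube v * (v $ l * v $ k) * H l k p a)) =
         (\<Sum>l\<in>UNIV. \<Sum>k\<in>UNIV. (LINT v|lborel. indicator unit_cube v * (v $ l * v $ k)) * H l k p a)"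
        by (simp only: Bochner_Integration.integral_sum[OF i7] Bochner_Integration.integral_sum[OF i6]
            integral_mult_left_zero)
      ultimately show ?thesis
        by (simp only: Bochner_Integration.integral_diff[OF
            Bochner_Integration.integrable_diff[OF Bochner_Integration.integrable_add[OF i1 i2] i4] i8]
           Bochner_Integration.integral_diff[OF Bochner_Integration.integrable_add[OF i1 i2] i4]
           Bochner_Integration.integral_add[OF i1 i2] I2)
    qed
    also have "(\<Sum>l\<in>UNIV. \<Sum>k\<in>UNIV. (LINT v|lborel. indicator unit_cube v * (v $ l * v $ k)) * H l k p a) =
        (\<Sum>l\<in>UNIV. unit_cube_moment l * H l l p a)"
    proof (rule sum.cong[OF refl])
      fix l :: 'n
      have "(\<Sum>k\<in>UNIV. (LINT v|lborel. indicator unit_cube v * (v $ l * v $ k)) * H l k p a) =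
         (\<Sum>k\<in>UNIV. if k = l then unit_cube_moment l * H l l p a else 0)"
        by (rule sum.cong) (auto simp: unit_cube_moment_def integral_unit_cube_offdiag)
      then show "(\<Sum>k\<in>UNIV. (LINT v|lborel. indicator unit_cube v * (v $ l * v $ k)) * H l k p a) = unit_cube_moment l * H l l p a"
        by simp
    qed
    \<comment> \<open>The factor 2 arises because \<open>a + v\<close> and \<open>a - v\<close> have
      the same average over the cube.\<close>
    finally have IR: "2 * (?I - f p a) = (LINT v|lborel. indicator unit_cube v * R v) + (\<Sum>l\<in>UNIV. unit_cube_moment l * H l l p a)"
      by simp
    have absR: "\<bar>LINT v|lborel. indicator unit_cube v * R v\<bar> \<le> M * ?d ^ 4 * norm a powr (m - 4)"
    proof -
      have "\<bar>LINT v|lborel. indicator unit_cube v * R v\<bar> \<le> (LINT v|lborel. indicator (unit_cube::(real^'n) set) v * (M * ?d ^ 4 * norm a powr (m - 4)))"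
        by (rule order_trans[OF integral_abs_bound], rule integral_mono[OF integrable_abs[OF i5] i4])
           (use Rb in \<open>auto simp: indicator_def\<close>)
      then show ?thesis using integral_unit_cube_1[where 'n = 'n] by simp
    qed
    \<comment> \<open>Applied to the unit vectors, the same Taylor bound measures how far a second
      difference is from \<open>H l l\<close>.\<close>
    have axb: "\<bar>R (axis l 1)\<bar> \<le> M * norm a powr (m - 4)" for l
      using T[OF p a0, of "axis l 1"] a d1 by (simp add: R_def)
    have Hax: "(\<Sum>i\<in>UNIV. \<Sum>k\<in>UNIV. axis l 1 $ i * axis l 1 $ k * H i k p a) = H l l p a" for l
    proof -
      have "(\<Sum>i\<in>UNIV. \<Sum>k\<in>UNIV. axis l 1 $ i * axis l 1 $ k * H i k p a) =
         (\<Sum>i\<in>UNIV. \<Sum>k\<in>UNIV. if k = l then (if i = l then H l l p a else 0) else 0)"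
        by (intro sum.cong) (auto simp: axis_def)
      then show ?thesis by simp
    qed
    have "f p (a + axis l 1) + f p (a - axis l 1) - 2 * f p a = R (axis l 1) + H l l p a" for l
      by (simp add: R_def Hax)
    then have "(\<Sum>l\<in>UNIV. unit_cube_moment l / 2 * (f p (a + axis l 1) + f p (a - axis l 1) - 2 * f p a)) =
      (\<Sum>l\<in>UNIV. unit_cube_moment l / 2 * R (axis l 1)) + (\<Sum>l\<in>UNIV. unit_cube_moment l * H l l p a) / 2"
      by (simp add: distrib_left sum.distrib sum_divide_distrib)
    moreover have "\<bar>\<Sum>l\<in>UNIV. unit_cube_moment l / 2 * R (axis l 1)\<bar> \<le> (\<Sum>l\<in>(UNIV::'n set). unit_cube_moment l / 2) * M * norm a powr (m - 4)"
    proof -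
      have "\<bar>\<Sum>l\<in>UNIV. unit_cube_moment l / 2 * R (axis l 1)\<bar> \<le> (\<Sum>l\<in>UNIV. \<bar>unit_cube_moment l / 2 * R (axis l 1)\<bar>)" by (rule sum_abs)
      also have "\<dots> \<le> (\<Sum>l\<in>(UNIV::'n set). unit_cube_moment l / 2 * (M * norm a powr (m - 4)))"
        unfolding abs_mult using axb unit_cube_moment_nonneg by (intro sum_mono mult_mono) auto
      finally show ?thesis by (simp only: sum_distrib_right mult.assoc)
    qed
    moreover have "0 \<le> M * ?d ^ 4 * norm a powr (m - 4)" using M by simp
    ultimately show "\<bar>?I - f p a - (\<Sum>l\<in>UNIV. unit_cube_moment l / 2 * (f p (a + axis l 1) + f p (a - axis l 1) - 2 * f p a))\<bar>
        \<le> N * norm a powr (m - 4)"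
      using IR absR unfolding N_def distrib_right by (smt (verit) field_sum_of_halves)
  qed
qed

section \<open>Lattice quadrature of singular functions\<close>

lemma has_sum_translate:
  fixes S :: "int ^ 'n \<Rightarrow> real"
  assumes "(S has_sum x) UNIV"
  shows "((\<lambda>j. S (j + k)) has_sum x) UNIV"
proof -
  have "bij_betw (\<lambda>j::int^'n. j + k) UNIV UNIV"
    by (rule bij_betw_byWitness[where f' = "\<lambda>j. j - k"]) auto
  from has_sum_reindex_bij_betw[OF this, of S x] show ?thesis using assms by simp
qed

lemma has_sum_finite_sum:
  fixes f :: "'i \<Rightarrow> 'a \<Rightarrow> real"
  assumes "finite I" "\<And>i. i \<in> I \<Longrightarrow> (f i has_sum x i) A"
  shows "((\<lambda>a. \<Sum>i\<in>I. f i a) has_sum (\<Sum>i\<in>I. x i)) A"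
  using assms by (induction I rule: finite_induct) (auto intro: has_sum_add has_sum_0)

text \<open>Translation permutes the lattice, so all three sums have the same value.\<close>

lemma has_sum_second_difference_0:
  fixes S :: "int ^ 'n \<Rightarrow> real"
  assumes "(S has_sum x) UNIV"
  shows "((\<lambda>j. S (j + k) + S (j - k) - 2 * S j) has_sum 0) UNIV"
proof -
  have "((\<lambda>j. S (j + k) + S (j + (- k)) + (- 2) * S j) has_sum (x + x + (- 2) * x)) UNIV"
    by (intro has_sum_add has_sum_translate has_sum_cmult_right assms)
  then show ?thesis by simp
qed

lemma powr_le_ball:
  fixes r R m s :: real
  assumes "0 < r" "r \<le> R" "s \<le> m"
  shows "r powr m \<le> R powr (m - s) * r powr s"
proof -
  have "r powr m = r powr (m - s) * r powr s" by (simp flip: powr_add)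
  also have "\<dots> \<le> R powr (m - s) * r powr s"
    by (intro mult_right_mono powr_mono2) (use assms in auto)
  finally show ?thesis .
qed

text \<open>The cell average minus the point value is, up to a fourth-order remainder, a combination of
  second differences along the axes, and these sum to zero over the whole lattice.\<close>

lemma lattice_quadrature_unit:
  fixes f :: "'p \<Rightarrow> real ^ 'n \<Rightarrow> real"
  assumes f: "symbol 4 P m f" and meas: "\<And>p. p \<in> P \<Longrightarrow> f p \<in> borel_measurable borel"
    and m: "- real CARD('n) < m" "m < 4 - real CARD('n)"
    and f0: "\<And>p. p \<in> P \<Longrightarrow> f p 0 = 0"
    and s: "s < - real CARD('n)"
    and decay: "\<And>p. p \<in> P \<Longrightarrow> \<exists>M. \<forall>y. y \<noteq> 0 \<longrightarrow> \<bar>f p y\<bar> \<le> M * norm y powr s"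
  obtains C where "\<And>p. p \<in> P \<Longrightarrow> (\<lambda>j. f p (zpoint j)) summable_on UNIV"
    and "\<And>p. p \<in> P \<Longrightarrow> \<bar>(LINT y|lborel. f p y) - (\<Sum>\<^sub>\<infinity>j\<in>UNIV. f p (zpoint j))\<bar> \<le> C"
proof -
  let ?d = "real CARD('n)"
  have d1: "?d \<ge> 1" by (simp add: Suc_leI)
  obtain M where M: "M \<ge> 0" "\<And>p y. p \<in> P \<Longrightarrow> y \<noteq> 0 \<Longrightarrow> \<bar>f p y\<bar> \<le> M * norm y powr m"
    using symbol_boundE[OF f] by blast
  obtain M1 where M1: "M1 \<ge> 0"
    "\<And>p a. p \<in> P \<Longrightarrow> 2 * real CARD('n) \<le> norm a \<Longrightarrow>
      \<bar>(LINT v|lborel. indicator unit_cube v * f p (a + v)) - f p a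
         - (\<Sum>l\<in>UNIV. unit_cube_moment l / 2 * (f p (a + axis l 1) + f p (a - axis l 1) - 2 * f p a))\<bar>
        \<le> M1 * norm a powr (m - 4)"
    by (rule local_error[OF f meas]) blast+
  define E where "E p j = (LINT v|lborel. indicator unit_cube v * f p (zpoint j + v)) - f p (zpoint j)
         - (\<Sum>l\<in>UNIV. unit_cube_moment l / 2 * (f p (zpoint j + axis l 1) + f p (zpoint j - axis l 1) - 2 * f p (zpoint j)))" for p j
  \<comment> \<open>The constant \<open>M'\<close> depends on \<open>p\<close>. It serves
    integrability and summability; the final bound is built from the uniform constants
    \<open>M\<close> and \<open>M1\<close>.\<close>
  have dec: "\<exists>M'\<ge>M. \<forall>y. y \<noteq> 0 \<longrightarrow> \<bar>f p y\<bar> \<le> M' * norm y powr m \<and> \<bar>f p y\<bar> \<le> M' * norm y powr s" if p: "p \<in> P" for p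
  proof -
    obtain M'' where M'': "\<And>y. y \<noteq> 0 \<Longrightarrow> \<bar>f p y\<bar> \<le> M'' * norm y powr s" using decay[OF p] by blast
    have "\<bar>f p y\<bar> \<le> max M M'' * norm y powr m \<and> \<bar>f p y\<bar> \<le> max M M'' * norm y powr s" if "y \<noteq> 0" for y
      using M(2)[OF p that] M''[OF that] mult_right_mono[of M "max M M''" "norm y powr m"]
        mult_right_mono[of M'' "max M M''" "norm y powr s"] by fastforce
    then show ?thesis by (intro exI[of _ "max M M''"]) auto
  qed
  have int: "integrable lborel (f p)" if p: "p \<in> P" for p
  proof -
    obtain M' where "\<forall>y. y \<noteq> 0 \<longrightarrow> \<bar>f p y\<bar> \<le> M' * norm y powr m \<and> \<bar>f p y\<bar> \<le> M' * norm y powr s"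
      using dec[OF p] by blast
    then show ?thesis
      by (intro integrable_powr_bounds[OF meas[OF p], of m s M']) (use m s in auto)
  qed
  have summ: "(\<lambda>j. f p (zpoint j)) summable_on UNIV" if p: "p \<in> P" for p
  proof -
    obtain M' where M': "M' \<ge> M" "\<forall>y. y \<noteq> 0 \<longrightarrow> \<bar>f p y\<bar> \<le> M' * norm y powr m \<and> \<bar>f p y\<bar> \<le> M' * norm y powr s"
      using dec[OF p] by blast
    have "(\<lambda>j. M' * norm (zpoint j :: real^'n) powr s) summable_on UNIV"
      by (intro summable_on_cmult_right summable_on_zpoint_powr s)
    then have "(\<lambda>j. norm (f p (zpoint j))) summable_on UNIV"
    proof (rule Infinite_Sum.abs_summable_on_comparison_test')
      fix j :: "int^'n"
      show "norm (f p (zpoint j)) \<le> M' * norm (zpoint j :: real^'n) powr s"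
        using M' f0[OF p] by (cases "j = 0") auto
    qed
    then show ?thesis by (rule abs_summable_summable)
  qed
  have hsE: "(E p has_sum ((LINT y|lborel. f p y) - (\<Sum>\<^sub>\<infinity>j\<in>UNIV. f p (zpoint j)))) UNIV" if p: "p \<in> P" for p
  proof -
    have S: "((\<lambda>j. f p (zpoint j)) has_sum (\<Sum>\<^sub>\<infinity>j\<in>UNIV. f p (zpoint j))) UNIV"
      using summ[OF p] by (rule has_sum_infsum)
    have "((\<lambda>j. (LINT v|lborel. indicator unit_cube v * f p (zpoint j + v)) + (- 1) * f p (zpoint j) + (- 1) *
       (\<Sum>l\<in>UNIV. unit_cube_moment l / 2 * (f p (zpoint (j + axis l 1)) + f p (zpoint (j - axis l 1)) - 2 * f p (zpoint j))))
       has_sum ((LINT y|lborel. f p y) + (- 1) * (\<Sum>\<^sub>\<infinity>j\<in>UNIV. f p (zpoint j)) + (- 1) * (\<Sum>l\<in>(UNIV::'n set). unit_cube_moment l / 2 * 0))) UNIV"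
      by (intro has_sum_add has_sum_cmult_right has_sum_finite_sum finite has_sum_integral_cells int p S
          has_sum_second_difference_0[OF S])
    then show ?thesis by (simp add: E_def[abs_def] zpoint_add zpoint_diff zpoint_axis)
  qed
  define J where "J = (LINT y|lborel. indicator (cball 0 (3 * ?d)) (y::real^'n) * norm y powr m)"
  have Jint: "integrable lborel (\<lambda>y::real^'n. indicator (cball 0 (3 * ?d)) y * norm y powr m)"
  proof (rule integrable_powr_bounds[where m = m and s = s and M = "max 1 ((3 * ?d) powr (m - s))"])
    show "(\<lambda>y::real^'n. indicator (cball 0 (3 * ?d)) y * norm y powr m) \<in> borel_measurable borel"
      by (intro borel_measurable_times borel_measurable_indicator) auto
    fix y :: "real^'n" assume y: "y \<noteq> 0"
    have "1 * norm y powr m \<le> max 1 ((3 * ?d) powr (m - s)) * norm y powr m"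
      by (rule mult_right_mono) auto
    then show "\<bar>indicator (cball 0 (3 * ?d)) y * norm y powr m\<bar> \<le> max 1 ((3 * ?d) powr (m - s)) * norm y powr m"
      using powr_ge_zero[of "norm y" m] by (cases "y \<in> cball 0 (3 * ?d)") (auto simp: max_def)
    have "norm y powr m \<le> max 1 ((3 * ?d) powr (m - s)) * norm y powr s" if "norm y \<le> 3 * ?d"
    proof -
      have "norm y powr m \<le> (3 * ?d) powr (m - s) * norm y powr s"
        by (rule powr_le_ball) (use y that m s in auto)
      also have "\<dots> \<le> max 1 ((3 * ?d) powr (m - s)) * norm y powr s" by (rule mult_right_mono) auto
      finally show ?thesis .
    qed
    then show "\<bar>indicator (cball 0 (3 * ?d)) y * norm y powr m\<bar> \<le> max 1 ((3 * ?d) powr (m - s)) * norm y powr s"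
      by (cases "y \<in> cball 0 (3 * ?d)") (auto intro!: mult_nonneg_nonneg simp: le_max_iff_disj)
  qed (use m s in auto)
  have J0: "J \<ge> 0" unfolding J_def by (intro Bochner_Integration.integral_nonneg) simp
  \<comment> \<open>Bounds the \<open>m\<close>-th power of the norm, for either sign of
    \<open>m\<close>, at nonzero lattice points of norm at most 2d + 1: centres of norm at most 2d
    together with their neighbours along the axes.\<close>
  define X where "X = (2 * ?d + 1) powr \<bar>m\<bar>"
  have X1: "X \<ge> 1" unfolding X_def using d1 by (intro ge_one_powr_ge_zero) auto
  have fX: "\<bar>f p (zpoint i)\<bar> \<le> M * X" if p: "p \<in> P" and i: "norm (zpoint i :: real^'n) \<le> 2 * ?d + 1" for p i
  proof (cases "i = 0")
    case True
    then show ?thesis using f0[OF p] M X1 by simp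
  next
    case False
    have "norm (zpoint i :: real^'n) powr m \<le> norm (zpoint i :: real^'n) powr \<bar>m\<bar>"
      by (rule powr_mono) (use norm_zpoint_ge_1[OF False] in auto)
    also have "\<dots> \<le> X" unfolding X_def by (rule powr_mono2) (use i in auto)
    finally have "M * norm (zpoint i :: real^'n) powr m \<le> M * X" by (rule mult_left_mono[OF _ M(1)])
    then show ?thesis using M(2)[OF p, of "zpoint i"] False by simp
  qed
  have IJ: "\<bar>LINT v|lborel. indicator unit_cube v * f p (zpoint j + v)\<bar> \<le> M * J"
    if p: "p \<in> P" and j: "norm (zpoint j :: real^'n) \<le> 2 * ?d" for p j
  proof -
    have [measurable]: "f p \<in> borel_measurable borel" by (rule meas[OF p])
    have "\<bar>LINT v|lborel. indicator unit_cube v * f p (zpoint j + v)\<bar> = \<bar>LINT y|lborel. indicator (cell j) y * f p y\<bar>"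
      by (simp add: integral_cell)
    also have "\<dots> \<le> (LINT y|lborel. \<bar>indicator (cell j) y * f p y\<bar>)" by (rule integral_abs_bound)
    also have "\<dots> \<le> (LINT y|lborel. M * (indicator (cball 0 (3 * ?d)) (y::real^'n) * norm y powr m))"
    proof (rule integral_mono_AE)
      show "integrable lborel (\<lambda>y. \<bar>indicator (cell j) y * f p y\<bar>)"
        by (intro integrable_abs Bochner_Integration.integrable_bound[OF int[OF p]]) (auto simp: indicator_def)
      show "integrable lborel (\<lambda>y::real^'n. M * (indicator (cball 0 (3 * ?d)) y * norm y powr m))"
        by (intro integrable_mult_right Jint)
      have "AE y::real^'n in lborel. y \<noteq> 0" by (rule AE_lborel_singleton)
      then show "AE y in lborel. \<bar>indicator (cell j) y * f p y\<bar> \<le> M * (indicator (cball 0 (3 * ?d)) (y::real^'n) * norm y powr m)"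
      proof eventually_elim
        case (elim y)
        show ?case
        proof (cases "y \<in> cell j")
          case True
          then have "norm (y - zpoint j) \<le> ?d / 2" unfolding cell_def mem_Collect_eq by (rule norm_unit_cube_le)
          then have "norm y \<le> 3 * ?d" using norm_triangle_sub[of y "zpoint j"] j d1 by linarith
          then show ?thesis using True M(2)[OF p elim] by simp
        next
          case False
          then show ?thesis using M(1) by simp
        qed
      qed
    qed
    finally show ?thesis by (simp add: J_def)
  qed
  define B0 where "B0 = M * J + M * X + (\<Sum>l\<in>(UNIV::'n set). unit_cube_moment l / 2 * (4 * (M * X)))"
  have B0: "B0 \<ge> 0" unfolding B0_def using M(1) J0 X1
    by (intro add_nonneg_nonneg sum_nonneg mult_nonneg_nonneg) (auto simp: unit_cube_moment_nonneg)
  have En: "\<bar>E p j\<bar> \<le> B0" if p: "p \<in> P" and j: "norm (zpoint j :: real^'n) \<le> 2 * ?d" for p j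
  proof -
    have "\<bar>unit_cube_moment l / 2 * (f p (zpoint j + axis l 1) + f p (zpoint j - axis l 1) - 2 * f p (zpoint j))\<bar>
       \<le> unit_cube_moment l / 2 * (4 * (M * X))" for l
    proof -
      have "norm (zpoint (j + axis l 1) :: real^'n) \<le> 2 * ?d + 1" "norm (zpoint (j - axis l 1) :: real^'n) \<le> 2 * ?d + 1"
        using norm_triangle_ineq[of "zpoint j" "axis l 1"] norm_triangle_ineq4[of "zpoint j" "axis l 1"] j
        by (simp_all add: zpoint_add zpoint_diff zpoint_axis)
      from fX[OF p this(1)] fX[OF p this(2)] fX[OF p, of j] j
      have "\<bar>f p (zpoint j + axis l 1) + f p (zpoint j - axis l 1) - 2 * f p (zpoint j)\<bar> \<le> 4 * (M * X)"
        by (simp add: zpoint_add zpoint_diff zpoint_axis)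
      then show ?thesis unfolding abs_mult using unit_cube_moment_nonneg by (intro mult_mono) auto
    qed
    then have "\<bar>\<Sum>l\<in>UNIV. unit_cube_moment l / 2 * (f p (zpoint j + axis l 1) + f p (zpoint j - axis l 1) - 2 * f p (zpoint j))\<bar>
      \<le> (\<Sum>l\<in>(UNIV::'n set). unit_cube_moment l / 2 * (4 * (M * X)))"
      by (intro order_trans[OF sum_abs] sum_mono)
    moreover have "\<bar>f p (zpoint j)\<bar> \<le> M * X" by (rule fX[OF p]) (use j in simp)
    ultimately show ?thesis using IJ[OF p j] unfolding E_def B0_def by linarith
  qed
  \<comment> \<open>For \<open>norm (zpoint j)\<close> below 2d and \<open>j\<close> nonzero,
    (2d)^(4-m) times the power of order m - 4 is at least 1, so this weight also dominates the crude
    bound \<open>B0\<close> near the origin.\<close>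
  define c where "c = M1 + B0 * (2 * ?d) powr (4 - m)"
  \<comment> \<open>At the origin the power is \<open>0\<close> by convention, so that point carries
    \<open>B0\<close> separately.\<close>
  define b where "b j = c * norm (zpoint j :: real^'n) powr (m - 4) + (if j = 0 then B0 else 0)" for j
  have bs: "b summable_on UNIV" unfolding b_def
  proof (intro summable_on_add summable_on_cmult_right summable_on_zpoint_powr)
    \<comment> \<open>This is the place where the upper bound on the order is used: the remainders
      of fourth order are summable.\<close>
    show "m - 4 < - ?d" using m by simp
    show "(\<lambda>j::int^'n. if j = 0 then B0 else 0) summable_on UNIV"
      by (rule finite_nonzero_values_imp_summable_on) (auto intro: finite_subset[of _ "{0}"])
  qed
  have Eb: "\<bar>E p j\<bar> \<le> b j" if p: "p \<in> P" for p j
  proof (cases "2 * ?d \<le> norm (zpoint j :: real^'n)")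
    case True
    have "\<bar>E p j\<bar> \<le> M1 * norm (zpoint j :: real^'n) powr (m - 4)"
      unfolding E_def by (rule M1(2)[OF p True])
    also have "\<dots> \<le> c * norm (zpoint j :: real^'n) powr (m - 4)"
      unfolding c_def using B0 by (intro mult_right_mono) auto
    also have "\<dots> \<le> b j" unfolding b_def using B0 by simp
    finally show ?thesis .
  next
    case False
    then have En': "\<bar>E p j\<bar> \<le> B0" by (intro En p) simp
    show ?thesis
    proof (cases "j = 0")
      case True
      then show ?thesis using En' by (simp add: b_def)
    next
      case j0: False
      then have pos: "0 < norm (zpoint j :: real^'n)" by simp
      have "1 = norm (zpoint j :: real^'n) powr (4 - m) * norm (zpoint j :: real^'n) powr (m - 4)"
        using j0 by (simp flip: powr_add)
      also have "\<dots> \<le> (2 * ?d) powr (4 - m) * norm (zpoint j :: real^'n) powr (m - 4)"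
        by (intro mult_right_mono powr_mono2) (use False m d1 in auto)
      finally have "B0 * 1 \<le> B0 * ((2 * ?d) powr (4 - m) * norm (zpoint j :: real^'n) powr (m - 4))"
        by (rule mult_left_mono[OF _ B0])
      also have "\<dots> \<le> c * norm (zpoint j :: real^'n) powr (m - 4)"
        unfolding c_def distrib_right using M1(1) by (simp add: mult.assoc)
      finally show ?thesis using En' j0 by (simp add: b_def)
    qed
  qed
  show ?thesis
  proof (rule that[of "infsum b UNIV"])
    fix p assume p: "p \<in> P"
    show "(\<lambda>j. f p (zpoint j)) summable_on UNIV" by (rule summ[OF p])
    have bh: "(b has_sum infsum b UNIV) UNIV" using bs by (rule has_sum_infsum)
    have "(LINT y|lborel. f p y) - (\<Sum>\<^sub>\<infinity>j\<in>UNIV. f p (zpoint j)) \<le> infsum b UNIV"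
      by (rule has_sum_mono[OF hsE[OF p] bh]) (use Eb[OF p] in \<open>auto simp: abs_le_iff\<close>)
    moreover have "- infsum b UNIV \<le> (LINT y|lborel. f p y) - (\<Sum>\<^sub>\<infinity>j\<in>UNIV. f p (zpoint j))"
      by (rule has_sum_mono[OF _ hsE[OF p], where f = "\<lambda>j. - b j"])
         (use Eb[OF p] bh in \<open>auto simp: abs_le_iff minus_le_iff has_sum_uminus\<close>)
    ultimately show "\<bar>(LINT y|lborel. f p y) - (\<Sum>\<^sub>\<infinity>j\<in>UNIV. f p (zpoint j))\<bar> \<le> infsum b UNIV"
      by linarith
  qed
qed

lemma integral_scale:
  fixes f :: "'a::euclidean_space \<Rightarrow> real"
  assumes [measurable]: "f \<in> borel_measurable borel" and h: "h > 0"
  shows "(LINT y|lborel. f y) = h ^ DIM('a) * (LINT y|lborel. f (h *\<^sub>R y))"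
proof -
  have "(LINT y|lborel. f y) = (LINT y|density (distr lborel borel (\<lambda>x::'a. 0 + h *\<^sub>R x)) (\<lambda>_. ennreal (\<bar>h\<bar> ^ DIM('a))). f y)"
    using lborel_affine[of h "0::'a"] h by simp
  also have "\<dots> = h ^ DIM('a) * (LINT y|distr lborel borel (\<lambda>x::'a. 0 + h *\<^sub>R x). f y)"
    using h by (subst integral_density) auto
  also have "(LINT y|distr lborel borel (\<lambda>x::'a. 0 + h *\<^sub>R x). f y) = (LINT y|lborel. f (h *\<^sub>R y))"
    by (subst integral_distr) auto
  finally show ?thesis .
qed

text \<open>The symbol estimates are invariant under \<open>f \<mapsto> h^(-m) f(h \<cdot>)\<close>, so the uniform bound on the unit lattice
  already contains the rate in \<open>h\<close>.\<close>

lemma lattice_quadrature: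
  fixes f :: "'p \<Rightarrow> real ^ 'n \<Rightarrow> real"
  assumes f: "symbol 4 P m f" and meas: "\<And>p. p \<in> P \<Longrightarrow> f p \<in> borel_measurable borel"
    and m: "- real CARD('n) < m" "m < 4 - real CARD('n)"
    and f0: "\<And>p. p \<in> P \<Longrightarrow> f p 0 = 0"
    and s: "s < - real CARD('n)"
    and decay: "\<And>p. p \<in> P \<Longrightarrow> \<exists>M. \<forall>y. y \<noteq> 0 \<longrightarrow> \<bar>f p y\<bar> \<le> M * norm y powr s"
  obtains C where
    "\<And>p h. p \<in> P \<Longrightarrow> h > 0 \<Longrightarrow> \<bar>(LINT y|lborel. f p y) - h ^ CARD('n) * (\<Sum>\<^sub>\<infinity>j\<in>UNIV. f p (lattice_point h j))\<bar>
        \<le> C * h powr (m + real CARD('n))"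
proof -
  \<comment> \<open>The mesh becomes a second component of the parameter, so one uniform bound on
    the unit lattice covers all meshes.\<close>
  define g where "g q y = snd q powr (- m) * f (fst q) (snd q *\<^sub>R y)" for q y
  have meas': "g q \<in> borel_measurable borel" if "q \<in> P \<times> {0<..}" for q
  proof -
    have [measurable]: "f (fst q) \<in> borel_measurable borel" by (rule meas) (use that in auto)
    show ?thesis unfolding g_def[abs_def] by measurable
  qed
  have decay': "\<exists>M. \<forall>y. y \<noteq> 0 \<longrightarrow> \<bar>g q y\<bar> \<le> M * norm y powr s" if q: "q \<in> P \<times> {0<..}" for q
  proof -
    obtain p h where ph: "q = (p, h)" "p \<in> P" "h > 0" using q by auto
    \<comment> \<open>The constant obtained from \<open>M\<close> below depends on \<open>h\<close>,
      which is admissible because decay is required for each parameter separately.\<close>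
    obtain M where M: "\<And>y. y \<noteq> 0 \<Longrightarrow> \<bar>f p y\<bar> \<le> M * norm y powr s" using decay[OF ph(2)] by blast
    have "\<bar>g q y\<bar> \<le> (h powr (- m) * M * h powr s) * norm y powr s" if "y \<noteq> 0" for y
    proof -
      have "\<bar>f p (h *\<^sub>R y)\<bar> \<le> M * norm (h *\<^sub>R y) powr s" by (rule M) (use that ph in auto)
      then have "h powr (- m) * \<bar>f p (h *\<^sub>R y)\<bar> \<le> h powr (- m) * (M * norm (h *\<^sub>R y) powr s)"
        by (rule mult_left_mono) auto
      then show ?thesis using ph by (simp add: g_def abs_mult powr_mult mult_ac)
    qed
    then show ?thesis by blast
  qed
  obtain C where C: "\<And>q. q \<in> P \<times> {0<..} \<Longrightarrow> \<bar>(LINT y|lborel. g q y) - (\<Sum>\<^sub>\<infinity>j\<in>UNIV. g q (zpoint j))\<bar> \<le> C"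
  proof (rule lattice_quadrature_unit[OF _ meas' m _ s decay'])
    show "symbol 4 (P \<times> {0<..}) m g" unfolding g_def[abs_def] by (rule symbol_scale[OF f])
    show "g q 0 = 0" if "q \<in> P \<times> {0<..}" for q using that f0 by (auto simp: g_def)
  qed blast+
  show ?thesis
  proof (rule that[of C])
    fix p h assume p: "p \<in> P" and h: "(h::real) > 0"
    have "\<bar>(LINT y|lborel. g (p, h) y) - (\<Sum>\<^sub>\<infinity>j\<in>UNIV. g (p, h) (zpoint j))\<bar> \<le> C" by (rule C) (use p h in auto)
    also have "(LINT y|lborel. g (p, h) y) = h powr (- m) * (LINT y|lborel. f p (h *\<^sub>R y))"
      by (simp add: g_def)
    also have "(\<Sum>\<^sub>\<infinity>j\<in>UNIV. g (p, h) (zpoint j)) = h powr (- m) * (\<Sum>\<^sub>\<infinity>j\<in>UNIV. f p (lattice_point h j))"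
      by (simp add: g_def infsum_cmult_right' lattice_point_scale[symmetric, of h])
    finally have A: "\<bar>h powr (- m) * ((LINT y|lborel. f p (h *\<^sub>R y)) - (\<Sum>\<^sub>\<infinity>j\<in>UNIV. f p (lattice_point h j)))\<bar> \<le> C"
      by (simp add: right_diff_distrib)
    have "h powr (m + real CARD('n)) * h powr (- m) = h ^ CARD('n)"
      using h by (simp add: powr_add powr_minus powr_realpow)
    then have "(LINT y|lborel. f p y) - h ^ CARD('n) * (\<Sum>\<^sub>\<infinity>j\<in>UNIV. f p (lattice_point h j)) =
       h powr (m + real CARD('n)) * (h powr (- m) * ((LINT y|lborel. f p (h *\<^sub>R y)) - (\<Sum>\<^sub>\<infinity>j\<in>UNIV. f p (lattice_point h j))))"
      unfolding integral_scale[OF meas[OF p] h] by (simp add: right_diff_distrib mult.assoc[symmetric])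
    then show "\<bar>(LINT y|lborel. f p y) - h ^ CARD('n) * (\<Sum>\<^sub>\<infinity>j\<in>UNIV. f p (lattice_point h j))\<bar>
        \<le> C * h powr (m + real CARD('n))"
      using mult_left_mono[OF A, of "h powr (m + real CARD('n))"] by (simp add: abs_mult mult.commute)
  qed
qed

section \<open>Derivatives of compactly supported smooth functions\<close>

lemma C_k_on_imp_continuous: "C_k_on k S f \<Longrightarrow> continuous_on S f"
  by (cases k) (auto intro: has_derivative_continuous_on)

lemma C_k_compact_bounded:
  fixes f :: "'a::real_normed_vector \<Rightarrow> real"
  assumes "C_k_on k UNIV f" "compactly_supported f"
  obtains M where "M \<ge> 0" "\<And>x. \<bar>f x\<bar> \<le> M"
proof -
  let ?S = "closure {x. f x \<noteq> 0}"
  have "compact (f ` ?S)"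
    using assms C_k_on_imp_continuous continuous_on_subset
    by (metis compact_continuous_image compactly_supported_def subset_UNIV)
  then obtain B where B: "\<And>y. y \<in> f ` ?S \<Longrightarrow> norm y \<le> B"
    using compact_imp_bounded bounded_iff by metis
  have "\<bar>f x\<bar> \<le> max B 0" for x
  proof (cases "f x = 0")
    case False
    then have "x \<in> ?S" using closure_subset[of "{x. f x \<noteq> 0}"] by auto
    then show ?thesis using B[of "f x"] by auto
  qed auto
  then show ?thesis using that[of "max B 0"] by auto
qed

text \<open>Off the closed support the function vanishes on a neighbourhood, hence so does its
  derivative. The supports of the partial derivatives are therefore closed subsets of a compact
  set.\<close>

lemma C_k_compact_SucE:
  fixes f :: "real ^ 'n \<Rightarrow> real"
  assumes "C_k_on (Suc k) UNIV f" "compactly_supported f"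
  obtains g where "\<And>x. (f has_derivative (\<lambda>v. \<Sum>l\<in>UNIV. v $ l * g l x)) (at x)"
    and "\<And>l. C_k_on k UNIV (g l)" "\<And>l. compactly_supported (g l)"
proof -
  obtain D where D: "\<And>x. (f has_derivative D x) (at x)" "\<And>v. C_k_on k UNIV (\<lambda>x. D x v)"
    using assms(1) by auto
  show ?thesis
  proof (rule that[of "\<lambda>l x. D x (axis l 1)"])
    show "(f has_derivative (\<lambda>v. \<Sum>l\<in>UNIV. v $ l * D x (axis l 1))) (at x)" for x
    proof -
      have lin: "linear (D x)" using D(1) by (rule has_derivative_linear)
      have "D x v = (\<Sum>l\<in>UNIV. v $ l * D x (axis l 1))" for v
      proof -
        have "D x v = D x (\<Sum>l\<in>UNIV. v $ l *\<^sub>R axis l 1)"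
          using basis_expansion[of v] by (simp add: scalar_mult_eq_scaleR)
        then show ?thesis by (simp add: linear_sum[OF lin] linear_scale[OF lin])
      qed
      then have "D x = (\<lambda>v. \<Sum>l\<in>UNIV. v $ l * D x (axis l 1))" by (rule ext)
      with D(1)[of x] show ?thesis by simp
    qed
    show "C_k_on k UNIV (\<lambda>x. D x (axis l 1))" for l by (rule D(2))
    show "compactly_supported (\<lambda>x. D x (axis l 1))" for l
    proof -
      let ?S = "closure {x. f x \<noteq> 0}"
      have "D x (axis l 1) = 0" if "x \<notin> ?S" for x
      proof -
        have "(f has_derivative (\<lambda>v. 0)) (at x)"
        proof (rule has_derivative_transform_within_open[of "\<lambda>_. 0" _ x UNIV "- ?S"])
          show "0 = f y" if "y \<in> - ?S" for y
            using that closure_subset[of "{x. f x \<noteq> 0}"] by auto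
        qed (use that in auto)
        then have "D x = (\<lambda>v. 0)" using D(1) has_derivative_unique by blast
        then show ?thesis by simp
      qed
      then have "closure {x. D x (axis l 1) \<noteq> 0} \<subseteq> ?S"
        by (intro closure_minimal) auto
      then show ?thesis using assms(2) unfolding compactly_supported_def
        by (metis closed_closure closed_Int_compact inf.absorb1)
    qed
  qed
qed

lemma C_k_compact_SucE_family:
  fixes f :: "'i \<Rightarrow> real ^ 'n \<Rightarrow> real"
  assumes "\<And>i. C_k_on (Suc k) UNIV (f i)" "\<And>i. compactly_supported (f i)"
  obtains g where "\<And>i x. (f i has_derivative (\<lambda>v. \<Sum>l\<in>UNIV. v $ l * g i l x)) (at x)"
    and "\<And>i l. C_k_on k UNIV (g i l)" "\<And>i l. compactly_supported (g i l)"
proof -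
  have "\<forall>i. \<exists>g. (\<forall>x. (f i has_derivative (\<lambda>v. \<Sum>l\<in>UNIV. v $ l * g l x)) (at x)) \<and>
          (\<forall>l. C_k_on k UNIV (g l) \<and> compactly_supported (g l))"
    by (intro allI, rule C_k_compact_SucE[OF assms]) blast
  from choice[OF this] show ?thesis using that by blast
qed

lemma sum_axis: "(\<Sum>i\<in>UNIV. axis l 1 $ i * c i) = (c l :: real)"
proof -
  have "(\<Sum>i\<in>UNIV. axis l 1 $ i * c i) = (\<Sum>i\<in>UNIV. if i = l then c l else 0)"
    by (rule sum.cong) (auto simp: axis_def)
  then show ?thesis by simp
qed

section \<open>Mixed second differences and the symmetry of the Hessian\<close>

lemma second_difference_mvt:
  fixes u :: "real ^ 'n \<Rightarrow> real"
  assumes u1: "\<And>x. (u has_derivative (\<lambda>v. \<Sum>l\<in>UNIV. v $ l * u1 l x)) (at x)"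
    and u2: "\<And>l x. (u1 l has_derivative (\<lambda>v. \<Sum>k\<in>UNIV. v $ k * u2 l k x)) (at x)"
    and t: "t > 0"
  obtains z where "norm (z - x) \<le> 2 * t"
    "u (x + t *\<^sub>R axis l 1 + t *\<^sub>R axis k 1) - u (x + t *\<^sub>R axis l 1) - u (x + t *\<^sub>R axis k 1) + u x
       = t * t * u2 l k z"
proof -
  have d1: "((\<lambda>r. u (a + r *\<^sub>R axis l 1)) has_real_derivative u1 l (a + r *\<^sub>R axis l 1)) (at r)" for a r
    using has_derivative_line[of u u1 a r "axis l 1", OF u1] by (simp add: sum_axis)
  have d2: "((\<lambda>r. u1 l (a + r *\<^sub>R axis k 1)) has_real_derivative u2 l k (a + r *\<^sub>R axis k 1)) (at r)" for a r
    using has_derivative_line[of "u1 l" "u2 l" a r "axis k 1", OF u2] by (simp add: sum_axis)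
  define \<Phi> where "\<Phi> r = u (x + t *\<^sub>R axis k 1 + r *\<^sub>R axis l 1) - u (x + r *\<^sub>R axis l 1)" for r
  have "(\<Phi> has_real_derivative u1 l (x + t *\<^sub>R axis k 1 + r *\<^sub>R axis l 1) - u1 l (x + r *\<^sub>R axis l 1)) (at r)" for r
    unfolding \<Phi>_def by (intro DERIV_diff d1)
  then obtain \<xi> where \<xi>: "0 < \<xi>" "\<xi> < t"
    "\<Phi> t - \<Phi> 0 = (t - 0) * (u1 l (x + t *\<^sub>R axis k 1 + \<xi> *\<^sub>R axis l 1) - u1 l (x + \<xi> *\<^sub>R axis l 1))"
    using MVT2[OF t, of \<Phi> "\<lambda>r. u1 l (x + t *\<^sub>R axis k 1 + r *\<^sub>R axis l 1) - u1 l (x + r *\<^sub>R axis l 1)"]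
    by blast
  obtain \<eta> where \<eta>: "0 < \<eta>" "\<eta> < t"
    "u1 l (x + \<xi> *\<^sub>R axis l 1 + t *\<^sub>R axis k 1) - u1 l (x + \<xi> *\<^sub>R axis l 1 + 0 *\<^sub>R axis k 1) =
      (t - 0) * u2 l k (x + \<xi> *\<^sub>R axis l 1 + \<eta> *\<^sub>R axis k 1)"
    using MVT2[OF t, of "\<lambda>r. u1 l (x + \<xi> *\<^sub>R axis l 1 + r *\<^sub>R axis k 1)"
        "\<lambda>r. u2 l k (x + \<xi> *\<^sub>R axis l 1 + r *\<^sub>R axis k 1)"] d2 by metis
  show ?thesis
  proof (rule that[of "x + \<xi> *\<^sub>R axis l 1 + \<eta> *\<^sub>R axis k 1"])
    have "norm (\<xi> *\<^sub>R axis l 1 + \<eta> *\<^sub>R axis k 1 :: real^'n) \<le> \<xi> + \<eta>"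
      using norm_triangle_ineq[of "\<xi> *\<^sub>R axis l 1 :: real^'n" "\<eta> *\<^sub>R axis k 1"] \<xi> \<eta> by simp
    then show "norm (x + \<xi> *\<^sub>R axis l 1 + \<eta> *\<^sub>R axis k 1 - x) \<le> 2 * t"
      using \<xi> \<eta> by (simp add: add.assoc)
    show "u (x + t *\<^sub>R axis l 1 + t *\<^sub>R axis k 1) - u (x + t *\<^sub>R axis l 1) - u (x + t *\<^sub>R axis k 1) + u x
       = t * t * u2 l k (x + \<xi> *\<^sub>R axis l 1 + \<eta> *\<^sub>R axis k 1)"
      using \<xi>(3) \<eta>(3) by (simp add: \<Phi>_def ac_simps)
  qed
qed

text \<open>The mixed second difference over a square of side \<open>t\<close> is symmetric in the
  two directions, and by the mean value theorem it equals \<open>t * t\<close> times either mixed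
  derivative at some point within \<open>2 * t\<close> of \<open>x\<close>. By continuity the two
  values at \<open>x\<close> cannot differ.\<close>

lemma hessian_symmetric:
  fixes u :: "real ^ 'n \<Rightarrow> real"
  assumes u1: "\<And>x. (u has_derivative (\<lambda>v. \<Sum>l\<in>UNIV. v $ l * u1 l x)) (at x)"
    and u2: "\<And>l x. (u1 l has_derivative (\<lambda>v. \<Sum>k\<in>UNIV. v $ k * u2 l k x)) (at x)"
    and cont: "\<And>l k. continuous_on UNIV (u2 l k)"
  shows "u2 l k x = u2 k l x"
proof (rule ccontr)
  assume "u2 l k x \<noteq> u2 k l x"
  define e where "e = \<bar>u2 l k x - u2 k l x\<bar> / 2"
  have e: "e > 0" using \<open>u2 l k x \<noteq> u2 k l x\<close> by (simp add: e_def)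
  obtain d1 where d1: "d1 > 0" "\<And>z. dist z x < d1 \<Longrightarrow> dist (u2 l k z) (u2 l k x) < e"
    using cont[of l k] e unfolding continuous_on_iff by (metis UNIV_I)
  obtain d2 where d2: "d2 > 0" "\<And>z. dist z x < d2 \<Longrightarrow> dist (u2 k l z) (u2 k l x) < e"
    using cont[of k l] e unfolding continuous_on_iff by (metis UNIV_I)
  define t where "t = min d1 d2 / 3"
  have t: "t > 0" "2 * t < d1" "2 * t < d2" using d1 d2 by (auto simp: t_def)
  obtain z where z: "norm (z - x) \<le> 2 * t"
    "u (x + t *\<^sub>R axis l 1 + t *\<^sub>R axis k 1) - u (x + t *\<^sub>R axis l 1) - u (x + t *\<^sub>R axis k 1) + u x
       = t * t * u2 l k z" by (rule second_difference_mvt[OF u1 u2 t(1)])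
  obtain z' where z': "norm (z' - x) \<le> 2 * t"
    "u (x + t *\<^sub>R axis k 1 + t *\<^sub>R axis l 1) - u (x + t *\<^sub>R axis k 1) - u (x + t *\<^sub>R axis l 1) + u x
       = t * t * u2 k l z'" by (rule second_difference_mvt[OF u1 u2 t(1)])
  have "t * t * u2 l k z = t * t * u2 k l z'"
    unfolding z(2)[symmetric] z'(2)[symmetric] by (simp add: ac_simps)
  then have "u2 l k z = u2 k l z'" using t by simp
  moreover have "\<bar>u2 l k z - u2 l k x\<bar> < e" "\<bar>u2 k l z' - u2 k l x\<bar> < e"
    using d1(2)[of z] d2(2)[of z'] z(1) z'(1) t by (auto simp: dist_norm)
  ultimately show False unfolding e_def by (smt (verit) field_sum_of_halves)
qed

lemma has_derivative_shift:
  fixes f :: "real ^ 'n \<Rightarrow> real"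
  assumes "\<And>x. (f has_derivative (\<lambda>v. \<Sum>l\<in>UNIV. v $ l * g l x)) (at x)"
  shows "((\<lambda>y. f (x + y)) has_derivative (\<lambda>v. \<Sum>l\<in>UNIV. v $ l * g l (x + y))) (at y)"
    and "((\<lambda>y. f (x - y)) has_derivative (\<lambda>v. \<Sum>l\<in>UNIV. v $ l * (- g l (x - y)))) (at y)"
proof -
  have "((\<lambda>y. x + y) has_derivative (\<lambda>v. v)) (at y)" by (auto intro!: derivative_eq_intros)
  from has_derivative_compose[OF this assms]
  show "((\<lambda>y. f (x + y)) has_derivative (\<lambda>v. \<Sum>l\<in>UNIV. v $ l * g l (x + y))) (at y)" by simp
  have "((\<lambda>y. x - y) has_derivative (\<lambda>v. - v)) (at y)" by (auto intro!: derivative_eq_intros)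
  from has_derivative_compose[OF this assms]
  show "((\<lambda>y. f (x - y)) has_derivative (\<lambda>v. \<Sum>l\<in>UNIV. v $ l * (- g l (x - y)))) (at y)" by simp
qed

lemma has_derivative_quadratic:
  fixes H :: "'n::finite \<Rightarrow> 'n \<Rightarrow> real"
  assumes "\<And>l k. H l k = H k l"
  shows "((\<lambda>y. (\<Sum>l\<in>UNIV. \<Sum>k\<in>UNIV. y $ l * y $ k * H l k) / 2) has_derivative
     (\<lambda>v. \<Sum>l\<in>UNIV. v $ l * (\<Sum>k\<in>UNIV. y $ k * H l k))) (at (y :: real ^ 'n))"
proof -
  have c: "((\<lambda>y :: real ^ 'n. y $ l) has_derivative (\<lambda>v. v $ l)) (at y)" for l
    by (rule bounded_linear_imp_has_derivative[OF bounded_linear_vec_nth])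
  have "((\<lambda>y :: real ^ 'n. \<Sum>l\<in>UNIV. \<Sum>k\<in>UNIV. y $ l * y $ k * H l k) has_derivative
     (\<lambda>v. \<Sum>l\<in>UNIV. \<Sum>k\<in>UNIV. (y $ l * v $ k + v $ l * y $ k) * H l k)) (at y)"
    by (intro has_derivative_sum has_derivative_mult_left has_derivative_mult c)
  from has_derivative_mult_right[OF this, of "1/2"]
  have "((\<lambda>y :: real ^ 'n. (\<Sum>l\<in>UNIV. \<Sum>k\<in>UNIV. y $ l * y $ k * H l k) / 2) has_derivative
     (\<lambda>v. (\<Sum>l\<in>UNIV. \<Sum>k\<in>UNIV. (y $ l * v $ k + v $ l * y $ k) * H l k) / 2)) (at y)"
    by simp
  moreover have "(\<Sum>l\<in>UNIV. \<Sum>k\<in>UNIV. (y $ l * v $ k + v $ l * y $ k) * H l k) / 2 =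
     (\<Sum>l\<in>UNIV. v $ l * (\<Sum>k\<in>UNIV. y $ k * H l k))" for v
  proof -
    have "(\<Sum>l\<in>UNIV. \<Sum>k\<in>UNIV. y $ l * v $ k * H l k) = (\<Sum>k\<in>UNIV. \<Sum>l\<in>UNIV. y $ l * v $ k * H l k)"
      by (rule sum.swap)
    also have "\<dots> = (\<Sum>l\<in>UNIV. \<Sum>k\<in>UNIV. v $ l * y $ k * H l k)"
      by (intro sum.cong refl) (use assms in \<open>auto simp: mult_ac\<close>)
    finally have A: "(\<Sum>l\<in>UNIV. \<Sum>k\<in>UNIV. y $ l * v $ k * H l k) = (\<Sum>l\<in>UNIV. \<Sum>k\<in>UNIV. v $ l * y $ k * H l k)" .
    have B: "(x + x) / 2 = x" for x :: real by simp
    show ?thesis unfolding distrib_right sum.distrib A B by (simp only: sum_distrib_left mult.assoc)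
  qed
  ultimately show ?thesis by simp
qed

text \<open>The derivatives in \<open>y\<close> are built from the top down. Those of order 1 and 3
  are odd in \<open>y\<close>; the function itself and the second derivatives are zero at the origin
  because the point value is balanced by the average of its two translates. The Hessian form
  supplies the second-order term, and its symmetry gives its derivative the single-sum form needed
  here. The point \<open>x\<close> is the parameter, so the bounds are uniform in it.\<close>

lemma vanish_symmetric_difference:
  fixes u :: "real ^ 'n \<Rightarrow> real"
  assumes u1: "\<And>x. (u has_derivative (\<lambda>v. \<Sum>l\<in>UNIV. v $ l * u1 l x)) (at x)"
    and u2: "\<And>l x. (u1 l has_derivative (\<lambda>v. \<Sum>k\<in>UNIV. v $ k * u2 l k x)) (at x)"
    and u3: "\<And>l k x. (u2 l k has_derivative (\<lambda>v. \<Sum>i\<in>UNIV. v $ i * u3 l k i x)) (at x)"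
    and u4: "\<And>l k i x. (u3 l k i has_derivative (\<lambda>v. \<Sum>j\<in>UNIV. v $ j * u4 l k i j x)) (at x)"
    and b: "\<And>l k i j x. \<bar>u4 l k i j x\<bar> \<le> M l k i j"
  shows "vanish 4 UNIV (\<lambda>x y. u x - (u (x + y) + u (x - y)) / 2 + (\<Sum>l\<in>UNIV. \<Sum>k\<in>UNIV. y $ l * y $ k * u2 l k x) / 2)"
proof -
  have sym: "u2 l k x = u2 k l x" for l k x
  proof (rule hessian_symmetric[OF u1 u2])
    show "continuous_on UNIV (u2 l k)" for l k
      using u3 by (meson continuous_at_imp_continuous_on has_derivative_continuous)
  qed
  have v0: "vanish 0 UNIV (\<lambda>x y. - (u4 l k i j (x + y) + u4 l k i j (x - y)) / 2)" for l k i j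
  proof -
    have "\<bar>- (u4 l k i j (x + y) + u4 l k i j (x - y)) / 2\<bar> \<le> M l k i j" for x y
      using b[of l k i j "x + y"] b[of l k i j "x - y"] by (simp add: abs_le_iff field_simps)
    then show ?thesis by auto
  qed
  have v1: "vanish (Suc 0) UNIV (\<lambda>x y. - (u3 l k i (x + y) - u3 l k i (x - y)) / 2)" for l k i
  proof (rule vanish_SucI[OF _ _ v0])
    show "((\<lambda>y. - (u3 l k i (x + y) - u3 l k i (x - y)) / 2) has_derivative
      (\<lambda>v. \<Sum>j\<in>UNIV. v $ j * (- (u4 l k i j (x + y) + u4 l k i j (x - y)) / 2))) (at y)" for x y
      using has_derivative_mult_right[OF has_derivative_diff[OF has_derivative_shift[OF u4, of l k i x y]], of "-1/2"]
      by (simp add: sum_distrib_left sum_subtractf[symmetric] sum_negf[symmetric] algebra_simps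
          diff_divide_distrib add_divide_distrib del: sum_negf)
  qed simp
  have v2: "vanish (Suc (Suc 0)) UNIV (\<lambda>x y. u2 l k x - (u2 l k (x + y) + u2 l k (x - y)) / 2)" for l k
  proof (rule vanish_SucI[OF _ _ v1])
    show "((\<lambda>y. u2 l k x - (u2 l k (x + y) + u2 l k (x - y)) / 2) has_derivative
      (\<lambda>v. \<Sum>i\<in>UNIV. v $ i * (- (u3 l k i (x + y) - u3 l k i (x - y)) / 2))) (at y)" for x y
    proof -
      have "((\<lambda>y. u2 l k x - (1/2) * (u2 l k (x + y) + u2 l k (x - y))) has_derivative
        (\<lambda>v. 0 - (1/2) * ((\<Sum>i\<in>UNIV. v $ i * u3 l k i (x + y)) + (\<Sum>i\<in>UNIV. v $ i * - u3 l k i (x - y))))) (at y)"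
        by (intro has_derivative_diff has_derivative_mult_right has_derivative_add has_derivative_const
            has_derivative_shift u3)
      then show ?thesis
        by (simp add: sum_distrib_left sum.distrib[symmetric] sum_negf[symmetric] algebra_simps
          diff_divide_distrib add_divide_distrib del: sum_negf)
    qed
  qed simp
  have v3: "vanish (Suc (Suc (Suc 0))) UNIV (\<lambda>x y. (\<Sum>k\<in>UNIV. y $ k * u2 l k x) - (u1 l (x + y) - u1 l (x - y)) / 2)" for l
  proof (rule vanish_SucI[OF _ _ v2])
    show "((\<lambda>y. (\<Sum>k\<in>UNIV. y $ k * u2 l k x) - (u1 l (x + y) - u1 l (x - y)) / 2) has_derivative
      (\<lambda>v. \<Sum>k\<in>UNIV. v $ k * (u2 l k x - (u2 l k (x + y) + u2 l k (x - y)) / 2))) (at y)" for x y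
    proof -
      have c: "((\<lambda>y :: real ^ 'n. y $ l) has_derivative (\<lambda>v. v $ l)) (at y)" for l
        by (rule bounded_linear_imp_has_derivative[OF bounded_linear_vec_nth])
      have "((\<lambda>y. (\<Sum>k\<in>UNIV. y $ k * u2 l k x) - (1/2) * (u1 l (x + y) - u1 l (x - y))) has_derivative
        (\<lambda>v. (\<Sum>k\<in>UNIV. v $ k * u2 l k x) - (1/2) * ((\<Sum>i\<in>UNIV. v $ i * u2 l i (x + y)) - (\<Sum>i\<in>UNIV. v $ i * - u2 l i (x - y))))) (at y)"
        by (intro has_derivative_diff has_derivative_mult_right has_derivative_mult_left has_derivative_sum c
            has_derivative_shift u2)
      then show ?thesis
        by (simp add: sum_distrib_left sum.distrib[symmetric] sum_subtractf[symmetric] algebra_simps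
          diff_divide_distrib add_divide_distrib)
    qed
  qed simp
  have "vanish (Suc (Suc (Suc (Suc 0)))) UNIV (\<lambda>x y. u x - (u (x + y) + u (x - y)) / 2 + (\<Sum>l\<in>UNIV. \<Sum>k\<in>UNIV. y $ l * y $ k * u2 l k x) / 2)"
  proof (rule vanish_SucI[OF _ _ v3])
    show "((\<lambda>y. u x - (u (x + y) + u (x - y)) / 2 + (\<Sum>l\<in>UNIV. \<Sum>k\<in>UNIV. y $ l * y $ k * u2 l k x) / 2) has_derivative
      (\<lambda>v. \<Sum>l\<in>UNIV. v $ l * ((\<Sum>k\<in>UNIV. y $ k * u2 l k x) - (u1 l (x + y) - u1 l (x - y)) / 2))) (at y)" for x y
    proof -
      have "((\<lambda>y. u x - (1/2) * (u (x + y) + u (x - y)) + (\<Sum>l\<in>UNIV. \<Sum>k\<in>UNIV. y $ l * y $ k * u2 l k x) / 2) has_derivative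
        (\<lambda>v. 0 - (1/2) * ((\<Sum>i\<in>UNIV. v $ i * u1 i (x + y)) + (\<Sum>i\<in>UNIV. v $ i * - u1 i (x - y)))
           + (\<Sum>l\<in>UNIV. v $ l * (\<Sum>k\<in>UNIV. y $ k * u2 l k x)))) (at y)"
        by (intro has_derivative_add has_derivative_diff has_derivative_mult_right has_derivative_const
            has_derivative_shift u1 has_derivative_quadratic sym)
      moreover have "0 - (1/2) * ((\<Sum>i\<in>UNIV. v $ i * u1 i (x + y)) + (\<Sum>i\<in>UNIV. v $ i * - u1 i (x - y)))
           + (\<Sum>l\<in>UNIV. v $ l * (\<Sum>k\<in>UNIV. y $ k * u2 l k x)) =
         (\<Sum>l\<in>UNIV. v $ l * ((\<Sum>k\<in>UNIV. y $ k * u2 l k x) - (u1 l (x + y) - u1 l (x - y)) / 2))" for v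
        by (simp add: right_diff_distrib sum_subtractf sum_negf diff_divide_distrib sum_divide_distrib[symmetric])
      ultimately show ?thesis by simp
    qed
  qed simp
  then show ?thesis by (simp add: eval_nat_numeral del: vanish.simps)
qed

section \<open>The window function; isotropy\<close>

lemma C_k_Ici_SucE:
  fixes f :: "real \<Rightarrow> real"
  assumes "C_k_on (Suc k) {0..} f"
  obtains f' where "\<And>x. 0 \<le> x \<Longrightarrow> (f has_real_derivative f' x) (at x within {0..})"
    and "C_k_on k {0..} f'"
proof -
  obtain D where D: "\<And>x. 0 \<le> x \<Longrightarrow> (f has_derivative D x) (at x within {0..})"
    "\<And>v. C_k_on k {0..} (\<lambda>x. D x v)" using assms by auto
  have d: "(f has_real_derivative D x 1) (at x within {0..})" if "0 \<le> x" for x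
  proof -
    have lin: "linear (D x)" using D(1)[OF that] by (rule has_derivative_linear)
    have "D x v = D x 1 * v" for v using linear_scale[OF lin, of v 1] by simp
    then have "D x = (\<lambda>v. D x 1 * v)" by (rule ext)
    then show ?thesis unfolding has_field_derivative_def using D(1)[OF that] by (simp only: )
  qed
  show ?thesis by (rule that[of "\<lambda>x. D x 1", OF d D(2)])
qed

lemma at_within_Ici_interior:
  fixes x :: real
  assumes "x > 0"
  shows "at x within {0..} = at x"
  by (rule at_within_interior) (use assms in \<open>auto simp: interior_Ici\<close>)

lemma deriv_zero_beyond:
  fixes f :: "real \<Rightarrow> real"
  assumes "\<And>x. 0 \<le> x \<Longrightarrow> (f has_real_derivative f' x) (at x within {0..})"
    and z: "\<And>r. r > L \<Longrightarrow> f r = 0" and "r > L" "L > 0"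
  shows "f' r = 0"
proof -
  have "(f has_real_derivative f' r) (at r)"
    using assms(1)[of r] at_within_Ici_interior[of r] assms by simp
  moreover have "(f has_real_derivative 0) (at r)"
    by (rule has_field_derivative_transform_within_open[of "\<lambda>_. 0" 0 r "{L<..}"]) (use assms in auto)
  ultimately show ?thesis by (rule DERIV_unique)
qed

lemma bounded_beyond_zero:
  fixes f :: "real \<Rightarrow> real"
  assumes "C_k_on k {0..} f" "\<And>r. r > L \<Longrightarrow> f r = 0"
  obtains B where "B \<ge> 0" "\<And>r. r \<ge> 0 \<Longrightarrow> \<bar>f r\<bar> \<le> B"
proof -
  have "continuous_on {0..L} f"
    using C_k_on_imp_continuous[OF assms(1)] by (rule continuous_on_subset) auto
  then have "bounded (f ` {0..L})"
    by (intro compact_imp_bounded compact_continuous_image) auto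
  then obtain B where B: "\<And>y. y \<in> f ` {0..L} \<Longrightarrow> norm y \<le> B" using bounded_iff by metis
  have "\<bar>f r\<bar> \<le> max B 0" if "r \<ge> 0" for r
    using B[of "f r"] assms(2)[of r] that by (cases "r \<le> L") auto
  then show ?thesis using that[of "max B 0"] by auto
qed

text \<open>A bounded function that vanishes beyond \<open>L\<close> is dominated by any power of
  order \<open>m \<le> 0\<close>, since such a power is at least \<open>L powr m\<close> up to
  \<open>L\<close>. This leaves room for lowering the order with each derivative.\<close>

lemma radial_symbol_C_k_compact:
  fixes f :: "real \<Rightarrow> real"
  assumes "C_k_on k {0..} f" "\<And>r. r > L \<Longrightarrow> f r = 0" "L > 0" "m \<le> 0"
  shows "radial_symbol k m f"
  using assms
proof (induction k arbitrary: f m)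
  have bound: "\<exists>M. \<forall>r>0. \<bar>f r\<bar> \<le> M * r powr m"
    if f: "C_k_on k {0..} f" "\<And>r. r > L \<Longrightarrow> f r = 0" "m \<le> 0" for k f and m :: real
  proof -
    obtain B where B: "B \<ge> 0" "\<And>r. r \<ge> 0 \<Longrightarrow> \<bar>f r\<bar> \<le> B" using bounded_beyond_zero[OF f(1,2)] by blast
    have "\<bar>f r\<bar> \<le> (B * L powr (- m)) * r powr m" if r: "r > 0" for r
    proof (cases "r \<le> L")
      case True
      have "1 = L powr (- m) * L powr m" using assms(3) by (simp flip: powr_add)
      also have "\<dots> \<le> L powr (- m) * r powr m"
        by (intro mult_left_mono powr_mono2') (use True r f(3) in auto)
      finally have "B * 1 \<le> B * (L powr (- m) * r powr m)" by (rule mult_left_mono[OF _ B(1)])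
      then show ?thesis using B(2)[of r] r by (simp add: mult.assoc)
    next
      case False
      then show ?thesis using f(2)[of r] B(1) by simp
    qed
    then show ?thesis by blast
  qed
  {
    case 0
    show ?case using bound[OF 0(1,2,4)] by simp
  next
    case (Suc k)
    obtain f' where f': "\<And>x. 0 \<le> x \<Longrightarrow> (f has_real_derivative f' x) (at x within {0..})" "C_k_on k {0..} f'"
      using C_k_Ici_SucE[OF Suc.prems(1)] by blast
    obtain M where M: "\<And>r. r > 0 \<Longrightarrow> \<bar>f r\<bar> \<le> M * r powr m" using bound[OF Suc.prems(1,2,4)] by blast
    show ?case
    proof (rule radial_symbol_SucI[OF M])
      show "(f has_real_derivative f' r) (at r)" if "r > 0" for r
        using f'(1)[of r] at_within_Ici_interior[OF that] that by simp
      show "radial_symbol k (m - 1) f'"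
        by (rule Suc.IH[OF f'(2) deriv_zero_beyond[OF f'(1) Suc.prems(2)] assms(3)])
           (use Suc.prems assms(3) in auto)
    qed
  }
qed

text \<open>The asymptotic condition says nothing about the point 0 itself; continuity there carries
  over the value. The difference quotient is then of order \<open>\<gamma> - 1\<close>, which is
  positive, so the one-sided derivative is zero.\<close>

lemma window_derivative_0:
  fixes w :: "real \<Rightarrow> real"
  assumes w': "(w has_real_derivative D) (at 0 within {0..})"
    and O: "(\<lambda>\<rho>. w \<rho> - 1) \<in> O[at_right 0](\<lambda>\<rho>. \<rho> ^ \<gamma>)" and \<gamma>: "2 \<le> \<gamma>"
  shows "w 0 = 1" "D = 0"
proof -
  obtain c where c: "\<forall>\<^sub>F \<rho> in at_right 0. norm (w \<rho> - 1) \<le> c * norm (\<rho> ^ \<gamma>)"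
    using O by (elim landau_o.bigE) auto
  have ar: "at 0 within {0..} = (at_right 0 :: real filter)" by (rule at_within_Ici_at_right)
  have p0: "((\<lambda>\<rho>::real. c * \<rho> ^ n) \<longlongrightarrow> 0) (at_right 0)" if "n > 0" for n
  proof -
    have "((\<lambda>\<rho>::real. c * \<rho> ^ n) \<longlongrightarrow> c * 0 ^ n) (at_right 0)" by (intro tendsto_intros)
    moreover have "c * 0 ^ n = 0" using that by (simp add: zero_power)
    ultimately show ?thesis by (simp only: )
  qed
  have "((\<lambda>\<rho>. w \<rho> - 1) \<longlongrightarrow> 0) (at_right 0)"
  proof (rule Lim_null_comparison[OF _ p0[of \<gamma>]])
    have "\<forall>\<^sub>F \<rho> in at_right 0. (\<rho>::real) > 0" by (rule eventually_at_right_less)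
    with c show "\<forall>\<^sub>F \<rho> in at_right 0. norm (w \<rho> - 1) \<le> c * \<rho> ^ \<gamma>" by eventually_elim simp
  qed (use \<gamma> in auto)
  moreover have "(w \<longlongrightarrow> w 0) (at_right 0)"
    using has_field_derivative_imp_has_derivative[OF w', THEN has_derivative_continuous]
    by (simp add: continuous_within ar)
  then have "((\<lambda>\<rho>. w \<rho> - 1) \<longlongrightarrow> w 0 - 1) (at_right 0)" by (intro tendsto_intros)
  ultimately have "w 0 - 1 = 0" using tendsto_unique trivial_limit_at_right_real by blast
  then show w0: "w 0 = 1" by simp
  have "((\<lambda>\<rho>. (w \<rho> - w 0) / (\<rho> - 0)) \<longlongrightarrow> D) (at_right 0)"
    using w' unfolding has_field_derivative_iff ar .
  moreover have "((\<lambda>\<rho>. (w \<rho> - w 0) / (\<rho> - 0)) \<longlongrightarrow> 0) (at_right 0)"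
  proof (rule Lim_null_comparison[OF _ p0[of "\<gamma> - 1"]])
    have "\<forall>\<^sub>F \<rho> in at_right 0. (\<rho>::real) > 0" by (rule eventually_at_right_less)
    with c show "\<forall>\<^sub>F \<rho> in at_right 0. norm ((w \<rho> - w 0) / (\<rho> - 0)) \<le> c * \<rho> ^ (\<gamma> - 1)"
    proof eventually_elim
      case (elim \<rho>)
      have "\<rho> ^ \<gamma> = \<rho> ^ (\<gamma> - 1) * \<rho>" using \<gamma> by (simp flip: power_Suc2)
      then show ?case using elim w0 by (simp add: divide_le_eq mult.assoc)
    qed
  qed (use \<gamma> in auto)
  ultimately show "D = 0" using tendsto_unique trivial_limit_at_right_real by blast
qed

lemma deriv_bound_Ici:
  fixes f :: "real \<Rightarrow> real"
  assumes "\<And>x. 0 \<le> x \<Longrightarrow> (f has_real_derivative f' x) (at x within {0..})"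
    and "\<And>x. 0 \<le> x \<Longrightarrow> x \<le> r \<Longrightarrow> \<bar>f' x\<bar> \<le> B" and "0 \<le> r"
  shows "\<bar>f r - f 0\<bar> \<le> B * r"
proof -
  have "norm (f r - f 0) \<le> B * norm (r - 0)"
  proof (rule field_differentiable_bound[of "{0..r}"])
    show "(f has_real_derivative f' z) (at z within {0..r})" if "z \<in> {0..r}" for z
      by (rule DERIV_subset[OF assms(1)]) (use that in auto)
    show "norm (f' z) \<le> B" if "z \<in> {0..r}" for z
      using assms(2)[of z] that by simp
  qed (use assms(3) in simp_all)
  then show ?thesis using assms(3) by simp
qed

text \<open>The value and slope of \<open>w - 1\<close> at 0 vanish, so integrating the bounded
  second derivative twice gives the orders 1 and 2 for all \<open>r\<close>. From the second
  derivative on, the orders required are at most 0 and follow from boundedness and support.\<close>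

lemma radial_symbol_window:
  fixes w :: "real \<Rightarrow> real"
  assumes w: "C_k_on (Suc (Suc k)) {0..} w" and L: "L > 0" and z: "\<And>r. r > L \<Longrightarrow> w r = 0"
    and O: "(\<lambda>\<rho>. w \<rho> - 1) \<in> O[at_right 0](\<lambda>\<rho>. \<rho> ^ \<gamma>)" and \<gamma>: "2 \<le> \<gamma>"
  shows "radial_symbol (Suc (Suc k)) 2 (\<lambda>r. w r - 1)"
proof -
  obtain w1 where w1: "\<And>x. 0 \<le> x \<Longrightarrow> (w has_real_derivative w1 x) (at x within {0..})" "C_k_on (Suc k) {0..} w1"
    using C_k_Ici_SucE[OF w] by blast
  have z1: "\<And>r. r > L \<Longrightarrow> w1 r = 0" using deriv_zero_beyond[OF w1(1) z] L by blast
  obtain w2 where w2: "\<And>x. 0 \<le> x \<Longrightarrow> (w1 has_real_derivative w2 x) (at x within {0..})" "C_k_on k {0..} w2"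
    using C_k_Ici_SucE[OF w1(2)] by blast
  have z2: "\<And>r. r > L \<Longrightarrow> w2 r = 0" using deriv_zero_beyond[OF w2(1) z1] L by blast
  have w0: "w 0 = 1" "w1 0 = 0" using window_derivative_0[OF w1(1) O \<gamma>] by auto
  obtain B where B: "B \<ge> 0" "\<And>r. r \<ge> 0 \<Longrightarrow> \<bar>w2 r\<bar> \<le> B" using bounded_beyond_zero[OF w2(2) z2] by blast
  have b1: "\<bar>w1 r\<bar> \<le> B * r" if "r \<ge> 0" for r
    using deriv_bound_Ici[OF w2(1), where r = r and B = B] B that w0 by simp
  have b0: "\<bar>w r - 1\<bar> \<le> (B * r) * r" if "r \<ge> 0" for r
  proof -
    have "\<bar>w1 x\<bar> \<le> B * r" if "0 \<le> x" "x \<le> r" for x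
      using b1[OF that(1)] mult_left_mono[OF that(2) B(1)] by linarith
    then show ?thesis using deriv_bound_Ici[OF w1(1), where r = r and B = "B * r"] that w0 by simp
  qed
  have r2: "radial_symbol k 0 w2" by (rule radial_symbol_C_k_compact[OF w2(2) z2 L]) auto
  have r1: "radial_symbol (Suc k) 1 w1"
  proof (rule radial_symbol_SucI[where M = B and g = w2])
    show "\<bar>w1 r\<bar> \<le> B * r powr 1" if "r > 0" for r using b1[of r] that by simp
    show "(w1 has_real_derivative w2 r) (at r)" if "r > 0" for r
      using w2(1)[of r] at_within_Ici_interior[OF that] that by simp
  qed (use r2 in simp)
  show ?thesis
  proof (rule radial_symbol_SucI[where M = B and g = w1])
    show "\<bar>w r - 1\<bar> \<le> B * r powr 2" if "r > 0" for r
      using b0[of r] that by (simp add: power2_eq_square)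
    show "((\<lambda>r. w r - 1) has_real_derivative w1 r) (at r)" if "r > 0" for r
      using DERIV_diff[OF w1(1)[of r] DERIV_const[of 1]] at_within_Ici_interior[OF that] that by simp
  qed (use r1 in simp)
qed

section \<open>Lattice symmetries and isotropy of second moments\<close>

lemma norm_flip [simp]: "norm (flip i y) = norm (y :: real ^ 'n)"
  unfolding norm_vec_def L2_set_def by (rule arg_cong[of _ _ sqrt], rule sum.cong) (auto simp: flip_def)

lemma norm_swap [simp]: "norm (swap i k y) = norm (y :: real ^ 'n)"
  unfolding norm_vec_def L2_set_def swap_def vec_lambda_beta
  by (rule arg_cong[of _ _ sqrt], rule sum.reindex_bij_betw[of _ UNIV UNIV "\<lambda>l. (norm (y $ l))\<^sup>2"]) simp

lemma lattice_point_flip: "lattice_point h (flip i j) = flip i (lattice_point h j)"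
  by (simp add: lattice_point_def flip_def vec_eq_iff)

lemma lattice_point_swap: "lattice_point h (swap i k j) = swap i k (lattice_point h j)"
  by (simp add: lattice_point_def swap_def vec_eq_iff)

lemma bij_flip: "bij_betw (flip i) UNIV (UNIV :: (int ^ 'n) set)"
  by (rule bij_betw_byWitness[where f' = "flip i"]) (auto simp: flip_def vec_eq_iff)

lemma bij_swap: "bij_betw (swap i k) UNIV (UNIV :: (int ^ 'n) set)"
  by (rule bij_betw_byWitness[where f' = "swap i k"]) (auto simp: swap_def vec_eq_iff)

lemma infsum_lattice_flip:
  "(\<Sum>\<^sub>\<infinity>j\<in>UNIV. f (flip i (lattice_point h j))) = (\<Sum>\<^sub>\<infinity>j\<in>UNIV. f (lattice_point h j) :: real)"
  using infsum_reindex_bij_betw[OF bij_flip, of "\<lambda>j. f (lattice_point h j)" i]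
  by (simp add: lattice_point_flip)

lemma infsum_lattice_swap:
  "(\<Sum>\<^sub>\<infinity>j\<in>UNIV. f (swap i k (lattice_point h j))) = (\<Sum>\<^sub>\<infinity>j\<in>UNIV. f (lattice_point h j) :: real)"
  using infsum_reindex_bij_betw[OF bij_swap, of "\<lambda>j. f (lattice_point h j)" i k]
  by (simp add: lattice_point_swap)

text \<open>Such a \<open>c\<close> is a multiple of the identity, so contracting it with
  \<open>H\<close> sees only the two traces.\<close>

lemma isotropic_contraction:
  fixes c H :: "'n::finite \<Rightarrow> 'n \<Rightarrow> real"
  assumes off: "\<And>l k. l \<noteq> k \<Longrightarrow> c l k = 0" and diag: "\<And>l k. c l l = c k k"
  shows "(\<Sum>l\<in>UNIV. \<Sum>k\<in>UNIV. c l k * H l k) = (\<Sum>l\<in>UNIV. H l l) / real CARD('n) * (\<Sum>l\<in>UNIV. c l l)"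
proof -
  obtain l0 :: 'n where True by blast
  have "(\<Sum>k\<in>UNIV. c l k * H l k) = c l0 l0 * H l l" for l
  proof -
    have "(\<Sum>k\<in>UNIV. c l k * H l k) = (\<Sum>k\<in>UNIV. if k = l then c l l * H l l else 0)"
      by (rule sum.cong) (auto simp: off)
    then show ?thesis using diag[of l l0] by simp
  qed
  moreover have "(\<Sum>l\<in>UNIV. c l l) = real CARD('n) * c l0 l0"
  proof -
    have "(\<Sum>l\<in>UNIV. c l l) = (\<Sum>l\<in>(UNIV :: 'n set). c l0 l0)" by (rule sum.cong[OF refl diag])
    then show ?thesis by simp
  qed
  ultimately show ?thesis by (simp add: sum_distrib_left[symmetric])
qed

lemma norm_sq_cart: "norm (y :: real ^ 'n) ^ 2 = (\<Sum>l\<in>UNIV. y $ l * y $ l)"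
  by (simp add: power2_norm_eq_inner inner_vec_def)

lemma abs_component_mult_le: "\<bar>(y :: real ^ 'n) $ l * y $ k\<bar> \<le> norm y ^ 2"
  unfolding abs_mult power2_eq_square by (intro mult_mono component_le_norm_cart) auto

lemma swap_component: "swap l k y $ l = y $ k"
  by (simp add: swap_def)

lemma flip_component: "flip i y $ l = (if l = i then - y $ l else y $ l)"
  by (simp add: flip_def)

text \<open>Reflections remove the mixed moments and coordinate exchanges equate the pure ones. With
  the Hessian as \<open>H\<close> this converts the quadratic form into the Laplacian used by the
  scheme.\<close>

lemma integral_radial_quadratic:
  fixes \<phi> :: "real \<Rightarrow> real" and H :: "'n::finite \<Rightarrow> 'n \<Rightarrow> real"
  assumes [measurable]: "(\<lambda>y :: real ^ 'n. \<phi> (norm y)) \<in> borel_measurable borel"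
    and int: "integrable lborel (\<lambda>y :: real ^ 'n. \<phi> (norm y) * norm y ^ 2)"
  shows "integrable lborel (\<lambda>y :: real ^ 'n. \<phi> (norm y) * (\<Sum>l\<in>UNIV. \<Sum>k\<in>UNIV. y $ l * y $ k * H l k))"
    and "(LINT y :: real ^ 'n|lborel. \<phi> (norm y) * (\<Sum>l\<in>UNIV. \<Sum>k\<in>UNIV. y $ l * y $ k * H l k)) =
      (\<Sum>l\<in>UNIV. H l l) / real CARD('n) * (LINT y :: real ^ 'n|lborel. \<phi> (norm y) * norm y ^ 2)"
proof -
  define c where "c l k = (LINT y :: real ^ 'n|lborel. \<phi> (norm y) * (y $ l * y $ k))" for l k
  have i: "integrable lborel (\<lambda>y :: real ^ 'n. \<phi> (norm y) * (y $ l * y $ k))" for l k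
  proof (rule Bochner_Integration.integrable_bound[OF int])
    show "AE y in lborel. norm (\<phi> (norm y) * ((y :: real ^ 'n) $ l * y $ k)) \<le> norm (\<phi> (norm y) * norm y ^ 2)"
      unfolding norm_mult real_norm_def abs_mult[symmetric]
      by (intro AE_I2, unfold abs_mult[of "\<phi> _"], intro mult_left_mono)
         (auto simp: abs_component_mult_le)
  qed measurable
  have eq: "\<phi> (norm y) * (\<Sum>l\<in>UNIV. \<Sum>k\<in>UNIV. y $ l * y $ k * H l k) =
      (\<Sum>l\<in>UNIV. \<Sum>k\<in>UNIV. \<phi> (norm y) * (y $ l * y $ k) * H l k)" for y :: "real ^ 'n"
    by (simp add: sum_distrib_left mult.assoc)
  have i1: "integrable lborel (\<lambda>y :: real ^ 'n. \<phi> (norm y) * (y $ l * y $ k) * H l k)" for l k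
    by (rule integrable_mult_left[OF i])
  have i2: "integrable lborel (\<lambda>y :: real ^ 'n. \<Sum>k\<in>UNIV. \<phi> (norm y) * (y $ l * y $ k) * H l k)" for l
    by (rule Bochner_Integration.integrable_sum[OF i1])
  show "integrable lborel (\<lambda>y :: real ^ 'n. \<phi> (norm y) * (\<Sum>l\<in>UNIV. \<Sum>k\<in>UNIV. y $ l * y $ k * H l k))"
    unfolding eq by (rule Bochner_Integration.integrable_sum[OF i2])
  have "(LINT y :: real ^ 'n|lborel. \<phi> (norm y) * (\<Sum>l\<in>UNIV. \<Sum>k\<in>UNIV. y $ l * y $ k * H l k)) =
     (\<Sum>l\<in>UNIV. \<Sum>k\<in>UNIV. c l k * H l k)"
    unfolding eq c_def by (simp only: Bochner_Integration.integral_sum[OF i2]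
      Bochner_Integration.integral_sum[OF i1] integral_mult_left_zero)
  also have "\<dots> = (\<Sum>l\<in>UNIV. H l l) / real CARD('n) * (\<Sum>l\<in>UNIV. c l l)"
  proof (rule isotropic_contraction)
    show "c l k = 0" if "l \<noteq> k" for l k
      unfolding c_def by (rule integral_odd_zero[OF distr_flip[of l]]) (use that in \<open>auto simp: flip_component\<close>)
    show "c l l = c k k" for l k
    proof -
      have "(LINT y :: real ^ 'n|lborel. \<phi> (norm (swap l k y)) * (swap l k y $ l * swap l k y $ l)) = c l l"
        unfolding c_def
        by (rule integral_comp_distr_lborel[OF distr_swap, where f = "\<lambda>y. \<phi> (norm y) * (y $ l * y $ l)"]) measurable
      then show ?thesis by (simp add: swap_component c_def)
    qed
  qed
  also have "(\<Sum>l\<in>UNIV. c l l) = (LINT y :: real ^ 'n|lborel. \<phi> (norm y) * norm y ^ 2)"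
    unfolding c_def norm_sq_cart sum_distrib_left by (rule Bochner_Integration.integral_sum[OF i, symmetric])
  finally show "(LINT y :: real ^ 'n|lborel. \<phi> (norm y) * (\<Sum>l\<in>UNIV. \<Sum>k\<in>UNIV. y $ l * y $ k * H l k)) =
      (\<Sum>l\<in>UNIV. H l l) / real CARD('n) * (LINT y :: real ^ 'n|lborel. \<phi> (norm y) * norm y ^ 2)" .
qed

text \<open>The same symmetries permute the lattice, so the discrete moments are isotropic with the
  very same factor as the integral; the conversion to the Laplacian thus introduces no error on
  either side.\<close>

lemma lattice_radial_quadratic:
  fixes \<phi> :: "real \<Rightarrow> real" and H :: "'n::finite \<Rightarrow> 'n \<Rightarrow> real" and h :: real
  defines "Y \<equiv> lattice_point h :: int ^ 'n \<Rightarrow> real ^ 'n"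
  assumes summ: "(\<lambda>j. \<phi> (norm (Y j)) * norm (Y j) ^ 2) summable_on UNIV"
  shows "(\<lambda>j. \<phi> (norm (Y j)) * (\<Sum>l\<in>UNIV. \<Sum>k\<in>UNIV. Y j $ l * Y j $ k * H l k)) summable_on UNIV"
    and "(\<Sum>\<^sub>\<infinity>j\<in>UNIV. \<phi> (norm (Y j)) * (\<Sum>l\<in>UNIV. \<Sum>k\<in>UNIV. Y j $ l * Y j $ k * H l k)) =
      (\<Sum>l\<in>UNIV. H l l) / real CARD('n) * (\<Sum>\<^sub>\<infinity>j\<in>UNIV. \<phi> (norm (Y j)) * norm (Y j) ^ 2)"
proof -
  define c where "c l k = (\<Sum>\<^sub>\<infinity>j\<in>UNIV. \<phi> (norm (Y j)) * (Y j $ l * Y j $ k))" for l k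
  have i: "(\<lambda>j. \<phi> (norm (Y j)) * (Y j $ l * Y j $ k)) summable_on UNIV" for l k
  proof -
    have "(\<lambda>j. norm (\<phi> (norm (Y j)) * norm (Y j) ^ 2)) summable_on UNIV"
      by (rule iffD1[OF summable_on_iff_abs_summable_on_real summ])
    then have "(\<lambda>j. norm (\<phi> (norm (Y j)) * (Y j $ l * Y j $ k))) summable_on UNIV"
    proof (rule Infinite_Sum.abs_summable_on_comparison_test')
      show "norm (\<phi> (norm (Y j)) * (Y j $ l * Y j $ k)) \<le> norm (\<phi> (norm (Y j)) * norm (Y j) ^ 2)" for j
        unfolding real_norm_def abs_mult[of "\<phi> _"]
        by (intro mult_left_mono) (auto simp: abs_component_mult_le)
    qed
    then show ?thesis by (rule abs_summable_summable)
  qed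
  have eq: "\<phi> (norm (Y j)) * (\<Sum>l\<in>UNIV. \<Sum>k\<in>UNIV. Y j $ l * Y j $ k * H l k) =
      (\<Sum>l\<in>UNIV. \<Sum>k\<in>UNIV. \<phi> (norm (Y j)) * (Y j $ l * Y j $ k) * H l k)" for j
    by (simp add: sum_distrib_left mult.assoc)
  have hs: "((\<lambda>j. \<phi> (norm (Y j)) * (Y j $ l * Y j $ k)) has_sum c l k) UNIV" for l k
    unfolding c_def using i by (rule has_sum_infsum)
  have hs': "((\<lambda>j. \<phi> (norm (Y j)) * (\<Sum>l\<in>UNIV. \<Sum>k\<in>UNIV. Y j $ l * Y j $ k * H l k)) has_sum
      (\<Sum>l\<in>UNIV. \<Sum>k\<in>UNIV. c l k * H l k)) UNIV"
    unfolding eq by (intro has_sum_finite_sum finite has_sum_cmult_left hs)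
  then show "(\<lambda>j. \<phi> (norm (Y j)) * (\<Sum>l\<in>UNIV. \<Sum>k\<in>UNIV. Y j $ l * Y j $ k * H l k)) summable_on UNIV"
    by (auto simp: summable_on_def)
  have "(\<Sum>\<^sub>\<infinity>j\<in>UNIV. \<phi> (norm (Y j)) * (\<Sum>l\<in>UNIV. \<Sum>k\<in>UNIV. Y j $ l * Y j $ k * H l k)) =
     (\<Sum>l\<in>UNIV. \<Sum>k\<in>UNIV. c l k * H l k)"
    using hs' by (rule infsumI)
  also have "\<dots> = (\<Sum>l\<in>UNIV. H l l) / real CARD('n) * (\<Sum>l\<in>UNIV. c l l)"
  proof (rule isotropic_contraction)
    show "c l k = 0" if "l \<noteq> k" for l k
    proof -
      have "c l k = - c l k"
        using infsum_lattice_flip[of "\<lambda>y. \<phi> (norm y) * (y $ l * y $ k)" l h] that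
        by (simp add: c_def Y_def flip_component infsum_uminus)
      then show ?thesis by simp
    qed
    show "c l l = c k k" for l k
      using infsum_lattice_swap[of "\<lambda>y. \<phi> (norm y) * (y $ l * y $ l)" l k h]
      by (simp add: c_def Y_def swap_component)
  qed
  also have "(\<Sum>l\<in>UNIV. c l l) = (\<Sum>\<^sub>\<infinity>j\<in>UNIV. \<phi> (norm (Y j)) * norm (Y j) ^ 2)"
  proof (rule infsumI[symmetric])
    show "((\<lambda>j. \<phi> (norm (Y j)) * norm (Y j) ^ 2) has_sum (\<Sum>l\<in>UNIV. c l l)) UNIV"
      unfolding norm_sq_cart sum_distrib_left by (intro has_sum_finite_sum finite hs)
  qed
  finally show "(\<Sum>\<^sub>\<infinity>j\<in>UNIV. \<phi> (norm (Y j)) * (\<Sum>l\<in>UNIV. \<Sum>k\<in>UNIV. Y j $ l * Y j $ k * H l k)) =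
      (\<Sum>l\<in>UNIV. H l l) / real CARD('n) * (\<Sum>\<^sub>\<infinity>j\<in>UNIV. \<phi> (norm (Y j)) * norm (Y j) ^ 2)" .
qed

section \<open>The tempered kernel\<close>

text \<open>The exponent is free because both d + \<alpha> and d + \<alpha> - 2 occur. At the origin
  the value is \<open>0\<close>, which lets sums over nonzero lattice points be taken over the whole
  lattice.\<close>

definition tkernel :: "real \<Rightarrow> real \<Rightarrow> real ^ 'n \<Rightarrow> real" where
  "tkernel lam a y = 1 / (exp (lam * norm y) * norm y powr a)"

lemma tkernel_0 [simp]: "tkernel lam a 0 = 0"
  by (simp add: tkernel_def)

lemma tkernel_nonneg [simp]: "0 \<le> tkernel lam a y"
  by (simp add: tkernel_def)

lemma tkernel_minus [simp]: "tkernel lam a (- y) = tkernel lam a y"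
  by (simp add: tkernel_def)

lemma measurable_tkernel [measurable]: "tkernel lam a \<in> borel_measurable borel"
  unfolding tkernel_def by measurable

lemma tkernel_le:
  assumes "0 \<le> lam"
  shows "tkernel lam a y \<le> norm y powr (- a)"
proof (cases "y = 0")
  case False
  have "1 * norm y powr a \<le> exp (lam * norm y) * norm y powr a"
    by (rule mult_right_mono) (use assms in auto)
  then have "tkernel lam a y \<le> 1 / norm y powr a"
    unfolding tkernel_def using False by (intro divide_left_mono) auto
  then show ?thesis by (simp add: powr_minus_divide)
qed simp

lemma symbol_tkernel:
  assumes "0 \<le> lam"
  shows "symbol k P (- a) (\<lambda>p. tkernel lam a)"
proof -
  have "symbol k P (0 + - a) (\<lambda>p (y :: real ^ 'n). exp (- (lam * norm y)) * (1 * norm y powr (- a)))"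
    by (rule symbol_mult[OF symbol_radial[OF radial_symbol_exp[OF assms]] symbol_radial[OF radial_symbol_powr]])
  then show ?thesis
    by (simp add: tkernel_def[abs_def] exp_minus powr_minus divide_inverse)
qed

lemma tkernel_minus_2:
  assumes "y \<noteq> 0"
  shows "tkernel lam (a - 2) y = norm y ^ 2 * tkernel lam a y"
  using assms by (simp add: tkernel_def powr_diff)

text \<open>The truncated domain is invariant under reflection in \<open>x\<close>, so the integrand
  may be averaged with its mirror image before the limit. The average is integrable up to the
  singularity, and dominated convergence removes the truncation.\<close>

lemma pv_integral_symmetric:
  fixes u :: "real ^ 'n \<Rightarrow> real"
  assumes [measurable]: "u \<in> borel_measurable borel" and B: "\<And>y. \<bar>u y\<bar> \<le> B"
    and lam: "0 \<le> lam" and a: "real CARD('n) < a"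
    and G: "integrable lborel (\<lambda>z. (u x - (u (x + z) + u (x - z)) / 2) * tkernel lam a z)"
  shows "pv_integral (\<lambda>y. (u x - u y) / (exp (lam * norm (x - y)) * norm (x - y) powr a)) x =
     (LINT z|lborel. (u x - (u (x + z) + u (x - z)) / 2) * tkernel lam a z)"
proof -
  let ?g = "\<lambda>y. (u x - u y) / (exp (lam * norm (x - y)) * norm (x - y) powr a)"
  let ?G = "\<lambda>z. (u x - (u (x + z) + u (x - z)) / 2) * tkernel lam a z"
  have trunc: "(LINT y:{y. \<epsilon> < norm (x - y)}|lborel. ?g y) = (LINT z|lborel. indicator {z. \<epsilon> < norm z} z * ?G z)"
    if \<epsilon>: "\<epsilon> > 0" for \<epsilon>
  proof -
    define P where "P z = indicator {z. \<epsilon> < norm z} z * ((u x - u (x + z)) * tkernel lam a z)" for z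
    have Pm [measurable]: "P \<in> borel_measurable borel" unfolding P_def by measurable
    \<comment> \<open>The first entry bounds the integrand by the power of order \<open>- a\<close>;
      the second is its largest possible size outside the excised ball, giving order 0 near the
      origin.\<close>
    define M where "M = max (2 * B) (2 * B * \<epsilon> powr (- a))"
    have Pi: "integrable lborel P"
    proof (rule integrable_powr_bounds[where m = 0 and s = "- a" and M = M])
      fix y :: "real ^ 'n" assume "y \<noteq> 0"
      have "\<bar>u x - u (x + y)\<bar> \<le> 2 * B" using B[of x] B[of "x + y"] by linarith
      then have P1: "\<bar>P y\<bar> \<le> indicator {z. \<epsilon> < norm z} y * (2 * B * norm y powr (- a))"
        unfolding P_def abs_mult using tkernel_le[OF lam, of a y]
        by (intro mult_mono) auto
      have B0: "B \<ge> 0" using B[of x] by linarith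
      have "\<bar>P y\<bar> \<le> 2 * B * norm y powr (- a)"
        using P1 B0 by (cases "\<epsilon> < norm y") auto
      also have "\<dots> \<le> M * norm y powr (- a)" by (intro mult_right_mono) (auto simp: M_def)
      finally show "\<bar>P y\<bar> \<le> M * norm y powr (- a)" .
      have "\<bar>P y\<bar> \<le> 2 * B * \<epsilon> powr (- a)"
      proof (cases "\<epsilon> < norm y")
        case True
        have "norm y powr (- a) \<le> \<epsilon> powr (- a)" by (rule powr_mono2') (use True \<epsilon> a in auto)
        then have "2 * B * norm y powr (- a) \<le> 2 * B * \<epsilon> powr (- a)" using B0 by (intro mult_left_mono) auto
        then show ?thesis using P1 True by simp
      next
        case False
        then show ?thesis using B0 by (simp add: P_def)
      qed
      then show "\<bar>P y\<bar> \<le> M * norm y powr 0" using \<open>y \<noteq> 0\<close> by (simp add: M_def)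
    qed (use a in auto)
    have "(LINT y:{y. \<epsilon> < norm (x - y)}|lborel. ?g y) = (LINT y|lborel. indicator {y. \<epsilon> < norm (x - y)} y * ?g y)"
      by (simp add: set_lebesgue_integral_def)
    also have "\<dots> = (LINT z|lborel. indicator {y. \<epsilon> < norm (x - y)} (x + z) * ?g (x + z))"
      by (rule integral_translate[symmetric, where f = "\<lambda>y. indicator {y. \<epsilon> < norm (x - y)} y * ?g y"]) measurable
    also have "\<dots> = (LINT z|lborel. P z)"
      by (rule Bochner_Integration.integral_cong) (auto simp: P_def tkernel_def indicator_def)
    finally have 1: "(LINT y:{y. \<epsilon> < norm (x - y)}|lborel. ?g y) = (LINT z|lborel. P z)" .
    have 2: "(LINT z|lborel. P (- z)) = (LINT z|lborel. P z)"
      by (rule integral_comp_distr_lborel[OF distr_uminus]) auto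
    have Pi': "integrable lborel (\<lambda>z. P (- z))"
    proof -
      have "integrable (distr lborel borel uminus) P" using Pi by (simp add: distr_uminus)
      then show ?thesis by (subst (asm) integrable_distr_eq) auto
    qed
    have "(LINT z|lborel. P z) = (LINT z|lborel. (P z + P (- z)) / 2)"
      by (simp add: Bochner_Integration.integral_add[OF Pi Pi'] 2)
    also have "\<dots> = (LINT z|lborel. indicator {z. \<epsilon> < norm z} z * ?G z)"
      by (rule Bochner_Integration.integral_cong) (auto simp: P_def indicator_def field_simps)
    finally show ?thesis using 1 by simp
  qed
  have "((\<lambda>t. LINT z|lborel. indicator {z. inverse t < norm z} z * ?G z) \<longlongrightarrow> (LINT z|lborel. ?G z)) at_top"
  \<comment> \<open>The radius is written as \<open>inverse t\<close>, so that shrinking the ball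
    becomes a limit at infinity.\<close>
  proof (rule integral_dominated_convergence_at_top[where w = "\<lambda>z. norm (?G z)"])
    show "AE z in lborel. ((\<lambda>t. indicator {z. inverse t < norm z} z * ?G z) \<longlongrightarrow> ?G z) at_top"
    proof (rule AE_I2)
      fix z :: "real ^ 'n"
      show "((\<lambda>t. indicator {z. inverse t < norm z} z * ?G z) \<longlongrightarrow> ?G z) at_top"
      proof (cases "z = 0")
        case False
        have "\<forall>\<^sub>F t in at_top. inverse (norm z) < t" by (rule eventually_gt_at_top)
        then have "\<forall>\<^sub>F t in at_top. indicator {z. inverse t < norm z} z * ?G z = ?G z"
        proof eventually_elim
          case (elim t)
          then have "inverse t < norm z" using False
            by (metis inverse_inverse_eq less_imp_inverse_less positive_imp_inverse_positive zero_less_norm_iff)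
          then show ?case by simp
        qed
        then show ?thesis by (rule tendsto_eventually)
      qed simp
    qed
    show "\<forall>\<^sub>F t in at_top. AE z in lborel. norm (indicator {z. inverse t < norm z} z * ?G z) \<le> norm (?G z)"
      by (auto simp: indicator_def)
    show "integrable lborel (\<lambda>z. norm (?G z))" by (rule integrable_norm[OF G])
  qed measurable
  then have "((\<lambda>\<epsilon>. LINT z|lborel. indicator {z. \<epsilon> < norm z} z * ?G z) \<longlongrightarrow> (LINT z|lborel. ?G z)) (at_right 0)"
    by (subst filterlim_at_right_to_top)
  moreover have "\<forall>\<^sub>F \<epsilon> in at_right 0. (LINT z|lborel. indicator {z. \<epsilon> < norm z} z * ?G z) =
      (LINT y:{y. \<epsilon> < norm (x - y)}|lborel. ?g y)"
    using eventually_at_right_less[of "0::real"] by eventually_elim (use trunc in auto)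
  ultimately have "((\<lambda>\<epsilon>. LINT y:{y. \<epsilon> < norm (x - y)}|lborel. ?g y) \<longlongrightarrow> (LINT z|lborel. ?G z)) (at_right 0)"
    by (rule Lim_transform_eventually)
  then show ?thesis unfolding pv_integral_def by (intro tendsto_Lim) auto
qed

section \<open>Sums over the scaled lattice\<close>

lemma summable_lattice_powr:
  assumes "h > 0" "s < - real CARD('n)"
  shows "(\<lambda>j. norm (lattice_point h j :: real ^ 'n) powr s) summable_on UNIV"
proof -
  have "(\<lambda>j. h powr s * norm (zpoint j :: real ^ 'n) powr s) summable_on UNIV"
    by (intro summable_on_cmult_right summable_on_zpoint_powr assms)
  then show ?thesis using assms by (simp add: lattice_point_scale[of h] powr_mult)
qed

lemma summable_lattice_bound:
  fixes f :: "real ^ 'n \<Rightarrow> real"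
  assumes "h > 0" "s < - real CARD('n)" and f: "\<And>y. \<bar>f y\<bar> \<le> M * norm y powr s"
  shows "(\<lambda>j. f (lattice_point h j)) summable_on UNIV"
proof -
  have "(\<lambda>j. M * norm (lattice_point h j :: real ^ 'n) powr s) summable_on UNIV"
    by (intro summable_on_cmult_right summable_lattice_powr assms)
  then have "(\<lambda>j. norm (f (lattice_point h j))) summable_on UNIV"
    by (rule Infinite_Sum.abs_summable_on_comparison_test') (use f in auto)
  then show ?thesis by (rule abs_summable_summable)
qed

lemma infsum_lattice_minus:
  "(\<Sum>\<^sub>\<infinity>j\<in>UNIV. f (- lattice_point h (j :: int ^ 'n))) = (\<Sum>\<^sub>\<infinity>j\<in>UNIV. f (lattice_point h j) :: real)"
proof -
  have "bij_betw uminus UNIV (UNIV :: (int ^ 'n) set)"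
    by (rule bij_betw_byWitness[where f' = uminus]) auto
  moreover have "lattice_point h (- j) = - lattice_point h j" for j :: "int ^ 'n"
    by (simp add: lattice_point_def vec_eq_iff)
  ultimately show ?thesis
    using infsum_reindex_bij_betw[of uminus UNIV UNIV "\<lambda>j :: int ^ 'n. f (lattice_point h j)"] by simp
qed

lemma lattice_point_0 [simp]: "lattice_point h 0 = 0"
  by (simp add: lattice_point_def vec_eq_iff)

lemma infsum_remove_0:
  "f 0 = 0 \<Longrightarrow> (\<Sum>\<^sub>\<infinity>j\<in>UNIV - {0 :: int ^ 'n}. f j) = (\<Sum>\<^sub>\<infinity>j\<in>UNIV. f j :: real)"
  by (rule infsum_cong_neutral) auto

text \<open>The discrete counterpart of the symmetrised principal value. Boundedness of
  \<open>u\<close> and \<open>a\<close> above the dimension make each sum converge absolutely, so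
  they may be split and reindexed by negation.\<close>

lemma lattice_symmetrized_sum:
  fixes u :: "real ^ 'n \<Rightarrow> real"
  assumes B: "\<And>y. \<bar>u y\<bar> \<le> B" and lam: "0 \<le> lam" and a: "real CARD('n) < a" and h: "h > 0"
  shows "(\<lambda>j. (u x - (u (x + lattice_point h j) + u (x - lattice_point h j)) / 2) * tkernel lam a (lattice_point h j)) summable_on UNIV"
    and "(\<Sum>\<^sub>\<infinity>j\<in>UNIV. tkernel lam a (lattice_point h j :: real ^ 'n)) * u x
      - (\<Sum>\<^sub>\<infinity>j\<in>UNIV. u (x + lattice_point h j) * tkernel lam a (lattice_point h j)) =
     (\<Sum>\<^sub>\<infinity>j\<in>UNIV. (u x - (u (x + lattice_point h j) + u (x - lattice_point h j)) / 2) * tkernel lam a (lattice_point h j))"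
proof -
  let ?Y = "lattice_point h :: int ^ 'n \<Rightarrow> real ^ 'n"
  have B0: "B \<ge> 0" using B[of x] by linarith
  have t: "(\<lambda>j. tkernel lam a (?Y j)) summable_on UNIV"
    by (rule summable_lattice_bound[OF h, where s = "- a" and M = 1]) (use a tkernel_le[OF lam] in auto)
  have sp: "(\<lambda>j. u (x + ?Y j) * tkernel lam a (?Y j)) summable_on UNIV"
    by (rule summable_lattice_bound[OF h, where s = "- a" and M = B and f = "\<lambda>y. u (x + y) * tkernel lam a y"])
       (use a tkernel_le[OF lam] B B0 in \<open>auto simp: abs_mult intro!: mult_mono\<close>)
  have sm: "(\<lambda>j. u (x - ?Y j) * tkernel lam a (?Y j)) summable_on UNIV"
    by (rule summable_lattice_bound[OF h, where s = "- a" and M = B and f = "\<lambda>y. u (x - y) * tkernel lam a y"])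
       (use a tkernel_le[OF lam] B B0 in \<open>auto simp: abs_mult intro!: mult_mono\<close>)
  define T where "T = (\<Sum>\<^sub>\<infinity>j\<in>UNIV. tkernel lam a (?Y j))"
  define U where "U = (\<Sum>\<^sub>\<infinity>j\<in>UNIV. u (x + ?Y j) * tkernel lam a (?Y j))"
  have U': "(\<Sum>\<^sub>\<infinity>j\<in>UNIV. u (x - ?Y j) * tkernel lam a (?Y j)) = U"
    using infsum_lattice_minus[of "\<lambda>y. u (x + y) * tkernel lam a y" h] by (simp add: U_def)
  have ht: "((\<lambda>j. tkernel lam a (?Y j)) has_sum T) UNIV" unfolding T_def using t by (rule has_sum_infsum)
  have hp: "((\<lambda>j. u (x + ?Y j) * tkernel lam a (?Y j)) has_sum U) UNIV" unfolding U_def using sp by (rule has_sum_infsum)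
  have hm: "((\<lambda>j. u (x - ?Y j) * tkernel lam a (?Y j)) has_sum U) UNIV" unfolding U'[symmetric] using sm by (rule has_sum_infsum)
  have "((\<lambda>j. u x * tkernel lam a (?Y j) + (- 1 / 2) * (u (x + ?Y j) * tkernel lam a (?Y j))
       + (- 1 / 2) * (u (x - ?Y j) * tkernel lam a (?Y j))) has_sum (u x * T + (- 1 / 2) * U + (- 1 / 2) * U)) UNIV"
    by (intro has_sum_add has_sum_cmult_right ht hp hm)
  then have "((\<lambda>j. (u x - (u (x + ?Y j) + u (x - ?Y j)) / 2) * tkernel lam a (?Y j)) has_sum (T * u x - U)) UNIV"
    by (simp add: algebra_simps add_divide_distrib)
  then show "(\<lambda>j. (u x - (u (x + lattice_point h j) + u (x - lattice_point h j)) / 2) * tkernel lam a (lattice_point h j)) summable_on UNIV"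
    and "(\<Sum>\<^sub>\<infinity>j\<in>UNIV. tkernel lam a (lattice_point h j :: real ^ 'n)) * u x
      - (\<Sum>\<^sub>\<infinity>j\<in>UNIV. u (x + lattice_point h j) * tkernel lam a (lattice_point h j)) =
     (\<Sum>\<^sub>\<infinity>j\<in>UNIV. (u x - (u (x + lattice_point h j) + u (x - lattice_point h j)) / 2) * tkernel lam a (lattice_point h j))"
    unfolding T_def[symmetric] U_def[symmetric] by (auto simp: summable_on_def infsumI)
qed

lemma C_4_compact_derivatives:
  fixes u :: "real ^ 'n \<Rightarrow> real"
  assumes "C_k_on (Suc (Suc (Suc (Suc s)))) UNIV u" "compactly_supported u"
  obtains u1 u2 u3 u4 M2 M4 where
    "\<And>x. (u has_derivative (\<lambda>v. \<Sum>l\<in>UNIV. v $ l * u1 l x)) (at x)"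
    "\<And>l x. (u1 l has_derivative (\<lambda>v. \<Sum>k\<in>UNIV. v $ k * u2 l k x)) (at x)"
    "\<And>l k x. (u2 l k has_derivative (\<lambda>v. \<Sum>i\<in>UNIV. v $ i * u3 l k i x)) (at x)"
    "\<And>l k i x. (u3 l k i has_derivative (\<lambda>v. \<Sum>j\<in>UNIV. v $ j * u4 l k i j x)) (at x)"
    "\<And>l k x. \<bar>u2 l k x\<bar> \<le> M2 l k" "\<And>l k i j x. \<bar>u4 l k i j x\<bar> \<le> M4 l k i j"
proof -
  obtain u1 where u1: "\<And>x. (u has_derivative (\<lambda>v. \<Sum>l\<in>UNIV. v $ l * u1 l x)) (at x)"
    "\<And>l. C_k_on (Suc (Suc (Suc s))) UNIV (u1 l)" "\<And>l. compactly_supported (u1 l)"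
    by (rule C_k_compact_SucE[OF assms]) blast
  obtain u2 where u2: "\<And>l x. (u1 l has_derivative (\<lambda>v. \<Sum>k\<in>UNIV. v $ k * u2 l k x)) (at x)"
    "\<And>l k. C_k_on (Suc (Suc s)) UNIV (u2 l k)" "\<And>l k. compactly_supported (u2 l k)"
    by (rule C_k_compact_SucE_family[of _ u1, OF u1(2,3)]) blast
  obtain u3 where u3: "\<And>p x. ((\<lambda>(l, k). u2 l k) p has_derivative (\<lambda>v. \<Sum>i\<in>UNIV. v $ i * u3 p i x)) (at x)"
    "\<And>p i. C_k_on (Suc s) UNIV (u3 p i)" "\<And>p i. compactly_supported (u3 p i)"
    by (rule C_k_compact_SucE_family[of "Suc s" "\<lambda>(l, k). u2 l k"])
       (simp only: case_prod_beta u2, simp only: case_prod_beta u2, blast)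
  obtain u4 where u4: "\<And>p x. ((\<lambda>(l, k). u3 l k) p has_derivative (\<lambda>v. \<Sum>i\<in>UNIV. v $ i * u4 p i x)) (at x)"
    "\<And>p i. C_k_on s UNIV (u4 p i)" "\<And>p i. compactly_supported (u4 p i)"
    by (rule C_k_compact_SucE_family[of s "\<lambda>(l, k). u3 l k"])
       (simp only: case_prod_beta u3, simp only: case_prod_beta u3, blast)
  have "\<forall>p. \<exists>M. \<forall>x. \<bar>u2 (fst p) (snd p) x\<bar> \<le> M"
    by (intro allI, rule C_k_compact_bounded[OF u2(2,3)]) blast
  from choice[OF this] obtain M2 where M2: "\<And>p x. \<bar>u2 (fst p) (snd p) x\<bar> \<le> M2 p" by blast
  have "\<forall>p. \<exists>M. \<forall>x. \<bar>u4 (fst p) (snd p) x\<bar> \<le> M"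
    by (intro allI, rule C_k_compact_bounded[OF u4(2,3)]) blast
  from choice[OF this] obtain M4 where M4: "\<And>p x. \<bar>u4 (fst p) (snd p) x\<bar> \<le> M4 p" by blast
  show ?thesis
  proof (rule that[of u1 u2 "\<lambda>l k. u3 (l, k)" "\<lambda>l k i. u4 ((l, k), i)" "\<lambda>l k. M2 (l, k)" "\<lambda>l k i j. M4 (((l, k), i), j)"])
    show "(u2 l k has_derivative (\<lambda>v. \<Sum>i\<in>UNIV. v $ i * u3 (l, k) i x)) (at x)" for l k x
      using u3(1)[of "(l, k)"] by simp
    show "(u3 (l, k) i has_derivative (\<lambda>v. \<Sum>j\<in>UNIV. v $ j * u4 ((l, k), i) j x)) (at x)" for l k i x
      using u4(1)[of "((l, k), i)"] by simp
    show "\<bar>u2 l k x\<bar> \<le> M2 (l, k)" for l k x using M2[of "(l, k)"] by simp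
    show "\<bar>u4 ((l, k), i) j x\<bar> \<le> M4 (((l, k), i), j)" for l k i j x using M4[of "(((l, k), i), j)"] by simp
  qed (rule u1 u2)+
qed

text \<open>The second difference along an axis is -2 times the symmetrised difference at
  \<open>h\<close> times the unit vector, so the fourth-order bound applies with a factor 2; there
  are d axes, and division by the squared mesh leaves second order.\<close>

lemma discrete_laplacian_error:
  fixes u :: "real ^ 'n \<Rightarrow> real" and H :: "'n \<Rightarrow> 'n \<Rightarrow> real"
  assumes M: "\<And>y. \<bar>u x - (u (x + y) + u (x - y)) / 2 + (\<Sum>l\<in>UNIV. \<Sum>k\<in>UNIV. y $ l * y $ k * H l k) / 2\<bar> \<le> M * norm y ^ 4"
    and h: "h > 0"
  shows "\<bar>discrete_laplacian h u x - (\<Sum>l\<in>UNIV. H l l)\<bar> \<le> 2 * real CARD('n) * M * h\<^sup>2"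
proof -
  have b: "\<bar>u (x - h *\<^sub>R axis l 1) - 2 * u x + u (x + h *\<^sub>R axis l 1) - h\<^sup>2 * H l l\<bar> \<le> 2 * M * h ^ 4" for l
  proof -
    have "(\<Sum>i\<in>UNIV. \<Sum>k\<in>UNIV. (h *\<^sub>R axis l 1 :: real ^ 'n) $ i * (h *\<^sub>R axis l 1 :: real ^ 'n) $ k * H i k) = h\<^sup>2 * H l l"
    proof -
      have "(\<Sum>i\<in>UNIV. \<Sum>k\<in>UNIV. (h *\<^sub>R axis l 1 :: real ^ 'n) $ i * (h *\<^sub>R axis l 1 :: real ^ 'n) $ k * H i k) =
        h\<^sup>2 * (\<Sum>i\<in>UNIV. axis l 1 $ i * (\<Sum>k\<in>UNIV. axis l 1 $ k * H i k))"
        by (simp add: sum_distrib_left power2_eq_square mult_ac)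
      then show ?thesis by (simp add: sum_axis)
    qed
    then have "\<bar>u x - (u (x + h *\<^sub>R axis l 1) + u (x - h *\<^sub>R axis l 1)) / 2 + h\<^sup>2 * H l l / 2\<bar> \<le> M * h ^ 4"
      using M[of "h *\<^sub>R axis l 1"] h by (simp add: abs_of_pos)
    then show ?thesis by (simp add: abs_le_iff field_simps)
  qed
  have "discrete_laplacian h u x - (\<Sum>l\<in>UNIV. H l l) =
     (\<Sum>l\<in>UNIV. u (x - h *\<^sub>R axis l 1) - 2 * u x + u (x + h *\<^sub>R axis l 1) - h\<^sup>2 * H l l) / h\<^sup>2"
    using h by (simp add: discrete_laplacian_def sum_subtractf diff_divide_distrib sum_distrib_left[symmetric])
  also have "\<bar>\<dots>\<bar> \<le> (\<Sum>l\<in>(UNIV :: 'n set). 2 * M * h ^ 4) / h\<^sup>2"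
    unfolding abs_divide abs_power2
    by (intro divide_right_mono order_trans[OF sum_abs] sum_mono b) simp
  also have "\<dots> = 2 * real CARD('n) * M * h\<^sup>2"
    using h by (simp add: power2_eq_square eval_nat_numeral field_simps)
  finally show ?thesis .
qed

lemma finite_grid: "finite (grid N :: (real ^ 'n) set)"
proof -
  have "{j :: int ^ 'n. \<forall>l. 1 \<le> j $ l \<and> j $ l \<le> int N - 1} \<subseteq> vec_lambda ` (PiE UNIV (\<lambda>_. {1..int N - 1}))"
  proof
    fix j :: "int ^ 'n" assume "j \<in> {j. \<forall>l. 1 \<le> j $ l \<and> j $ l \<le> int N - 1}"
    then have "vec_nth j \<in> PiE UNIV (\<lambda>_. {1..int N - 1})" by auto
    then show "j \<in> vec_lambda ` (PiE UNIV (\<lambda>_. {1..int N - 1}))"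
      by (intro image_eqI[of _ _ "vec_nth j"]) (auto simp: vec_nth_inverse)
  qed
  then have "finite {j :: int ^ 'n. \<forall>l. 1 \<le> j $ l \<and> j $ l \<le> int N - 1}"
    by (rule finite_subset) (intro finite_imageI finite_PiE, auto)
  then show ?thesis unfolding grid_def by (rule finite_image_set)
qed

lemma grid_nonempty:
  assumes "N \<ge> 2"
  shows "(grid N :: (real ^ 'n) set) \<noteq> {}"
proof -
  have "(\<chi> l. - 1 + of_int (((\<chi> l. 1) :: int ^ 'n) $ l) * mesh_size N) \<in> (grid N :: (real ^ 'n) set)"
    unfolding grid_def using assms by (intro CollectI exI[of _ "(\<chi> l. 1) :: int ^ 'n"]) auto
  then show ?thesis by blast
qed

section \<open>Consistency of the scheme\<close>

text \<open>The estimate is uniform over the whole space and over all positive meshes, because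
  \<open>x\<close> and \<open>h\<close> are parameters of the quadrature bound.\<close>

lemma wirfd_consistency:
  fixes u :: "real ^ 'n \<Rightarrow> real" and w :: "real \<Rightarrow> real" and \<alpha> lam L :: real
  assumes \<alpha>: "0 < \<alpha>" "\<alpha> < 2" and lam: "0 \<le> lam"
    and u: "C_k_on (Suc (Suc (Suc (Suc s)))) UNIV u" "compactly_supported u"
    and L: "0 < L" and w: "C_k_on 4 {0..} w"
    and w01: "\<And>\<rho>. 0 \<le> \<rho> \<Longrightarrow> 0 \<le> w \<rho> \<and> w \<rho> \<le> 1"
    and wL: "\<And>\<rho>. L \<le> \<rho> \<Longrightarrow> w \<rho> = 0"
    and wO: "(\<lambda>\<rho>. w \<rho> - 1) \<in> O[at_right 0](\<lambda>\<rho>. \<rho> ^ \<gamma>)" and \<gamma>: "2 \<le> \<gamma>"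
  obtains C where "\<And>x h. 0 < h \<Longrightarrow>
    \<bar>tempered_frac_laplacian \<alpha> lam u x - wirfd w L \<alpha> lam h u x\<bar> \<le> C * h powr (4 - \<alpha>)"
proof -
  let ?d = "real CARD('n)"
  define a where "a = ?d + \<alpha>"
  have a: "?d < a" "a < ?d + 2" using \<alpha> by (auto simp: a_def)
  let ?K = "tkernel lam a :: real ^ 'n \<Rightarrow> real"
  obtain u1 u2 u3 u4 M2 M4 where
    D: "\<And>x. (u has_derivative (\<lambda>v. \<Sum>l\<in>UNIV. v $ l * u1 l x)) (at x)"
    "\<And>l x. (u1 l has_derivative (\<lambda>v. \<Sum>k\<in>UNIV. v $ k * u2 l k x)) (at x)"
    "\<And>l k x. (u2 l k has_derivative (\<lambda>v. \<Sum>i\<in>UNIV. v $ i * u3 l k i x)) (at x)"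
    "\<And>l k i x. (u3 l k i has_derivative (\<lambda>v. \<Sum>j\<in>UNIV. v $ j * u4 l k i j x)) (at x)"
    and M2: "\<And>l k x. \<bar>u2 l k x\<bar> \<le> M2 l k" and M4: "\<And>l k i j x. \<bar>u4 l k i j x\<bar> \<le> M4 l k i j"
    by (rule C_4_compact_derivatives[OF u]) blast
  obtain B where B: "B \<ge> 0" "\<And>y. \<bar>u y\<bar> \<le> B" by (rule C_k_compact_bounded[OF u]) blast
  have um [measurable]: "u \<in> borel_measurable borel"
    by (rule borel_measurable_continuous_onI[OF C_k_on_imp_continuous[OF u(1)]])
  have "continuous_on UNIV (\<lambda>y :: real ^ 'n. w (norm y))"
    by (rule continuous_on_compose2[OF C_k_on_imp_continuous[OF w]]) (auto intro: continuous_on_norm_id)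
  then have wm [measurable]: "(\<lambda>y :: real ^ 'n. w (norm y)) \<in> borel_measurable borel"
    by (rule borel_measurable_continuous_onI)
  define A where "A x y = u x - (u (x + y) + u (x - y)) / 2" for x y
  define q where "q x y = (\<Sum>l\<in>UNIV. \<Sum>k\<in>UNIV. y $ l * y $ k * u2 l k x) / 2" for x and y :: "real ^ 'n"
  define lapl where "lapl x = (\<Sum>l\<in>UNIV. u2 l l x)" for x
  define W :: "real ^ 'n \<Rightarrow> real" where "W y = w (norm y) * tkernel lam (a - 2) y" for y
  have qm [measurable]: "q x \<in> borel_measurable borel" for x unfolding q_def by measurable
  have Am [measurable]: "A x \<in> borel_measurable borel" for x unfolding A_def by measurable
  have Wm [measurable]: "W \<in> borel_measurable borel" unfolding W_def by measurable

  have Fvan: "vanish 4 UNIV (\<lambda>x y. A x y + q x y)"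
    unfolding A_def q_def by (rule vanish_symmetric_difference[OF D M4])
  then obtain MF where MF: "MF \<ge> 0" "\<And>x y. \<bar>A x y + q x y\<bar> \<le> MF * norm y ^ 4"
    using vanish_bound by blast
  have Fsym: "symbol 4 UNIV 4 (\<lambda>x y. A x y + q x y)" using vanish_imp_symbol[OF Fvan] by simp
  have qsym: "symbol 4 UNIV 2 q"
  proof -
    have "symbol 4 UNIV ((1 + 1) + 0) (\<lambda>x y. y $ l * y $ k * (u2 l k x / 2))" for l k
      by (intro symbol_mult symbol_coord symbol_const[where M = "M2 l k / 2"]) (use M2[of l k] in simp)
    then have "symbol 4 UNIV 2 (\<lambda>x y. \<Sum>l\<in>UNIV. \<Sum>k\<in>UNIV. y $ l * y $ k * (u2 l k x / 2))"
      by (intro symbol_sum finite) simp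
    then show ?thesis by (simp add: q_def[abs_def] sum_divide_distrib)
  qed
  obtain Mq where Mq: "Mq \<ge> 0" "\<And>x y. y \<noteq> 0 \<Longrightarrow> \<bar>q x y\<bar> \<le> Mq * norm y powr 2"
    by (rule symbol_boundE[OF qsym]) blast
  have w_w1: "radial_symbol 4 2 (\<lambda>r. w r - 1)"
  proof -
    have four: "(4 :: nat) = Suc (Suc (Suc (Suc 0)))" by simp
    show ?thesis unfolding four by (rule radial_symbol_window[OF w[unfolded four] L wL[OF less_imp_le] wO \<gamma>])
  qed
  have w_w0: "radial_symbol 4 0 w" by (rule radial_symbol_C_k_compact[OF w _ L]) (use wL in auto)

  define G where "G x y = A x y * ?K y + w (norm y) * q x y * ?K y" for x y
  have Gm [measurable]: "G x \<in> borel_measurable borel" for x unfolding G_def[abs_def] by measurable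
  have Gsym: "symbol 4 UNIV (4 - a) G"
  proof -
    have "symbol 4 UNIV (4 + - a) (\<lambda>x y. (A x y + q x y) * ?K y)"
      by (rule symbol_mult[OF Fsym symbol_tkernel[OF lam]])
    \<comment> \<open>Two orders come from the flatness of the window and two from the quadratic
      form, which matches the order of \<open>A + q\<close>.\<close>
    moreover have "symbol 4 UNIV ((2 + 2) + - a) (\<lambda>x y. (w (norm y) - 1) * q x y * ?K y)"
      by (rule symbol_mult[OF symbol_mult[OF symbol_radial[OF w_w1] qsym] symbol_tkernel[OF lam]])
    ultimately have "symbol 4 UNIV (4 - a) (\<lambda>x y. (A x y + q x y) * ?K y + (w (norm y) - 1) * q x y * ?K y)"
      by (intro symbol_add) simp_all
    then show ?thesis by (rule symbol_cong) (simp add: G_def algebra_simps)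
  qed
  \<comment> \<open>The symbol order 4 - a is too weak at infinity. There \<open>A\<close> is
    bounded and \<open>w q\<close> has bounded support, so the decay is that of the kernel.\<close>
  have Gdecay: "\<bar>G x y\<bar> \<le> (2 * B + Mq * L powr 2) * norm y powr (- a)" for x y
  proof (cases "y = 0")
    case False
    have "\<bar>A x y\<bar> \<le> 2 * B" unfolding A_def using B(2)[of x] B(2)[of "x + y"] B(2)[of "x - y"] by (simp add: abs_le_iff field_simps)
    moreover have "\<bar>w (norm y) * q x y\<bar> \<le> Mq * L powr 2"
    proof (cases "norm y \<le> L")
      case True
      have "\<bar>w (norm y) * q x y\<bar> \<le> 1 * (Mq * norm y powr 2)"
        unfolding abs_mult using w01[of "norm y"] Mq False by (intro mult_mono) auto
      also have "\<dots> \<le> Mq * L powr 2"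
        unfolding mult_1 by (intro mult_left_mono powr_mono2) (use True Mq(1) in auto)
      finally show ?thesis .
    qed (use Mq wL in auto)
    ultimately have "\<bar>A x y + w (norm y) * q x y\<bar> \<le> 2 * B + Mq * L powr 2" by linarith
    then have "\<bar>(A x y + w (norm y) * q x y) * ?K y\<bar> \<le> (2 * B + Mq * L powr 2) * norm y powr (- a)"
      unfolding abs_mult using tkernel_le[OF lam, of a y] B Mq by (intro mult_mono) auto
    then show ?thesis by (simp add: G_def algebra_simps)
  qed (simp add: G_def)
  have Wdecay: "\<bar>W y\<bar> \<le> L powr 2 * norm y powr (- a)" for y
  proof (cases "y = 0 \<or> norm y > L")
    case False
    have "\<bar>W y\<bar> \<le> 1 * (norm y powr 2 * norm y powr (- a))"
      using False w01[of "norm y"] tkernel_le[OF lam, of a y] unfolding W_def abs_mult tkernel_minus_2[of y]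
      by (intro mult_mono) (auto simp: tkernel_minus_2 intro!: mult_left_mono)
    also have "\<dots> \<le> L powr 2 * norm y powr (- a)"
      unfolding mult_1 by (intro mult_right_mono powr_mono2) (use False in auto)
    finally show ?thesis .
  qed (use wL in \<open>auto simp: W_def\<close>)
  \<comment> \<open>Nothing depends on \<open>x\<close> here, so the parameter set is a single
    point.\<close>
  have Wsym: "symbol 4 (UNIV :: unit set) (2 - a) (\<lambda>_. W)"
    using symbol_mult[OF symbol_radial[OF w_w0] symbol_tkernel[OF lam, where a = "a - 2"]]
    by (simp add: W_def[abs_def])

  obtain C1 where C1: "\<And>x h. h > 0 \<Longrightarrow>
    \<bar>(LINT y|lborel. G x y) - h ^ CARD('n) * (\<Sum>\<^sub>\<infinity>j\<in>UNIV. G x (lattice_point h j))\<bar> \<le> C1 * h powr (4 - a + ?d)"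
  proof (rule lattice_quadrature[OF Gsym Gm, where s = "- a"])
    show "\<exists>M. \<forall>y. y \<noteq> 0 \<longrightarrow> \<bar>G x y\<bar> \<le> M * norm y powr - a" for x using Gdecay by blast
    show "G x 0 = 0" for x by (simp add: G_def)
  qed (use a \<alpha> in \<open>auto simp: a_def\<close>)
  obtain C2 where C2: "\<And>h. h > 0 \<Longrightarrow>
    \<bar>(LINT y|lborel. W y) - h ^ CARD('n) * (\<Sum>\<^sub>\<infinity>j\<in>UNIV. W (lattice_point h j))\<bar> \<le> C2 * h powr (2 - a + ?d)"
  proof (rule lattice_quadrature[OF Wsym Wm, where s = "- a"])
    show "\<exists>M. \<forall>y. y \<noteq> 0 \<longrightarrow> \<bar>W y\<bar> \<le> M * norm y powr - a" using Wdecay by blast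
    show "W 0 = 0" by (simp add: W_def)
  qed (use a \<alpha> in \<open>auto simp: a_def\<close>)
  have C20: "C2 \<ge> 0" using C2[of 1] by simp

  \<comment> \<open>The radial profile of the windowed kernel, in the form which the isotropy lemmas
    take; times the squared norm it is \<open>W\<close>, including the value \<open>0\<close> at the
    origin.\<close>
  define \<phi> where "\<phi> r = w r / (exp (lam * r) * r powr a)" for r
  have \<phi>W: "\<phi> (norm y) * norm y ^ 2 = W y" for y
    by (cases "y = 0") (simp_all add: \<phi>_def W_def tkernel_minus_2 tkernel_def[of lam a])
  have \<phi>q: "w (norm y) * q x y * ?K y = \<phi> (norm y) * (\<Sum>l\<in>UNIV. \<Sum>k\<in>UNIV. y $ l * y $ k * (u2 l k x / 2))" for x y
    by (simp add: \<phi>_def q_def tkernel_def sum_divide_distrib)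
  have Wint: "integrable lborel W"
  proof -
    obtain M where M: "\<And>y. y \<noteq> 0 \<Longrightarrow> \<bar>W y\<bar> \<le> M * norm y powr (2 - a)" by (rule symbol_boundE[OF Wsym]) blast
    show ?thesis
    proof (rule integrable_powr_bounds[OF Wm, where m = "2 - a" and s = "- a" and M = "max M (L powr 2)"])
      fix y :: "real ^ 'n" assume y: "y \<noteq> 0"
      show "\<bar>W y\<bar> \<le> max M (L powr 2) * norm y powr (2 - a)"
        using M[OF y] mult_right_mono[of M "max M (L powr 2)" "norm y powr (2 - a)"] by simp
      show "\<bar>W y\<bar> \<le> max M (L powr 2) * norm y powr (- a)"
        using Wdecay[of y] mult_right_mono[of "L powr 2" "max M (L powr 2)" "norm y powr (- a)"] by simp
    qed (use a in auto)
  qed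
  have Gint: "integrable lborel (G x)" for x
  proof -
    obtain M where M: "\<And>y. y \<noteq> 0 \<Longrightarrow> \<bar>G x y\<bar> \<le> M * norm y powr (4 - a)" by (rule symbol_boundE[OF Gsym]) blast
    let ?M = "max M (2 * B + Mq * L powr 2)"
    show ?thesis
    proof (rule integrable_powr_bounds[OF Gm, where m = "4 - a" and s = "- a" and M = ?M])
      fix y :: "real ^ 'n" assume y: "y \<noteq> 0"
      show "\<bar>G x y\<bar> \<le> ?M * norm y powr (4 - a)"
        using M[OF y] mult_right_mono[of M ?M "norm y powr (4 - a)"] by simp
      show "\<bar>G x y\<bar> \<le> ?M * norm y powr (- a)"
        using Gdecay[of x y] mult_right_mono[of "2 * B + Mq * L powr 2" ?M "norm y powr (- a)"] by simp
    qed (use a in auto)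
  qed
  \<comment> \<open>The half in \<open>q\<close> is moved into the coefficients; it is the source of
    the 2 in the factor 1/(2d) of the scheme.\<close>
  have lapl2: "(\<Sum>l\<in>UNIV. u2 l l x / 2) = lapl x / 2" for x by (simp add: lapl_def sum_divide_distrib)
  have \<phi>m: "(\<lambda>y :: real ^ 'n. \<phi> (norm y)) \<in> borel_measurable borel" unfolding \<phi>_def by measurable
  have qK_int: "integrable lborel (\<lambda>y. w (norm y) * q x y * ?K y)"
    "(LINT y|lborel. w (norm y) * q x y * ?K y) = lapl x / (2 * ?d) * (LINT y|lborel. W y)" for x
    using integral_radial_quadratic[OF \<phi>m, of "\<lambda>l k. u2 l k x / 2"] Wint
    unfolding \<phi>W \<phi>q lapl2 by simp_all
  \<comment> \<open>Neither symbol bound is stated for \<open>A\<close> alone; its integrability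
    follows by subtracting the windowed quadratic part from \<open>G\<close>.\<close>
  have AK_int: "integrable lborel (\<lambda>y. A x y * ?K y)" for x
    using Bochner_Integration.integrable_diff[OF Gint[of x] qK_int(1)[of x]] by (simp add: G_def)
  have IG: "(LINT y|lborel. G x y) = (LINT y|lborel. A x y * ?K y) + lapl x / (2 * ?d) * (LINT y|lborel. W y)" for x
    unfolding G_def Bochner_Integration.integral_add[OF AK_int qK_int(1)] qK_int(2) ..

  define c where "c = frac_const CARD('n) \<alpha> lam"
  have T: "tempered_frac_laplacian \<alpha> lam u x = c * (LINT y|lborel. A x y * ?K y)" for x
    unfolding tempered_frac_laplacian_def c_def a_def[symmetric]
    using pv_integral_symmetric[OF um B(2) lam a(1), of x] AK_int[of x] unfolding A_def by simp

  show ?thesis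
  proof (rule that[of "\<bar>c\<bar> * (C1 + MF * C2)"])
    fix x :: "real ^ 'n" and h :: real assume h: "0 < h"
    let ?Y = "lattice_point h :: int ^ 'n \<Rightarrow> real ^ 'n"
    define \<Delta> where "\<Delta> = discrete_laplacian h u x"
    define IW where "IW = (LINT y|lborel. W y)"
    define SW where "SW = (\<Sum>\<^sub>\<infinity>j\<in>UNIV. W (?Y j))"
    define IA where "IA = (LINT y|lborel. A x y * ?K y)"
    define SA where "SA = (\<Sum>\<^sub>\<infinity>j\<in>UNIV. A x (?Y j) * ?K (?Y j))"
    have S1h: "wirfd_S1h TYPE('n) w \<alpha> lam h = 1 / (2 * ?d) * SW"
    proof -
      have "(\<Sum>\<^sub>\<infinity>j\<in>UNIV - {0}. w (norm (?Y j)) / (exp (lam * norm (?Y j)) * norm (?Y j) powr (?d + \<alpha> - 2)))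
          = (\<Sum>\<^sub>\<infinity>j\<in>UNIV - {0}. W (?Y j))" by (simp add: W_def tkernel_def a_def)
      also have "\<dots> = SW" unfolding SW_def by (rule infsum_remove_0) (simp add: W_def)
      finally show ?thesis by (simp add: wirfd_S1h_def)
    qed
    \<comment> \<open>Outside the cube of half-width \<open>L\<close> the norm is at least
      \<open>L\<close> and the window vanishes, so the integral is already the one over the whole
      space.\<close>
    have S1: "h ^ CARD('n) * wirfd_S1 TYPE('n) w L \<alpha> lam h = 1 / (2 * ?d) * IW"
    proof -
      have "indicator (cbox (\<chi> l. - L) (\<chi> l. L)) y *\<^sub>R (w (norm y) / (exp (lam * norm y) * norm y powr (?d + \<alpha> - 2))) = W y"
        for y :: "real ^ 'n"
      proof (cases "y \<in> cbox (\<chi> l. - L) (\<chi> l. L)")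
        case True
        then show ?thesis by (simp add: W_def tkernel_def a_def)
      next
        case False
        then obtain l where "\<not> (- L \<le> y $ l \<and> y $ l \<le> L)" by (auto simp: mem_box_cart)
        then have "L \<le> norm y" using component_le_norm_cart[of y l] by linarith
        then show ?thesis using wL False by (simp add: W_def)
      qed
      then show ?thesis using h by (simp add: wirfd_S1_def set_lebesgue_integral_def IW_def)
    qed
    have S2: "wirfd_S2 TYPE('n) \<alpha> lam h = (\<Sum>\<^sub>\<infinity>j\<in>UNIV. ?K (?Y j))"
    proof -
      have "wirfd_S2 TYPE('n) \<alpha> lam h = (\<Sum>\<^sub>\<infinity>j\<in>UNIV - {0}. ?K (?Y j))"
        by (simp add: wirfd_S2_def tkernel_def a_def)
      also have "\<dots> = (\<Sum>\<^sub>\<infinity>j\<in>UNIV. ?K (?Y j))" by (rule infsum_remove_0) simp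
      finally show ?thesis .
    qed
    have S3: "(\<Sum>\<^sub>\<infinity>j\<in>UNIV - {0}. u (x + ?Y j) / (exp (lam * norm (?Y j)) * norm (?Y j) powr (?d + \<alpha>)))
        = (\<Sum>\<^sub>\<infinity>j\<in>UNIV. u (x + ?Y j) * ?K (?Y j))"
    proof -
      have "(\<Sum>\<^sub>\<infinity>j\<in>UNIV - {0}. u (x + ?Y j) / (exp (lam * norm (?Y j)) * norm (?Y j) powr (?d + \<alpha>)))
        = (\<Sum>\<^sub>\<infinity>j\<in>UNIV - {0}. u (x + ?Y j) * ?K (?Y j))"
        by (simp add: tkernel_def a_def)
      also have "\<dots> = (\<Sum>\<^sub>\<infinity>j\<in>UNIV. u (x + ?Y j) * ?K (?Y j))" by (rule infsum_remove_0) simp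
      finally show ?thesis .
    qed
    have Wr: "wirfd w L \<alpha> lam h u x = c * (h ^ CARD('n) * SA + 1 / (2 * ?d) * (h ^ CARD('n) * SW - IW) * \<Delta>)"
    proof -
      have "wirfd w L \<alpha> lam h u x = c * (h ^ CARD('n) * (1 / (2 * ?d) * SW) * \<Delta>
          - (h ^ CARD('n) * wirfd_S1 TYPE('n) w L \<alpha> lam h) * \<Delta>
          + h ^ CARD('n) * ((\<Sum>\<^sub>\<infinity>j\<in>UNIV. ?K (?Y j)) * u x - (\<Sum>\<^sub>\<infinity>j\<in>UNIV. u (x + ?Y j) * ?K (?Y j))))"
        unfolding wirfd_def S1h S2 S3 c_def[symmetric] \<Delta>_def[symmetric] by (simp add: algebra_simps)
      also have "(\<Sum>\<^sub>\<infinity>j\<in>UNIV. ?K (?Y j)) * u x - (\<Sum>\<^sub>\<infinity>j\<in>UNIV. u (x + ?Y j) * ?K (?Y j)) = SA"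
        unfolding SA_def A_def by (rule lattice_symmetrized_sum(2)[OF B(2) lam a(1) h])
      finally show ?thesis unfolding S1 by (simp add: algebra_simps diff_divide_distrib)
    qed
    have Wsumm: "(\<lambda>j. W (?Y j)) summable_on UNIV"
      by (rule summable_lattice_bound[OF h _ Wdecay]) (use a in simp)
    have SG: "(\<Sum>\<^sub>\<infinity>j\<in>UNIV. G x (?Y j)) = SA + lapl x / (2 * ?d) * SW"
    proof -
      have s1: "(\<lambda>j. A x (?Y j) * ?K (?Y j)) summable_on UNIV"
        unfolding A_def by (rule lattice_symmetrized_sum(1)[OF B(2) lam a(1) h])
      have s2: "(\<lambda>j. w (norm (?Y j)) * q x (?Y j) * ?K (?Y j)) summable_on UNIV"
        "(\<Sum>\<^sub>\<infinity>j\<in>UNIV. w (norm (?Y j)) * q x (?Y j) * ?K (?Y j)) = lapl x / (2 * ?d) * SW"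
        using lattice_radial_quadratic[of \<phi> h "\<lambda>l k. u2 l k x / 2"] Wsumm
        unfolding \<phi>W \<phi>q lapl2 SW_def by simp_all
      show ?thesis unfolding G_def infsum_add[OF s1 s2(1)] s2(2) SA_def ..
    qed
    define eG where "eG = (LINT y|lborel. G x y) - h ^ CARD('n) * (\<Sum>\<^sub>\<infinity>j\<in>UNIV. G x (?Y j))"
    define eW where "eW = IW - h ^ CARD('n) * SW"
    \<comment> \<open>\<open>eG\<close> contains \<open>eW\<close> with the exact Laplacian as
      coefficient, while the scheme carries it with the discrete one; only their difference
      multiplies \<open>eW\<close>, and its second order makes up for the two orders that
      \<open>eW\<close> lacks.\<close>
    have key: "tempered_frac_laplacian \<alpha> lam u x - wirfd w L \<alpha> lam h u x = c * (eG + (\<Delta> - lapl x) / (2 * ?d) * eW)"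
      unfolding T Wr eG_def eW_def IG SG IA_def[symmetric] IW_def[symmetric] by (simp add: field_simps)
    have ex: "4 - a + ?d = 4 - \<alpha>" "2 - a + ?d = 2 - \<alpha>" by (simp_all add: a_def)
    have b1: "\<bar>eG\<bar> \<le> C1 * h powr (4 - \<alpha>)" using C1[OF h, of x] unfolding eG_def ex .
    have b2: "\<bar>eW\<bar> \<le> C2 * h powr (2 - \<alpha>)" using C2[OF h] unfolding eW_def IW_def SW_def ex .
    have b3: "\<bar>\<Delta> - lapl x\<bar> \<le> 2 * ?d * MF * h\<^sup>2"
      unfolding \<Delta>_def lapl_def
      by (rule discrete_laplacian_error[OF _ h]) (use MF(2)[of x] in \<open>simp add: A_def q_def\<close>)
    have "\<bar>(\<Delta> - lapl x) / (2 * ?d) * eW\<bar> \<le> (MF * h\<^sup>2) * (C2 * h powr (2 - \<alpha>))"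
      unfolding abs_mult
    proof (rule mult_mono[OF _ b2])
      show "\<bar>(\<Delta> - lapl x) / (2 * ?d)\<bar> \<le> MF * h\<^sup>2"
        using b3 by (simp add: abs_divide field_simps)
    qed (use MF in auto)
    also have "\<dots> = MF * C2 * h powr (4 - \<alpha>)"
    proof -
      have "h\<^sup>2 * h powr (2 - \<alpha>) = h powr (4 - \<alpha>)"
        using powr_add[of h 2 "2 - \<alpha>"] h by simp
      moreover have "(MF * h\<^sup>2) * (C2 * h powr (2 - \<alpha>)) = MF * C2 * (h\<^sup>2 * h powr (2 - \<alpha>))"
        by (simp only: mult_ac)
      ultimately show ?thesis by (simp only:)
    qed
    finally have "\<bar>eG + (\<Delta> - lapl x) / (2 * ?d) * eW\<bar> \<le> (C1 + MF * C2) * h powr (4 - \<alpha>)"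
      using b1 unfolding distrib_right by linarith
    then show "\<bar>tempered_frac_laplacian \<alpha> lam u x - wirfd w L \<alpha> lam h u x\<bar> \<le> \<bar>c\<bar> * (C1 + MF * C2) * h powr (4 - \<alpha>)"
      unfolding key abs_mult mult.assoc by (rule mult_left_mono) simp
  qed
qed

lemma C_k_on_Suc_imp: "C_k_on (Suc k) S f \<Longrightarrow> C_k_on k S f"
proof (induction k arbitrary: f)
  case 0
  then show ?case using C_k_on_imp_continuous[OF 0] by simp
next
  case (Suc k)
  then show ?case by (metis C_k_on.simps(2))
qed

lemma C_k_on_mono: "j \<le> k \<Longrightarrow> C_k_on k S f \<Longrightarrow> C_k_on j S f"
  by (induction k rule: dec_induct) (auto intro: C_k_on_Suc_imp simp del: C_k_on.simps)

theorem theorem3p2: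
  fixes u :: "real ^ 'n \<Rightarrow> real"
    and w :: "real \<Rightarrow> real"
    and \<alpha> lam L :: real
    and s \<gamma> :: nat
  assumes "CARD('n) \<in> {1, 2, 3}"
    and "0 < \<alpha>" "\<alpha> < 2"
    and "0 \<le> lam"
    and "8 \<le> s" "C_k_on s UNIV u" "compactly_supported u"
    and "0 < L"
    and "4 \<le> \<gamma>" "C_k_on \<gamma> {0..} w"
    and "\<And>\<rho>. 0 \<le> \<rho> \<Longrightarrow> 0 \<le> w \<rho> \<and> w \<rho> \<le> 1"
    and "\<And>\<rho>. L \<le> \<rho> \<Longrightarrow> w \<rho> = 0"
    and "(\<lambda>\<rho>. w \<rho> - 1) \<in> O[at_right 0](\<lambda>\<rho>. \<rho> ^ \<gamma>)"
  shows "\<exists>C>0. \<exists>h0>0. \<forall>N>0. mesh_size N < h0 \<longrightarrow>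
           linf_norm (grid N)
             (\<lambda>x. tempered_frac_laplacian \<alpha> lam u x - wirfd w L \<alpha> lam (mesh_size N) u x)
           \<le> C * mesh_size N powr (4 - \<alpha>)"
proof -
  have u4: "C_k_on (Suc (Suc (Suc (Suc 0)))) UNIV u"
    by (rule C_k_on_mono[OF _ assms(6)]) (use assms(5) in simp)
  have w4: "C_k_on 4 {0..} w" by (rule C_k_on_mono[OF assms(9,10)])
  have \<gamma>: "2 \<le> \<gamma>" using assms(9) by simp
  obtain C where C: "\<And>x h. 0 < h \<Longrightarrow>
    \<bar>tempered_frac_laplacian \<alpha> lam u x - wirfd w L \<alpha> lam h u x\<bar> \<le> C * h powr (4 - \<alpha>)"
    by (rule wirfd_consistency[OF assms(2,3,4) u4 assms(7,8) w4 assms(11,12,13) \<gamma>]) blast+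
  \<comment> \<open>The threshold 2 is the mesh for \<open>N = 1\<close>, whose grid is empty and
    whose maximum would carry no information. Passing to \<open>\<bar>C\<bar> + 1\<close> makes the
    constant positive.\<close>
  have bound: "linf_norm (grid N)
             (\<lambda>x. tempered_frac_laplacian \<alpha> lam u x - wirfd w L \<alpha> lam (mesh_size N) u x)
           \<le> (\<bar>C\<bar> + 1) * mesh_size N powr (4 - \<alpha>)" if N: "0 < N" "mesh_size N < 2" for N
  proof -
    have "N \<ge> 2" using N by (cases "N = 1") (auto simp: mesh_size_def)
    have "C * mesh_size N powr (4 - \<alpha>) \<le> (\<bar>C\<bar> + 1) * mesh_size N powr (4 - \<alpha>)"
      by (rule mult_right_mono) auto
    moreover have "0 < mesh_size N" using N by (simp add: mesh_size_def)
    ultimately have "\<bar>tempered_frac_laplacian \<alpha> lam u x - wirfd w L \<alpha> lam (mesh_size N) u x\<bar> \<le> (\<bar>C\<bar> + 1) * mesh_size N powr (4 - \<alpha>)" for x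
      using C order_trans by blast
    then show ?thesis
      unfolding linf_norm_def using finite_grid grid_nonempty[OF \<open>N \<ge> 2\<close>]
      by (subst Max_le_iff) auto
  qed
  then have "\<exists>h0>0. \<forall>N>0. mesh_size N < h0 \<longrightarrow>
           linf_norm (grid N)
             (\<lambda>x. tempered_frac_laplacian \<alpha> lam u x - wirfd w L \<alpha> lam (mesh_size N) u x)
           \<le> (\<bar>C\<bar> + 1) * mesh_size N powr (4 - \<alpha>)"
    by (intro exI[of _ 2]) auto
  moreover have "0 < \<bar>C\<bar> + 1" by simp
  ultimately show ?thesis by blast
qed

end
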